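(* Let $\mathcal A\in\{\mathfrak S,\mathcal B,\mathcal Bs,\mathcal H,\mathcal P\}$. For any integer $N$, let $(M_i^N)_{i\in\mathcal I}$ be a $\mathcal G(\mathcal A)$-invariant family of random matrices of size $N$. For any integers $k$ and $N\geq 2k$, any $(i_1,\dots,i_k)\in\mathcal I^k$ and any $2k$-tuple $\mathcal N=(n_1,n_{1'},\dots,n_k,n_{k'})\in\{1,\dots,N\}^{2k}$, $$\mathbb E\big[(M_{i_1}^N)^{n_1}_{n_{1'}}\cdots(M_{i_k}^N)^{n_k}_{n_{k'}}\big]=\sum_{p_1\in\mathcal A_k,\ p_1\trianglelefteq\mathrm{Ker}(\mathcal N)}\frac{1}{N^{\mathrm{nc}(p_1)-\mathrm{nc}(p_1\vee\mathrm{id}_k)}}\ \mathbb E\kappa^{\mathcal A}_{p_1}(M^N_{i_1},\dots,M^N_{i_k}).$$ Thus, if $(M_i^N)_{i\in\mathcal I}$ converges in $\mathcal A$-distribution, then, as $N\to\infty$, $\mathbb E\big[(M_{i_1}^N)^{n_1}_{n_{1'}}\cdots(M_{i_k}^N)^{n_k}_{n_{k'}}\big]$ is equal to $$N^{\mathrm{nc}(\mathrm{Ker}(\mathcal N)\vee\mathrm{id}_k)-\mathrm{nc}(\mathrm{Ker}(\mathcal N))}\Big(\sum_{p_1\in\mathcal A_k,\ p_1\sqsupset\mathrm{Ker}(\mathcal N)}\mathbb E\kappa^{\mathcal A}_{p_1}(M_{i_1},\dots,M_{i_k})+o(1)\Big).$$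
   Context: Partitions. For $k\ge 0$, $\mathcal P_k$ is the set of partitions of $\{1,\dots,k,1',\dots,k'\}$. $\mathrm{nc}(p)$ is the number of blocks of $p$; $p\vee p'$ is the finest partition coarser than both; $\mathrm{id}_k=\{\{i,i'\}\}$; ${}^tp$ is obtained by exchanging $i$ and $i'$ for every $i$; $p\trianglelefteq p'$ means $p'$ is coarser than $p$. A permutation $\sigma\in\mathfrak S_k$ is identified with $\{\{i,\sigma(i)'\}\}\in\mathcal P_k$. $\mathcal B_k$, $\mathcal H_k$, $\mathcal Bs_k$ are the sets of $p\in\mathcal P_k$ whose blocks all have size $2$, all have even size, all have size at most $2$ respectively. Set $d(p,p')=\frac{\mathrm{nc}(p)+\mathrm{nc}(p')}{2}-\mathrm{nc}(p\vee p')$ and $p\le p'$ if $d(\mathrm{id}_k,p)+d(p,p')=d(\mathrm{id}_k,p')$ (a partial order). Write $p'\sqsupset p$ if $p'$ is finer than $p$ and $\mathrm{nc}(p')-\mathrm{nc}(p'\vee\mathrm{id}_k)=\mathrm{nc}(p)-\mathrm{nc}(p\vee\mathrm{id}_k)$. $E_i^j$ is the $N\times N$ matrix sending $e_j$ to $e_i$ and the other basis vectors to $0$; $(M)_i^j$ denotes the coefficient of $E_i^j$ in $M$ (row $i$, column $j$). For $\mathcal N=(n_1,n_{1'},\dots,n_k,n_{k'})\in\{1,\dots,N\}^{2k}$, $\mathrm{Ker}(\mathcal N)\in\mathcal P_k$ is the partition where $u,v$ are in the same block iff $n_u=n_v$; $\rho_N(p)=\sum_{\mathcal N:\,p\trianglelefteq\mathrm{Ker}(\mathcal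 N)}E_{n_{1'}}^{n_1}\otimes\dots\otimes E_{n_{k'}}^{n_k}$. Groups. $\mathcal G(\mathfrak S)(N)=U(N)$, $\mathcal G(\mathcal B)(N)=O(N)$, $\mathcal G(\mathcal H)(N)$ = signed permutation matrices, $\mathcal G(\mathcal Bs)(N)$ = orthogonal matrices whose rows and columns all sum to $1$, $\mathcal G(\mathcal P)(N)$ = permutation matrices. A family is $\mathcal G(\mathcal A)$-invariant if for every $g\in\mathcal G(\mathcal A)(N)$ and all indices, $(gM_{i_1}g^{-1},\dots,gM_{i_k}g^{-1})$ has the same law as $(M_{i_1},\dots,M_{i_k})$. Random matrices have entries with finite moments of all orders. $\mathbb Em_p(M_1,\dots,M_k)=N^{-\mathrm{nc}(p\vee\mathrm{id}_k)}\mathbb E\,\mathrm{Tr}[(M_1\otimes\dots\otimes M_k)\rho_N({}^tp)]$. $(M_i^N)_i$ converges in $\mathcal A$-distribution if $\mathbb Em_p(M_{i_1}^N,\dots,M^N_{i_k})$ converges for all $k$, $p\in\mathcal A_k$ and indices; the limit is $\mathbb Em_p(M_{i_1},\dots,M_{i_k})$, and the asymptotic $\mathcal A$-cumulants are defined by $\mathbb Em_p(M_{i_1},\dots,M_{i_k})=\sum_{p'\in\mathcal A_k,p'\le p}\mathbb E\kappa_{p'}^{\mathcal A}(M_{i_1},\dots,M_{i_k})$ for all $p\in\mathcal A_k$. Finite-dimensional $\mathcal A$-cumulants ($N\ge2k$): $E=\int_{\mathcal G(\mathcal A)(N)}g^{\otimes k}\,\mathbb E[M_{i_1}^N\otimes\dots\otimes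 M_{i_k}^N]\,(g^{-1})^{\otimes k}dg$ lies in the span of the linearly independent $\rho_N(p)$, $p\in\mathcal A_k$, and the $\mathbb E\kappa_p^{\mathcal A}(M^N_{i_1},\dots,M^N_{i_k})$ are the unique numbers with $E=\sum_{p\in\mathcal A_k}\mathbb E\kappa_p^{\mathcal A}(M^N_{i_1},\dots,M_{i_k}^N)\,N^{\mathrm{nc}(p\vee\mathrm{id}_k)-\mathrm{nc}(p)}\rho_N(p)$. *)

theory Defs
  imports "HOL-Probability.Probability" "HOL-Combinatorics.Permutations"
begin

section \<open>Partitions\<close>

text \<open>
  \<^term>\<open>Inl i\<close> stands for the point $i$ and \<^term>\<open>Inr i\<close> for the point $i'$, with
  $1 \le i \le k$. In \<^term>\<open>refines A p q\<close> the partition \<^term>\<open>p\<close> is the finer one, so for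
  partitions of \<^term>\<open>points k\<close> it is the relation $p \trianglelefteq q$.
\<close>

type_synonym point = "nat + nat"
type_synonym part = "point set set"

definition points :: "nat \<Rightarrow> point set" where
  "points k = {1..k} <+> {1..k}"

definition Parts :: "nat \<Rightarrow> part set" where
  "Parts k = {p. partition_on (points k) p}"

definition nc :: "part \<Rightarrow> nat" where
  "nc p = card p"

definition join :: "nat \<Rightarrow> part \<Rightarrow> part \<Rightarrow> part" where
  "join k p q = (THE r. refines (points k) p r \<and> refines (points k) q r \<and>
     (\<forall>s. refines (points k) p s \<and> refines (points k) q s \<longrightarrow> refines (points k) r s))"

definition perm_part :: "nat \<Rightarrow> (nat \<Rightarrow> nat) \<Rightarrow> part" where
  "perm_part k \<sigma> = (\<lambda>i. {Inl i, Inr (\<sigma> i)}) ` {1..k}"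

definition id_part :: "nat \<Rightarrow> part" where
  "id_part k = perm_part k id"

definition flip :: "point \<Rightarrow> point" where
  "flip u = (case u of Inl i \<Rightarrow> Inr i | Inr i \<Rightarrow> Inl i)"

definition transpose_part :: "part \<Rightarrow> part" where
  "transpose_part p = (\<lambda>b. flip ` b) ` p"

definition pdist :: "nat \<Rightarrow> part \<Rightarrow> part \<Rightarrow> real" where
  "pdist k p q = (real (nc p) + real (nc q)) / 2 - real (nc (join k p q))"

definition geo_le :: "nat \<Rightarrow> part \<Rightarrow> part \<Rightarrow> bool" where
  "geo_le k p q \<longleftrightarrow> pdist k (id_part k) p + pdist k p q = pdist k (id_part k) q"

text \<open>$\mathrm{nc}(p) - \mathrm{nc}(p \vee \mathrm{id}_k)$, as an integer.\<close>

definition defect :: "nat \<Rightarrow> part \<Rightarrow> int" where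
  "defect k p = int (nc p) - int (nc (join k p (id_part k)))"

text \<open>\<^term>\<open>finer_compatible k p' p\<close> is the relation $p' \sqsupset p$.\<close>

definition finer_compatible :: "nat \<Rightarrow> part \<Rightarrow> part \<Rightarrow> bool" where
  "finer_compatible k p' p \<longleftrightarrow> refines (points k) p' p \<and> defect k p' = defect k p"

datatype category = Sym | Brauer | BrauerS | Hyper | AllParts

fun cat_parts :: "category \<Rightarrow> nat \<Rightarrow> part set" where
  "cat_parts Sym k = {perm_part k \<sigma> |\<sigma>. \<sigma> permutes {1..k}}"
| "cat_parts Brauer k = {p \<in> Parts k. \<forall>b\<in>p. card b = 2}"
| "cat_parts BrauerS k = {p \<in> Parts k. \<forall>b\<in>p. card b \<le> 2}"
| "cat_parts Hyper k = {p \<in> Parts k. \<forall>b\<in>p. even (card b)}"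
| "cat_parts AllParts k = Parts k"

text \<open>The kernel of a tuple $(n_1, n_{1'}, \dots, n_k, n_{k'})$, given as a function on
  \<^term>\<open>points k\<close>.\<close>

definition Ker :: "nat \<Rightarrow> (point \<Rightarrow> nat) \<Rightarrow> part" where
  "Ker k n = (\<lambda>u. {v \<in> points k. n v = n u}) ` points k"


section \<open>Matrices and tensor powers\<close>

text \<open>
  The size \<^term>\<open>N\<close> of the matrices tends to infinity, so matrices are functions of a row and a
  column index ranging over an explicit finite set \<^term>\<open>I\<close>: \<^term>\<open>{1..N}\<close> for $N \times N$
  matrices, and the set of multi-indices \<^term>\<open>multi N k\<close> for operators on
  $(\mathbb{C}^N)^{\otimes k}$.
\<close>

type_synonym 'a matrix = "'a \<Rightarrow> 'a \<Rightarrow> complex"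
type_synonym cmat = "nat matrix"
type_synonym tensor = "(nat \<Rightarrow> nat) matrix"

definition mat_mul :: "'a set \<Rightarrow> 'a matrix \<Rightarrow> 'a matrix \<Rightarrow> 'a matrix" where
  "mat_mul I A B = (\<lambda>r c. \<Sum>m\<in>I. A r m * B m c)"

definition mat_trace :: "'a set \<Rightarrow> 'a matrix \<Rightarrow> complex" where
  "mat_trace I A = (\<Sum>r\<in>I. A r r)"

text \<open>Each matrix of size \<^term>\<open>N\<close> has a unique representative vanishing outside the index range.\<close>

definition mats :: "nat \<Rightarrow> cmat set" where
  "mats N = {A. \<forall>a b. a \<notin> {1..N} \<or> b \<notin> {1..N} \<longrightarrow> A a b = 0}"

definition one_mat :: "nat \<Rightarrow> cmat" where
  "one_mat N = (\<lambda>a b. if a = b \<and> a \<in> {1..N} then 1 else 0)"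

definition adj :: "cmat \<Rightarrow> cmat" where
  "adj A = (\<lambda>a b. cnj (A b a))"

definition inv_mat :: "nat \<Rightarrow> cmat \<Rightarrow> cmat" where
  "inv_mat N g = (THE h. h \<in> mats N \<and>
     mat_mul {1..N} g h = one_mat N \<and> mat_mul {1..N} h g = one_mat N)"

text \<open>\<^term>\<open>E_unit i j\<close> is $E_i^j$: it sends $e_j$ to $e_i$.\<close>

definition E_unit :: "nat \<Rightarrow> nat \<Rightarrow> cmat" where
  "E_unit i j = (\<lambda>a b. if a = i \<and> b = j then 1 else 0)"

definition multi :: "nat \<Rightarrow> nat \<Rightarrow> (nat \<Rightarrow> nat) set" where
  "multi N k = {1..k} \<rightarrow>\<^sub>E {1..N}"

definition tensor :: "nat \<Rightarrow> (nat \<Rightarrow> cmat) \<Rightarrow> tensor" where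
  "tensor k X = (\<lambda>r c. \<Prod>j=1..k. X j (r j) (c j))"

definition rho :: "nat \<Rightarrow> nat \<Rightarrow> part \<Rightarrow> tensor" where
  "rho N k p = (\<lambda>r c. \<Sum>n | n \<in> points k \<rightarrow>\<^sub>E {1..N} \<and> refines (points k) p (Ker k n).
     tensor k (\<lambda>j. E_unit (n (Inr j)) (n (Inl j))) r c)"


section \<open>Groups and Haar measure\<close>

definition unitary_group :: "nat \<Rightarrow> cmat set" where
  "unitary_group N = {g \<in> mats N.
     mat_mul {1..N} g (adj g) = one_mat N \<and> mat_mul {1..N} (adj g) g = one_mat N}"

definition orthogonal_group :: "nat \<Rightarrow> cmat set" where
  "orthogonal_group N = {g \<in> mats N. (\<forall>a b. g a b \<in> \<real>) \<and>
     mat_mul {1..N} g (\<lambda>a b. g b a) = one_mat N \<and> mat_mul {1..N} (\<lambda>a b. g b a) g = one_mat N}"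

fun cat_group :: "category \<Rightarrow> nat \<Rightarrow> cmat set" where
  "cat_group Sym N = unitary_group N"
| "cat_group Brauer N = orthogonal_group N"
| "cat_group BrauerS N = {g \<in> orthogonal_group N.
     (\<forall>a\<in>{1..N}. (\<Sum>b=1..N. g a b) = 1) \<and> (\<forall>b\<in>{1..N}. (\<Sum>a=1..N. g a b) = 1)}"
| "cat_group Hyper N = {(\<lambda>a b. if b \<in> {1..N} \<and> a = \<sigma> b then \<epsilon> b else 0) |\<sigma> \<epsilon>.
     \<sigma> permutes {1..N} \<and> (\<forall>b. \<epsilon> b = 1 \<or> \<epsilon> b = - 1)}"
| "cat_group AllParts N = {(\<lambda>a b. if b \<in> {1..N} \<and> a = \<sigma> b then 1 else 0) |\<sigma>. \<sigma> permutes {1..N}}"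

text \<open>\<^term>\<open>\<mu>\<close> is the normalised Haar measure of the compact group \<^term>\<open>G\<close>. The Borel sets are those
  of the product topology on functions, which induces on \<^term>\<open>mats N\<close> the topology of
  $\mathbb{C}^{N \times N}$.\<close>

definition haar_measure :: "nat \<Rightarrow> cmat set \<Rightarrow> cmat measure \<Rightarrow> bool" where
  "haar_measure N G \<mu> \<longleftrightarrow> prob_space \<mu> \<and> space \<mu> = G \<and> sets \<mu> = sets (restrict_space borel G) \<and>
     (\<forall>h\<in>G. distr \<mu> \<mu> (\<lambda>g. mat_mul {1..N} h g) = \<mu>)"


section \<open>Random matrices\<close>

definition random_matrix :: "'w measure \<Rightarrow> nat \<Rightarrow> ('w \<Rightarrow> cmat) \<Rightarrow> bool" where
  "random_matrix P N X \<longleftrightarrow> (\<forall>a\<in>{1..N}. \<forall>b\<in>{1..N}.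
     (\<lambda>\<omega>. X \<omega> a b) \<in> borel_measurable P \<and> (\<forall>m::nat. integrable P (\<lambda>\<omega>. cmod (X \<omega> a b) ^ m)))"

definition joint_law ::
    "'w measure \<Rightarrow> nat \<Rightarrow> nat \<Rightarrow> (nat \<Rightarrow> 'w \<Rightarrow> cmat) \<Rightarrow> (nat \<times> nat \<times> nat \<Rightarrow> complex) measure" where
  "joint_law P N k X = distr P (\<Pi>\<^sub>M x\<in>{1..k} \<times> {1..N} \<times> {1..N}. borel)
     (\<lambda>\<omega>. \<lambda>(j, a, b)\<in>{1..k} \<times> {1..N} \<times> {1..N}. X j \<omega> a b)"

definition invariant_family :: "category \<Rightarrow> 'w measure \<Rightarrow> nat \<Rightarrow> ('i \<Rightarrow> 'w \<Rightarrow> cmat) \<Rightarrow> bool" where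
  "invariant_family A P N M \<longleftrightarrow> (\<forall>g\<in>cat_group A N. \<forall>k (i :: nat \<Rightarrow> 'i).
     joint_law P N k
       (\<lambda>j \<omega>. mat_mul {1..N} (mat_mul {1..N} g (M (i j) \<omega>)) (inv_mat N g)) =
     joint_law P N k (\<lambda>j. M (i j)))"

definition moment ::
    "'w measure \<Rightarrow> nat \<Rightarrow> nat \<Rightarrow> (nat \<Rightarrow> 'w \<Rightarrow> cmat) \<Rightarrow> part \<Rightarrow> complex" where
  "moment P N k X p = inverse (of_nat N ^ nc (join k p (id_part k))) *
     (\<integral>\<omega>. mat_trace (multi N k)
        (mat_mul (multi N k) (tensor k (\<lambda>j. X j \<omega>)) (rho N k (transpose_part p))) \<partial>P)"

definition converges_in_distribution ::
    "category \<Rightarrow> (nat \<Rightarrow> 'w measure) \<Rightarrow> (nat \<Rightarrow> 'i \<Rightarrow> 'w \<Rightarrow> cmat) \<Rightarrow> bool" where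
  "converges_in_distribution A P M \<longleftrightarrow> (\<forall>k. \<forall>p\<in>cat_parts A k. \<forall>i :: nat \<Rightarrow> 'i.
     convergent (\<lambda>N. moment (P N) N k (\<lambda>j. M N (i j)) p))"

definition limit_moment ::
    "(nat \<Rightarrow> 'w measure) \<Rightarrow> (nat \<Rightarrow> 'i \<Rightarrow> 'w \<Rightarrow> cmat) \<Rightarrow> nat \<Rightarrow> (nat \<Rightarrow> 'i) \<Rightarrow> part \<Rightarrow> complex" where
  "limit_moment P M k i p = lim (\<lambda>N. moment (P N) N k (\<lambda>j. M N (i j)) p)"


section \<open>Cumulants\<close>

text \<open>In both definitions the cumulants are set to \<open>0\<close> off \<^term>\<open>cat_parts A k\<close>, so that the
  function that they form is unique.\<close>

definition asym_cumulant ::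
    "category \<Rightarrow> (nat \<Rightarrow> 'w measure) \<Rightarrow> (nat \<Rightarrow> 'i \<Rightarrow> 'w \<Rightarrow> cmat) \<Rightarrow> nat \<Rightarrow> (nat \<Rightarrow> 'i) \<Rightarrow> part \<Rightarrow> complex"
  where "asym_cumulant A P M k i = (THE \<kappa>. (\<forall>p. p \<notin> cat_parts A k \<longrightarrow> \<kappa> p = 0) \<and>
     (\<forall>p\<in>cat_parts A k. limit_moment P M k i p =
        (\<Sum>p' | p' \<in> cat_parts A k \<and> geo_le k p' p. \<kappa> p')))"

definition mean_tensor :: "'w measure \<Rightarrow> nat \<Rightarrow> (nat \<Rightarrow> 'w \<Rightarrow> cmat) \<Rightarrow> tensor" where
  "mean_tensor P k X = (\<lambda>r c. \<integral>\<omega>. tensor k (\<lambda>j. X j \<omega>) r c \<partial>P)"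

definition haar_average :: "cmat measure \<Rightarrow> nat \<Rightarrow> nat \<Rightarrow> tensor \<Rightarrow> tensor" where
  "haar_average \<mu> N k T = (\<lambda>r c. \<integral>g. mat_mul (multi N k)
     (mat_mul (multi N k) (tensor k (\<lambda>_. g)) T) (tensor k (\<lambda>_. inv_mat N g)) r c \<partial>\<mu>)"

definition fin_cumulant ::
    "category \<Rightarrow> cmat measure \<Rightarrow> 'w measure \<Rightarrow> nat \<Rightarrow> nat \<Rightarrow> (nat \<Rightarrow> 'w \<Rightarrow> cmat) \<Rightarrow> part \<Rightarrow> complex" where
  "fin_cumulant A \<mu> P N k X = (THE \<kappa>. (\<forall>p. p \<notin> cat_parts A k \<longrightarrow> \<kappa> p = 0) \<and>
     (\<forall>r\<in>multi N k. \<forall>c\<in>multi N k. haar_average \<mu> N k (mean_tensor P k X) r c =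
        (\<Sum>p\<in>cat_parts A k. \<kappa> p * of_nat N powi (- defect k p) * rho N k p r c)))"

text \<open>$\mathbb{E}[(X_1)^{n_1}_{n_{1'}} \cdots (X_k)^{n_k}_{n_{k'}}]$; the lower index is the row.\<close>

definition entry_moment ::
    "'w measure \<Rightarrow> nat \<Rightarrow> (nat \<Rightarrow> 'w \<Rightarrow> cmat) \<Rightarrow> (point \<Rightarrow> nat) \<Rightarrow> complex" where
  "entry_moment P k X n = (\<integral>\<omega>. (\<Prod>j=1..k. X j \<omega> (n (Inr j)) (n (Inl j))) \<partial>P)"

end

theory Submission
  imports Defs
begin

text \<open>
  Write $F(n)$ for the entry moment at the tuple $n$ of indices. Invariance in law says that the tensor $F$ is
  invariant under the group, so the Haar average in the definition of the finite-dimensional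
  cumulants is $F$ itself, and the exact formula says that $F$ is a combination of the tensors $\rho_N(p)$ with
  $p \in \mathcal{A}_k$, with unique coefficients. For all five groups this is proved in the range $N \ge 2k$ by elementary
  means. Each group contains the permutation matrices, so $F(n)$ depends only on $\mathrm{Ker}(n)$; since every partition
  is a kernel, Moebius inversion gives unique coefficients with
  \[ F(n) = \sum_{q \trianglelefteq \mathrm{Ker}(n)} a_q, \]
  where $q$ runs through all partitions (\<open>partition_expansion_exists\<close>, \<open>partition_expansion_unique\<close>). The coefficients
  outside $\mathcal{A}_k$ vanish, by induction starting with the finest partitions:

  \<^item> changing the sign of one basis vector excludes odd blocks (\<open>hyperoctahedral_coefficients\<close>);
  \<^item> differentiating a rotation of three basis vectors around the axis $(1,1,1)$ gives a linear relation between
    values of $F$ that excludes blocks with more than two elements (\<open>bistochastic_coefficients\<close>);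
  \<^item> multiplying one basis vector by the imaginary unit excludes pairs of two primed or two unprimed
    points (\<open>unmixed_pair_vanishes\<close>).

  Since $U(N) \supseteq O(N)$ and $O(N)$ contains the signed permutation matrices and these rotations, the three
  facts cover all categories (\<open>invariant_tensor_expansion\<close>).

  For the asymptotic formula, summing the expansion against $\rho_N({}^t p)$ gives
  \[ \mathbb{E} m_p = \sum_{q \in \mathcal{A}_k} N^{-(d(\mathrm{id}_k, q) + d(q, p) - d(\mathrm{id}_k, p))}\, \mathbb{E}\kappa_q \]
  (\<open>moment_eq_fin_cumulants\<close>). The exponent is nonpositive by the triangle inequality for $d$
  (\<open>nc_join_triangle\<close>), and it is zero exactly when $q \le p$. In the limit this becomes the unitriangular system that
  defines the asymptotic cumulants, so the finite-dimensional cumulants converge to them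
  (\<open>perturbed_triangular_systems_converge\<close>, \<open>fin_cumulant_tendsto\<close>). Finally, the defect
  $\mathrm{nc}(p) - \mathrm{nc}(p \vee \mathrm{id}_k)$ can only grow when $p$ is refined (\<open>defect_antimono\<close>). In the exact
  formula, a term with the same defect as $\mathrm{Ker}(\mathcal{N})$ therefore has the leading order, and every other
  term is smaller by a factor $1/N$ at least.
\<close>

section \<open>Partitions and the tuples that are constant on their blocks\<close>

lemma finite_points: "finite (points k)"
  by (simp add: points_def)

lemma finite_Parts: "finite (Parts k)"
  unfolding Parts_def by (rule finitely_many_partition_on[OF finite_points])

lemma finite_part: "p \<in> Parts k \<Longrightarrow> finite p"
  unfolding Parts_def using finite_elements[OF finite_points] by blast

lemma finite_block: "p \<in> Parts k \<Longrightarrow> b \<in> p \<Longrightarrow> finite b"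
  unfolding Parts_def by (metis finite_points finite_subset mem_Collect_eq partition_onD1 Sup_upper)

text \<open>
  For a tuple \<open>n\<close> of indices this is the relation $p \trianglelefteq \mathrm{Ker}(n)$. It is kept
  polymorphic because it is also used for \<^typ>\<open>bool\<close>-valued functions, which encode unions of blocks.
\<close>

definition blockwise_const :: "part \<Rightarrow> (point \<Rightarrow> 'a) \<Rightarrow> bool" where
  "blockwise_const p n \<longleftrightarrow> (\<forall>b\<in>p. \<forall>u\<in>b. \<forall>v\<in>b. n u = n v)"

lemma blockwise_constD: "blockwise_const p n \<Longrightarrow> b \<in> p \<Longrightarrow> u \<in> b \<Longrightarrow> v \<in> b \<Longrightarrow> n u = n v"
  unfolding blockwise_const_def by blast

definition block_of :: "part \<Rightarrow> point \<Rightarrow> point set" where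
  "block_of p u = (THE b. b \<in> p \<and> u \<in> b)"

lemma block_of_eq: "p \<in> Parts k \<Longrightarrow> b \<in> p \<Longrightarrow> u \<in> b \<Longrightarrow> block_of p u = b"
  unfolding block_of_def Parts_def partition_on_def disjoint_def
  by (rule the_equality) auto

lemma block_of_in: 
  assumes "p \<in> Parts k" "u \<in> points k" shows "block_of p u \<in> p" "u \<in> block_of p u"
proof -
  obtain b where "b \<in> p" "u \<in> b" using assms unfolding Parts_def partition_on_def by auto
  then show "block_of p u \<in> p" "u \<in> block_of p u" using block_of_eq[OF assms(1)] by auto
qed

lemma block_subset: "p \<in> Parts k \<Longrightarrow> b \<in> p \<Longrightarrow> b \<subseteq> points k"
  unfolding Parts_def partition_on_def by blast

lemma block_nonempty: "p \<in> Parts k \<Longrightarrow> b \<in> p \<Longrightarrow> b \<noteq> {}"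
  unfolding Parts_def partition_on_def by blast

lemma block_disjoint: "p \<in> Parts k \<Longrightarrow> b \<in> p \<Longrightarrow> c \<in> p \<Longrightarrow> u \<in> b \<Longrightarrow> u \<in> c \<Longrightarrow> b = c"
  using block_of_eq by metis

lemma block_of_image: assumes "p \<in> Parts k" shows "block_of p ` points k = p"
proof
  show "block_of p ` points k \<subseteq> p" using block_of_in[OF assms] by auto
  show "p \<subseteq> block_of p ` points k"
  proof
    fix b assume b: "b \<in> p"
    then obtain u where u: "u \<in> b" using block_nonempty[OF assms] by blast
    then have "u \<in> points k" "block_of p u = b"
      using block_of_eq[OF assms b] block_subset[OF assms b] by auto
    then show "b \<in> block_of p ` points k" by blast
  qed
qed

lemma Ker_in_Parts: "Ker k n \<in> Parts k"
  unfolding Parts_def Ker_def partition_on_def disjoint_def by auto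

lemma refines_Ker_iff:
  assumes "p \<in> Parts k"
  shows "refines (points k) p (Ker k n) \<longleftrightarrow> blockwise_const p n"
proof
  assume ref: "refines (points k) p (Ker k n)"
  show "blockwise_const p n"
    unfolding blockwise_const_def
  proof (intro ballI)
    fix b u v assume b: "b \<in> p" "u \<in> b" "v \<in> b"
    obtain Y where "Y \<in> Ker k n" "b \<subseteq> Y" using ref b(1) unfolding refines_def by blast
    then obtain w where "b \<subseteq> {v \<in> points k. n v = n w}" unfolding Ker_def by blast
    then have "n u = n w" "n v = n w" using b by blast+
    then show "n u = n v" by simp
  qed
next
  assume bc: "blockwise_const p n"
  have "\<exists>Y\<in>Ker k n. b \<subseteq> Y" if "b \<in> p" for b
  proof -
    obtain u where "u \<in> b" using block_nonempty[OF assms \<open>b \<in> p\<close>] by blast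
    then have "b \<subseteq> {v \<in> points k. n v = n u}" "u \<in> points k"
      using block_subset[OF assms that] blockwise_constD[OF bc that] by blast+
    then show ?thesis unfolding Ker_def by blast
  qed
  then show "refines (points k) p (Ker k n)"
    using assms Ker_in_Parts unfolding refines_def Parts_def by blast
qed

lemma Ker_eqI:
  assumes "p \<in> Parts k" "\<And>u v. u \<in> points k \<Longrightarrow> v \<in> points k \<Longrightarrow> n u = n v \<longleftrightarrow> block_of p u = block_of p v"
  shows "Ker k n = p"
proof -
  have eq: "{v \<in> points k. n v = n u} = block_of p u" if "u \<in> points k" for u
    using assms that block_of_in[OF assms(1)] block_of_eq[OF assms(1)] block_subset[OF assms(1)]
    by blast
  have "Ker k n = block_of p ` points k"
    unfolding Ker_def using eq by auto
  then show ?thesis using block_of_image[OF assms(1)] by simp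
qed

text \<open>
  Colouring the blocks of \<open>p\<close> with distinct elements of \<open>S\<close> realises \<open>p\<close> as a kernel. The bound on
  the number of values leaves room for fresh indices later on.
\<close>

lemma exists_tuple_with_Ker:
  assumes p: "p \<in> Parts k" and S: "finite S" "nc p \<le> card S"
  obtains n where "n \<in> points k \<rightarrow>\<^sub>E S" "Ker k n = p" "card (n ` points k) \<le> nc p"
proof -
  obtain f where f: "f ` p \<subseteq> S" "inj_on f p"
    using card_le_inj[OF finite_part[OF p] S(1) S(2)[unfolded nc_def]] by blast
  define n where "n = (\<lambda>u\<in>points k. f (block_of p u))"
  have nS: "n \<in> points k \<rightarrow>\<^sub>E S" using f block_of_in[OF p] unfolding n_def by auto
  have Kn: "Ker k n = p"
    using f(2) block_of_in[OF p] by (intro Ker_eqI[OF p]) (auto simp: n_def inj_on_eq_iff)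
  have "card (n ` points k) \<le> nc p"
  proof -
    have "n ` points k \<subseteq> f ` p" using block_of_in[OF p] unfolding n_def by auto
    then have "card (n ` points k) \<le> card (f ` p)"
      using finite_part[OF p] by (intro card_mono) auto
    also have "\<dots> \<le> nc p" unfolding nc_def using finite_part[OF p] by (rule card_image_le)
    finally show ?thesis .
  qed
  with nS Kn show ?thesis by (rule that)
qed

lemma card_points: "card (points k) = 2 * k"
  unfolding points_def by (simp add: card_Plus)

lemma nc_le: "p \<in> Parts k \<Longrightarrow> nc p \<le> 2 * k"
  using card_image_le[OF finite_points, of "block_of p" k] block_of_image[of p k] card_points
  unfolding nc_def by simp

text \<open>
  Such a tuple is a free choice of one value per block. With $S = \{1, \dots, N\}$ this count produces all the
  powers of $N$; with two values it turns identities and inequalities between numbers of blocks into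
  statements about finite sets.
\<close>

lemma card_blockwise_const:
  assumes p: "p \<in> Parts k"
  shows "card {n \<in> points k \<rightarrow>\<^sub>E S. blockwise_const p n} = card S ^ nc p"
proof -
  have "bij_betw (\<lambda>f. \<lambda>u\<in>points k. f (block_of p u)) (p \<rightarrow>\<^sub>E S)
     {n \<in> points k \<rightarrow>\<^sub>E S. blockwise_const p n}"
  proof (rule bij_betw_byWitness[where f' = "\<lambda>n. \<lambda>b\<in>p. n (SOME u. u \<in> b)"])
    have some: "(SOME u. u \<in> b) \<in> b" "(SOME u. u \<in> b) \<in> points k" if "b \<in> p" for b
      using block_nonempty[OF p that] block_subset[OF p that] some_in_eq by blast+
    show "\<forall>f\<in>p \<rightarrow>\<^sub>E S. (\<lambda>b\<in>p. (\<lambda>u\<in>points k. f (block_of p u)) (SOME u. u \<in> b)) = f"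
      using some block_of_eq[OF p]
      by (fastforce simp: fun_eq_iff PiE_iff extensional_def restrict_def)
    show "\<forall>n\<in>{n \<in> points k \<rightarrow>\<^sub>E S. blockwise_const p n}.
      (\<lambda>u\<in>points k. (\<lambda>b\<in>p. n (SOME u. u \<in> b)) (block_of p u)) = n"
    proof
      fix n assume n: "n \<in> {n \<in> points k \<rightarrow>\<^sub>E S. blockwise_const p n}"
      show "(\<lambda>u\<in>points k. (\<lambda>b\<in>p. n (SOME u. u \<in> b)) (block_of p u)) = n"
      proof
        fix u
        show "(\<lambda>u\<in>points k. (\<lambda>b\<in>p. n (SOME u. u \<in> b)) (block_of p u)) u = n u"
        proof (cases "u \<in> points k")
          case True
          then have "n (SOME w. w \<in> block_of p u) = n u"
            using n block_of_in[OF p True] some by (intro blockwise_constD[of p n "block_of p u"]) auto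
          then show ?thesis using True block_of_in[OF p True] by simp
        qed (use n in auto)
      qed
    qed
    show "(\<lambda>f. \<lambda>u\<in>points k. f (block_of p u)) ` (p \<rightarrow>\<^sub>E S) \<subseteq> {n \<in> points k \<rightarrow>\<^sub>E S. blockwise_const p n}"
    proof
      fix n assume "n \<in> (\<lambda>f. \<lambda>u\<in>points k. f (block_of p u)) ` (p \<rightarrow>\<^sub>E S)"
      then obtain f where f: "f \<in> p \<rightarrow>\<^sub>E S" and n: "n = (\<lambda>u\<in>points k. f (block_of p u))" by blast
      have "n \<in> points k \<rightarrow>\<^sub>E S" unfolding n using f block_of_in(1)[OF p] by auto
      moreover have "n u = f b" if "b \<in> p" "u \<in> b" for b u
        using block_of_eq[OF p that] subsetD[OF block_subset[OF p that(1)] that(2)] unfolding n by simp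
      then have "blockwise_const p n" unfolding blockwise_const_def by simp
      ultimately show "n \<in> {n \<in> points k \<rightarrow>\<^sub>E S. blockwise_const p n}" by blast
    qed
    show "(\<lambda>n. \<lambda>b\<in>p. n (SOME u. u \<in> b)) ` {n \<in> points k \<rightarrow>\<^sub>E S. blockwise_const p n} \<subseteq> p \<rightarrow>\<^sub>E S"
      using some by (auto simp: PiE_iff)
  qed
  from bij_betw_same_card[OF this] show ?thesis
    using card_funcsetE[OF finite_part[OF p], of S] unfolding nc_def by simp
qed

lemma blockwise_const_refines:
  assumes "refines A p q" "blockwise_const q n" shows "blockwise_const p n"
  unfolding blockwise_const_def
proof (intro ballI)
  fix b u v assume b: "b \<in> p" "u \<in> b" "v \<in> b"
  obtain c where "c \<in> q" "b \<subseteq> c" using assms(1) b(1) unfolding refines_def by blast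
  then show "n u = n v" using b blockwise_constD[OF assms(2)] by blast
qed

text \<open>
  A partition is determined by the unions of its blocks, and refinement reverses inclusion between
  these families of sets.
\<close>

lemma refines_iff_blockwise_const:
  assumes p: "p \<in> Parts k" and q: "q \<in> Parts k"
  shows "refines (points k) p q \<longleftrightarrow> (\<forall>n :: point \<Rightarrow> bool. blockwise_const q n \<longrightarrow> blockwise_const p n)"
proof
  assume "refines (points k) p q"
  then show "\<forall>n :: point \<Rightarrow> bool. blockwise_const q n \<longrightarrow> blockwise_const p n"
    using blockwise_const_refines by blast
next
  assume *: "\<forall>n :: point \<Rightarrow> bool. blockwise_const q n \<longrightarrow> blockwise_const p n"
  have "\<exists>Y\<in>q. b \<subseteq> Y" if b: "b \<in> p" for b
  proof -
    obtain u where u: "u \<in> b" using block_nonempty[OF p b] by blast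
    then have up: "u \<in> points k" using block_subset[OF p b] by blast
    have "blockwise_const q (\<lambda>v. v \<in> block_of q u)"
      unfolding blockwise_const_def
    proof (intro ballI)
      fix c v w assume c: "c \<in> q" "v \<in> c" "w \<in> c"
      show "(v \<in> block_of q u) = (w \<in> block_of q u)"
        using block_disjoint[OF q c(1) block_of_in(1)[OF q up]] c(2,3) by blast
    qed
    then have "blockwise_const p (\<lambda>v. v \<in> block_of q u)" using * by blast
    then have "b \<subseteq> block_of q u" using u b block_of_in[OF q up] unfolding blockwise_const_def by blast
    then show ?thesis using block_of_in[OF q up] by blast
  qed
  then show "refines (points k) p q" using p q unfolding refines_def Parts_def by blast
qed

text \<open>
  The join is the quotient by the equivalence relation that no union of blocks of both \<open>p\<close> and \<open>q\<close>
  can separate. Its blockwise constant functions are those that are blockwise constant for both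
  partitions, which is how the join enters all computations below.
\<close>

lemma
  assumes p: "p \<in> Parts k" and q: "q \<in> Parts k"
  shows join_in_Parts: "join k p q \<in> Parts k"
    and blockwise_const_join:
      "blockwise_const (join k p q) n \<longleftrightarrow> blockwise_const p n \<and> blockwise_const q (n :: point \<Rightarrow> 'a)"
proof -
  define R where "R = {(u, v). u \<in> points k \<and> v \<in> points k \<and>
     (\<forall>n :: point \<Rightarrow> bool. blockwise_const p n \<and> blockwise_const q n \<longrightarrow> n u = n v)}"
  have eqR: "equiv (points k) R"
    unfolding R_def by (intro equivI refl_onI symI transI) auto
  define r where "r = points k // R"
  have r: "r \<in> Parts k" unfolding r_def Parts_def using partition_on_quotient[OF eqR] by simp
  have same: "(u, v) \<in> R" if "b \<in> r" "u \<in> b" "v \<in> b" for b u v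
    using that eqR unfolding r_def by (meson quotient_eq_iff)
  have fwd: "blockwise_const r n" if "blockwise_const p n" "blockwise_const q n"
    for n :: "point \<Rightarrow> 'b"
    unfolding blockwise_const_def
  proof (intro ballI)
    fix b u v assume "b \<in> r" "u \<in> b" "v \<in> b"
    then have "(u, v) \<in> R" using same by blast
    then have R: "\<And>m :: point \<Rightarrow> bool. blockwise_const p m \<Longrightarrow> blockwise_const q m \<Longrightarrow> m u = m v"
      unfolding R_def by simp
    \<comment> \<open>The level sets of \<open>n\<close> are unions of blocks, so they cannot separate equivalent points.\<close>
    have level: "blockwise_const s (\<lambda>w. n w = n u)" if "blockwise_const s n" for s
      unfolding blockwise_const_def
    proof (intro ballI)
      fix c v w assume "c \<in> s" "v \<in> c" "w \<in> c"
      then have "n v = n w" by (rule blockwise_constD[OF that])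
      then show "(n v = n u) = (n w = n u)" by simp
    qed
    have "(n u = n u) = (n v = n u)"
      by (rule R[OF level[OF that(1)] level[OF that(2)]])
    then show "n u = n v" by simp
  qed
  have sub: "refines (points k) s r"
    if s: "s \<in> Parts k" and sR: "\<And>b u v. b \<in> s \<Longrightarrow> u \<in> b \<Longrightarrow> v \<in> b \<Longrightarrow> (u, v) \<in> R" for s
  proof -
    have "\<exists>Y\<in>r. b \<subseteq> Y" if b: "b \<in> s" for b
    proof -
      obtain u where u: "u \<in> b" using block_nonempty[OF s b] by blast
      then have "b \<subseteq> R `` {u}" using sR[OF b u] by blast
      moreover have "R `` {u} \<in> r" unfolding r_def using u block_subset[OF s b] by (intro quotientI) blast
      ultimately show ?thesis by blast
    qed
    then show ?thesis using s r unfolding refines_def Parts_def by blast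
  qed
  have pr: "refines (points k) p r" and qr: "refines (points k) q r"
  proof -
    have "(u, v) \<in> R" if "b \<in> p \<or> b \<in> q" "u \<in> b" "v \<in> b" for b u v
    proof -
      have "u \<in> points k" "v \<in> points k" using that block_subset[OF p] block_subset[OF q] by blast+
      moreover have "n u = n v" if "blockwise_const p n" "blockwise_const q n" for n :: "point \<Rightarrow> bool"
        using \<open>b \<in> p \<or> b \<in> q\<close> \<open>u \<in> b\<close> \<open>v \<in> b\<close> that by (auto dest: blockwise_constD)
      ultimately show ?thesis unfolding R_def by simp
    qed
    then show "refines (points k) p r" "refines (points k) q r" by (blast intro: sub p q)+
  qed
  have least: "refines (points k) r s" if "refines (points k) p s" "refines (points k) q s" for s
  proof -
    have s: "s \<in> Parts k" using that unfolding refines_def Parts_def by blast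
    show ?thesis
      using that refines_iff_blockwise_const[OF p s] refines_iff_blockwise_const[OF q s]
        refines_iff_blockwise_const[OF r s] fwd by blast
  qed
  have jr: "join k p q = r"
    unfolding join_def
  proof (rule the_equality)
    show "refines (points k) p r \<and> refines (points k) q r \<and>
     (\<forall>s. refines (points k) p s \<and> refines (points k) q s \<longrightarrow> refines (points k) r s)"
      using pr qr least by blast
  next
    fix r' assume "refines (points k) p r' \<and> refines (points k) q r' \<and>
     (\<forall>s. refines (points k) p s \<and> refines (points k) q s \<longrightarrow> refines (points k) r' s)"
    then show "r' = r" using pr qr least refines_asym by blast
  qed
  show "join k p q \<in> Parts k" using jr r by simp
  have "blockwise_const p n \<and> blockwise_const q n" if "blockwise_const r n"
    using that pr qr blockwise_const_refines by blast
  then show "blockwise_const (join k p q) n \<longleftrightarrow> blockwise_const p n \<and> blockwise_const q n"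
    using fwd[of n] jr by blast
qed

lemma join_refines:
  assumes "p \<in> Parts k" "q \<in> Parts k"
  shows "refines (points k) p (join k p q)" "refines (points k) q (join k p q)"
  using assms join_in_Parts[OF assms]
  by (simp_all add: refines_iff_blockwise_const blockwise_const_join)

lemma join_commute:
  assumes "p \<in> Parts k" "q \<in> Parts k" shows "join k p q = join k q p"
  using assms join_in_Parts
  by (intro refines_asym[of "points k"]) (auto simp: refines_iff_blockwise_const blockwise_const_join)

lemma join_absorb:
  assumes "refines (points k) p q" shows "join k q p = q"
proof -
  have "p \<in> Parts k" "q \<in> Parts k" using assms unfolding refines_def Parts_def by auto
  with assms show ?thesis using join_in_Parts
  by (intro refines_asym[of "points k"]) (auto simp: refines_iff_blockwise_const blockwise_const_join)
qed

text \<open>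
  The unions of blocks of \<open>q\<close> are among those of \<open>p\<close>, and there are $2^{\mathrm{nc}}$ of them.
\<close>

lemma nc_refines:
  assumes "refines (points k) p q"
  shows "nc q \<le> nc p" and "nc q = nc p \<Longrightarrow> p = q"
proof -
  have pq: "p \<in> Parts k" "q \<in> Parts k" using assms unfolding refines_def Parts_def by auto
  let ?W = "\<lambda>p. {n \<in> points k \<rightarrow>\<^sub>E (UNIV :: bool set). blockwise_const p n}"
  have fin: "finite (?W p)" using finite_points by (simp add: finite_PiE)
  have sub: "?W q \<subseteq> ?W p" using assms refines_iff_blockwise_const[OF pq] by blast
  have "(2::nat) ^ nc q \<le> 2 ^ nc p"
    using card_mono[OF fin sub]
    unfolding card_blockwise_const[OF pq(1)] card_blockwise_const[OF pq(2)] card_UNIV_bool .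
  then show "nc q \<le> nc p" by simp
  assume "nc q = nc p"
  then have eq: "?W q = ?W p"
    by (intro card_subset_eq[OF fin sub]) (simp add: card_blockwise_const pq)
  have "blockwise_const q n" if n: "blockwise_const p n" for n :: "point \<Rightarrow> bool"
  proof -
    have res: "blockwise_const s (restrict n (points k)) = blockwise_const s n" if "s \<in> Parts k" for s
    proof -
      have "restrict n (points k) u = n u" if "b \<in> s" "u \<in> b" for b u
        using block_subset[OF \<open>s \<in> Parts k\<close> that(1)] that(2) by auto
      then show ?thesis unfolding blockwise_const_def by simp
    qed
    have "restrict n (points k) \<in> ?W p" using n res[OF pq(1)] by auto
    then show ?thesis using eq res[OF pq(2)] by blast
  qed
  then have "refines (points k) q p" using refines_iff_blockwise_const pq by blast
  then show "p = q" using assms refines_asym by blast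
qed

text \<open>
  This is the triangle inequality for the distance \<^const>\<open>pdist\<close>. Let $W_p$ be the group of unions of blocks of
  \<open>p\<close> under symmetric difference; it has $2^{\mathrm{nc}(p)}$ elements and $W_{p \vee q} = W_p \cap W_q$. The map
  $(m, n) \mapsto m + n$ sends $W_{p \vee q} \times W_{q \vee r}$ into $W_q$, and two elements of one of its fibres differ
  by an element of $W_p \cap W_q \cap W_r \subseteq W_{p \vee r}$. Hence
  $|W_{p \vee q}|\,|W_{q \vee r}| \le |W_q|\,|W_{p \vee r}|$.
\<close>

lemma nc_join_triangle:
  assumes p: "p \<in> Parts k" and q: "q \<in> Parts k" and r: "r \<in> Parts k"
  shows "nc (join k p q) + nc (join k q r) \<le> nc q + nc (join k p r)"
proof -
  let ?W = "\<lambda>p. {n \<in> points k \<rightarrow>\<^sub>E (UNIV :: bool set). blockwise_const p n}"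
  have fin: "finite (?W p)" for p using finite_points by (simp add: finite_PiE)
  define xor where "xor = (\<lambda>(m, n). \<lambda>u\<in>points k. (m u :: bool) \<noteq> n u)"
  have xor_const: "blockwise_const s (xor (m, n))"
    if "s \<in> Parts k" "blockwise_const s m" "blockwise_const s n" for s m n
    unfolding blockwise_const_def
  proof (intro ballI)
    fix b u v assume b: "b \<in> s" "u \<in> b" "v \<in> b"
    then have "u \<in> points k" "v \<in> points k" using block_subset[OF that(1) b(1)] by blast+
    then show "xor (m, n) u = xor (m, n) v"
      using blockwise_constD[OF that(2) b] blockwise_constD[OF that(3) b] unfolding xor_def by simp
  qed
  let ?X = "?W (join k p q) \<times> ?W (join k q r)"
  define X where "X = ?X"
  have xq: "xor ` X \<subseteq> ?W q"
  proof clarify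
    fix m n assume "(m, n) \<in> X"
    then have "blockwise_const q m" "blockwise_const q n"
      unfolding X_def by (simp_all add: blockwise_const_join p q r)
    then show "xor (m, n) \<in> points k \<rightarrow>\<^sub>E UNIV \<and> blockwise_const q (xor (m, n))"
      using xor_const[OF q] unfolding xor_def by simp
  qed
  have fibre: "card {z \<in> X. xor z = w} \<le> card (?W (join k p r))" if w: "w \<in> xor ` X" for w
  proof -
    obtain m0 n0 where z0: "(m0, n0) \<in> X" "xor (m0, n0) = w" using w by auto
    let ?h = "\<lambda>z. xor (fst z, m0)"
    have "inj_on ?h {z \<in> X. xor z = w}"
    proof (rule inj_onI)
      fix z z' assume z: "z \<in> {z \<in> X. xor z = w}" "z' \<in> {z \<in> X. xor z = w}" "?h z = ?h z'"
      obtain m n m' n' where zz: "z = (m, n)" "z' = (m', n')" by fastforce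
      have ext: "m \<in> points k \<rightarrow>\<^sub>E UNIV" "n \<in> points k \<rightarrow>\<^sub>E UNIV" "m' \<in> points k \<rightarrow>\<^sub>E UNIV" "n' \<in> points k \<rightarrow>\<^sub>E UNIV"
        using z zz unfolding X_def by auto
      have *: "(m u \<noteq> m0 u) = (m' u \<noteq> m0 u)" "(m u \<noteq> n u) = (m' u \<noteq> n' u)" if "u \<in> points k" for u
      proof -
        have "xor (m, m0) u = xor (m', m0) u" "xor (m, n) u = xor (m', n') u" using z zz by auto
        then show "(m u \<noteq> m0 u) = (m' u \<noteq> m0 u)" "(m u \<noteq> n u) = (m' u \<noteq> n' u)"
          using that unfolding xor_def by auto
      qed
      have "m = m'" "n = n'" by (rule PiE_ext[OF ext(1,3)] PiE_ext[OF ext(2,4)], use * in blast)+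
      then show "z = z'" using zz by simp
    qed
    moreover have "?h ` {z \<in> X. xor z = w} \<subseteq> ?W (join k p r)"
    proof clarify
      fix m n assume z: "(m, n) \<in> X" "w = xor (m, n)"
      have eq: "xor (m, m0) = xor (n, n0)"
      proof
        fix u
        have "xor (m, n) u = xor (m0, n0) u" using z z0(2) by simp
        then show "xor (m, m0) u = xor (n, n0) u" unfolding xor_def by (cases "u \<in> points k") auto
      qed
      have "blockwise_const p (xor (m, m0))"
        using z z0 by (intro xor_const p) (auto simp: X_def blockwise_const_join p q)
      moreover have "blockwise_const r (xor (n, n0))"
        using z z0 by (intro xor_const r) (auto simp: X_def blockwise_const_join r q)
      ultimately show "xor (fst (m, n), m0) \<in> points k \<rightarrow>\<^sub>E UNIV \<and> blockwise_const (join k p r) (xor (fst (m, n), m0))"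
        using eq by (simp add: blockwise_const_join p r) (simp add: xor_def)
    qed
    ultimately show ?thesis using card_inj_on_le[OF _ _ fin] by blast
  qed
  have finX: "finite X" unfolding X_def using fin by blast
  have "card X = (\<Sum>w\<in>xor ` X. card {z \<in> X. xor z = w})"
    using sum.image_gen[OF finX, of "\<lambda>_. 1::nat" xor] by (simp only: card_eq_sum)
  also have "\<dots> \<le> card (xor ` X) * card (?W (join k p r))"
    using sum_mono[of "xor ` X", OF fibre] by simp
  also have "\<dots> \<le> card (?W q) * card (?W (join k p r))"
    using card_mono[OF fin xq] by simp
  finally have "card (?W (join k p q)) * card (?W (join k q r)) \<le> card (?W q) * card (?W (join k p r))"
    unfolding X_def by (simp add: card_cartesian_product)
  then have "(2::nat) ^ (nc (join k p q) + nc (join k q r)) \<le> 2 ^ (nc q + nc (join k p r))"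
    unfolding card_blockwise_const[OF q] card_blockwise_const[OF join_in_Parts[OF p q]]
      card_blockwise_const[OF join_in_Parts[OF q r]]
      card_blockwise_const[OF join_in_Parts[OF p r]] card_UNIV_bool power_add .
  then show ?thesis by simp
qed


section \<open>Unitriangular linear systems and their perturbations\<close>

text \<open>
  Moebius inversion: for a reflexive relation whose strict part increases a real rank, the system is
  unitriangular. Both refinement and the geodesic order provide such a rank.
\<close>

lemma triangular_solution_exists:
  fixes rank :: "'a \<Rightarrow> real" and f :: "'a \<Rightarrow> 'b::ab_group_add"
  assumes "finite S"
    and "\<And>p. p \<in> S \<Longrightarrow> le p p"
    and "\<And>p q. p \<in> S \<Longrightarrow> q \<in> S \<Longrightarrow> le q p \<Longrightarrow> q \<noteq> p \<Longrightarrow> rank q < rank p"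
  shows "\<exists>a. \<forall>p\<in>S. f p = (\<Sum>q | q \<in> S \<and> le q p. a q)"
  using assms
proof (induction S rule: finite_ranking_induct[where f = rank])
  case (insert m S)
  show ?case
  proof (cases "m \<in> S")
    case True
    then have eq: "insert m S = S" by blast
    show ?thesis unfolding eq by (rule insert.IH) (simp_all add: insert.prems)
  next
    case False
    have "\<exists>a. \<forall>p\<in>S. f p = (\<Sum>q | q \<in> S \<and> le q p. a q)"
      by (rule insert.IH) (simp_all add: insert.prems)
    then obtain a where a: "\<forall>p\<in>S. f p = (\<Sum>q | q \<in> S \<and> le q p. a q)" ..
    \<comment> \<open>A maximal element occurs in its own equation only, which therefore determines its value.\<close>
    define a' where "a' = a(m := f m - (\<Sum>q | q \<in> S \<and> le q m. a q))"
    have "f p = (\<Sum>q | q \<in> insert m S \<and> le q p. a' q)" if p: "p \<in> insert m S" for p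
    proof (cases "p = m")
      case True
      then have "{q. q \<in> insert m S \<and> le q p} = insert m {q \<in> S. le q m}" using insert.prems by auto
      moreover have "(\<Sum>q | q \<in> S \<and> le q m. a' q) = (\<Sum>q | q \<in> S \<and> le q m. a q)"
        using False by (intro sum.cong) (auto simp: a'_def)
      ultimately show ?thesis using True False insert.hyps by (simp add: a'_def)
    next
      case pm: False
      then have pS: "p \<in> S" using p by simp
      have "\<not> le m p" using insert.prems(2)[of p m] insert.hyps(2)[OF pS] pm p by fastforce
      then have "{q. q \<in> insert m S \<and> le q p} = {q \<in> S. le q p}" by auto
      moreover have "(\<Sum>q | q \<in> S \<and> le q p. a' q) = (\<Sum>q | q \<in> S \<and> le q p. a q)"
        using False by (intro sum.cong) (auto simp: a'_def)
      ultimately show ?thesis using a pS by simp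
    qed
    then show ?thesis by blast
  qed
qed simp

text \<open>
  The bound on the inverse of the system is what survives a small perturbation of its coefficients.
\<close>

lemma triangular_system_bounded_inverse:
  fixes rank :: "'a \<Rightarrow> real"
  assumes "finite S"
    and "\<And>p. p \<in> S \<Longrightarrow> le p p"
    and "\<And>p q. p \<in> S \<Longrightarrow> q \<in> S \<Longrightarrow> le q p \<Longrightarrow> q \<noteq> p \<Longrightarrow> rank q < rank p"
  shows "\<exists>C\<ge>0. \<forall>x :: 'a \<Rightarrow> 'b::real_normed_vector. \<forall>p\<in>S. 
           norm (x p) \<le> C * (\<Sum>r\<in>S. norm (\<Sum>q | q \<in> S \<and> le q r. x q))"
  using assms
proof (induction S rule: finite_ranking_induct[where f = rank])
  case (insert m S)
  show ?case
  proof (cases "m \<in> S")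
    case True
    then have eq: "insert m S = S" by blast
    show ?thesis unfolding eq by (rule insert.IH) (simp_all add: insert.prems)
  next
    case False
    have "\<exists>C\<ge>0. \<forall>x :: 'a \<Rightarrow> 'b. \<forall>p\<in>S.
           norm (x p) \<le> C * (\<Sum>r\<in>S. norm (\<Sum>q | q \<in> S \<and> le q r. x q))"
      using insert.prems by (intro insert.IH) auto
    then obtain C where C: "C \<ge> 0" "\<And>(x :: 'a \<Rightarrow> 'b) p. p \<in> S \<Longrightarrow>
           norm (x p) \<le> C * (\<Sum>r\<in>S. norm (\<Sum>q | q \<in> S \<and> le q r. x q))"
      by blast
    \<comment> \<open>One equation for \<open>x m\<close> itself, plus \<open>card S\<close> values that are already bounded.\<close>
    define C' where "C' = 1 + (1 + real (card S)) * C"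
    have C': "C' \<ge> 0" "C \<le> C'" using C by (simp_all add: C'_def algebra_simps)
    have "norm (x p) \<le> C' * (\<Sum>r\<in>insert m S. norm (\<Sum>q | q \<in> insert m S \<and> le q r. x q))"
      if p: "p \<in> insert m S" for x :: "'a \<Rightarrow> 'b" and p
    proof -
      define T where "T = (\<Sum>r\<in>S. norm (\<Sum>q | q \<in> S \<and> le q r. x q))"
      have T0: "T \<ge> 0" unfolding T_def by (intro sum_nonneg) simp
      have eq: "{q. q \<in> insert m S \<and> le q r} = {q \<in> S. le q r}" if r: "r \<in> S" for r
        using insert.prems(2)[of r m] insert.hyps(2)[OF r] r False by fastforce
      have sum_eq: "(\<Sum>r\<in>insert m S. norm (\<Sum>q | q \<in> insert m S \<and> le q r. x q)) =
         norm (\<Sum>q | q \<in> insert m S \<and> le q m. x q) + T"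
        using False insert.hyps eq unfolding T_def by simp
      have "{q. q \<in> insert m S \<and> le q m} = insert m {q \<in> S. le q m}" using insert.prems by auto
      then have xm: "(\<Sum>q | q \<in> insert m S \<and> le q m. x q) = x m + (\<Sum>q | q \<in> S \<and> le q m. x q)"
        using False insert.hyps by simp
      have S: "norm (x q) \<le> C * T" if "q \<in> S" for q using C(2)[OF that] unfolding T_def .
      show ?thesis
      proof (cases "p = m")
        case True
        have "norm (\<Sum>q | q \<in> S \<and> le q m. x q) \<le> (\<Sum>q | q \<in> S \<and> le q m. C * T)"
          by (intro sum_norm_le S) simp
        also have "\<dots> \<le> real (card S) * (C * T)"
          using C(1) T0 insert.hyps by (simp add: mult_right_mono card_mono)
        finally have "norm (x m) \<le> norm (\<Sum>q | q \<in> insert m S \<and> le q m. x q) + real (card S) * (C * T)"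
          unfolding xm
          using norm_triangle_ineq4[of "x m + (\<Sum>q | q \<in> S \<and> le q m. x q)" "\<Sum>q | q \<in> S \<and> le q m. x q"]
          by simp
        also have "\<dots> \<le> C' * (norm (\<Sum>q | q \<in> insert m S \<and> le q m. x q) + T)"
        proof -
          have "1 * norm (\<Sum>q | q \<in> insert m S \<and> le q m. x q) \<le> C' * norm (\<Sum>q | q \<in> insert m S \<and> le q m. x q)"
            using C(1) by (intro mult_right_mono) (simp_all add: C'_def)
          moreover have "real (card S) * C * T \<le> C' * T"
            using T0 C(1) by (intro mult_right_mono) (simp_all add: C'_def algebra_simps)
          ultimately show ?thesis by (simp add: algebra_simps)
        qed
        finally show ?thesis using True sum_eq by simp
      next
        case pm: False
        then have "norm (x p) \<le> C * T" using p S by simp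
        also have "\<dots> \<le> C' * T" using C' T0 by (intro mult_right_mono)
        also have "\<dots> \<le> C' * (norm (\<Sum>q | q \<in> insert m S \<and> le q m. x q) + T)"
          using C' by (intro mult_left_mono) simp_all
        finally show ?thesis using sum_eq by simp
      qed
    qed
    then show ?thesis using C' by blast
  qed
qed (auto intro: exI[of _ 0])

lemma triangular_solution_unique:
  fixes rank :: "'a \<Rightarrow> real" and a b :: "'a \<Rightarrow> 'b::real_normed_vector"
  assumes "finite S"
    and "\<And>p. p \<in> S \<Longrightarrow> le p p"
    and "\<And>p q. p \<in> S \<Longrightarrow> q \<in> S \<Longrightarrow> le q p \<Longrightarrow> q \<noteq> p \<Longrightarrow> rank q < rank p"
    and eq: "\<And>p. p \<in> S \<Longrightarrow> (\<Sum>q | q \<in> S \<and> le q p. a q) = (\<Sum>q | q \<in> S \<and> le q p. b q)"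
    and p: "p \<in> S"
  shows "a p = b p"
proof -
  obtain C where C: "\<And>x :: 'a \<Rightarrow> 'b. norm (x p) \<le> C * (\<Sum>r\<in>S. norm (\<Sum>q | q \<in> S \<and> le q r. x q))"
    using triangular_system_bounded_inverse[where ?'b = 'b, of S le rank] assms(1,2,3) p by blast
  show ?thesis using C[of "\<lambda>q. a q - b q"] by (simp add: sum_subtractf eq)
qed

text \<open>
  The error \<open>Y N\<close> of the solution satisfies $Y_N \le K (\delta_N + D_N (Y_N + B))$, where $\delta_N$ and $D_N$ are the
  errors of the right-hand side and of the coefficients. Once $K D_N < 1/2$, the unknown $Y_N$ on the right
  can be absorbed, which gives boundedness and convergence at once.
\<close>

lemma perturbed_triangular_systems_converge:
  fixes rank :: "'a \<Rightarrow> real" and x m :: "nat \<Rightarrow> 'a \<Rightarrow> complex" and g :: "nat \<Rightarrow> 'a \<Rightarrow> 'a \<Rightarrow> complex"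
  assumes S: "finite S"
    and "\<And>p. p \<in> S \<Longrightarrow> le p p"
    and "\<And>p q. p \<in> S \<Longrightarrow> q \<in> S \<Longrightarrow> le q p \<Longrightarrow> q \<noteq> p \<Longrightarrow> rank q < rank p"
    and g: "\<And>p q. p \<in> S \<Longrightarrow> q \<in> S \<Longrightarrow> (\<lambda>N. g N p q) \<longlonglongrightarrow> (if le q p then 1 else 0)"
    and m: "\<And>p. p \<in> S \<Longrightarrow> (\<lambda>N. m N p) \<longlonglongrightarrow> (\<Sum>q | q \<in> S \<and> le q p. a q)"
    and eq: "\<forall>\<^sub>F N in sequentially. \<forall>p\<in>S. m N p = (\<Sum>q\<in>S. g N p q * x N q)"
    and p: "p \<in> S"
  shows "(\<lambda>N. x N p) \<longlonglongrightarrow> a p"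
proof -
  obtain C where C: "C \<ge> 0" "\<And>(x :: 'a \<Rightarrow> complex) p. p \<in> S \<Longrightarrow>
      norm (x p) \<le> C * (\<Sum>r\<in>S. norm (\<Sum>q | q \<in> S \<and> le q r. x q))"
    using triangular_system_bounded_inverse[where ?'b = complex, of S le rank] assms(1,2,3) by blast
  define m' where "m' = (\<lambda>p. \<Sum>q | q \<in> S \<and> le q p. a q)"
  define d where "d = (\<lambda>N p q. g N p q - (if le q p then 1 else 0))"
  define D where "D = (\<lambda>N. \<Sum>p\<in>S. \<Sum>q\<in>S. norm (d N p q))"
  define \<delta> where "\<delta> = (\<lambda>N. \<Sum>p\<in>S. norm (m N p - m' p))"
  define Y where "Y = (\<lambda>N. \<Sum>p\<in>S. norm (x N p - a p))"
  define K where "K = real (card S) * C"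
  define B where "B = (\<Sum>p\<in>S. norm (a p))"
  have D: "D \<longlonglongrightarrow> 0"
    unfolding D_def
  proof (intro tendsto_null_sum)
    fix p q assume pq: "p \<in> S" "q \<in> S"
    show "(\<lambda>N. norm (d N p q)) \<longlonglongrightarrow> 0"
      using g[OF pq] unfolding d_def by (intro tendsto_norm_zero) (simp add: LIM_zero_iff)
  qed
  have \<delta>: "\<delta> \<longlonglongrightarrow> 0"
    unfolding \<delta>_def
  proof (intro tendsto_null_sum)
    fix p assume "p \<in> S"
    from m[OF this] show "(\<lambda>N. norm (m N p - m' p)) \<longlonglongrightarrow> 0"
      unfolding m'_def by (intro tendsto_norm_zero) (simp add: LIM_zero_iff)
  qed
  have le: "Y N \<le> K * (\<delta> N + D N * (Y N + B))"
    if N: "\<forall>p\<in>S. m N p = (\<Sum>q\<in>S. g N p q * x N q)" for N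
  proof -
    have xb: "norm (x N q) \<le> Y N + B" if "q \<in> S" for q
    proof -
      have "norm (x N q) \<le> norm (x N q - a q) + norm (a q)" by norm
      moreover have "norm (x N q - a q) \<le> Y N" "norm (a q) \<le> B"
        unfolding Y_def B_def using S that by (auto intro!: member_le_sum)
      ultimately show ?thesis by linarith
    qed
    have "norm (\<Sum>q | q \<in> S \<and> le q r. x N q - a q) \<le> norm (m N r - m' r) + (\<Sum>q\<in>S. norm (d N r q)) * (Y N + B)"
      if r: "r \<in> S" for r
    proof -
      have "(\<Sum>q | q \<in> S \<and> le q r. x N q) = (\<Sum>q\<in>S. (if le q r then 1 else 0) * x N q)"
        using S by (intro sum.mono_neutral_cong_left) auto
      also have "\<dots> = m N r - (\<Sum>q\<in>S. d N r q * x N q)"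
        using N r by (simp add: d_def left_diff_distrib sum_subtractf)
      finally have sum_eq: "(\<Sum>q | q \<in> S \<and> le q r. x N q - a q) = (m N r - m' r) - (\<Sum>q\<in>S. d N r q * x N q)"
        by (simp add: sum_subtractf m'_def)
      have "norm (\<Sum>q\<in>S. d N r q * x N q) \<le> (\<Sum>q\<in>S. norm (d N r q) * (Y N + B))"
        using xb by (intro sum_norm_le) (simp add: norm_mult mult_left_mono)
      then show ?thesis
        using norm_triangle_ineq4[of "m N r - m' r" "\<Sum>q\<in>S. d N r q * x N q"]
        unfolding sum_eq sum_distrib_right by linarith
    qed
    then have "(\<Sum>r\<in>S. norm (\<Sum>q | q \<in> S \<and> le q r. x N q - a q)) \<le> \<delta> N + D N * (Y N + B)"
      unfolding \<delta>_def D_def sum_distrib_right sum.distrib[symmetric]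
      by (intro sum_mono) (simp add: sum_distrib_right)
    then have "C * (\<Sum>r\<in>S. norm (\<Sum>q | q \<in> S \<and> le q r. x N q - a q)) \<le> C * (\<delta> N + D N * (Y N + B))"
      using C(1) by (rule mult_left_mono)
    then have "norm (x N p - a p) \<le> C * (\<delta> N + D N * (Y N + B))" if "p \<in> S" for p
      using C(2)[OF that, of "\<lambda>q. x N q - a q"] by simp
    then have "Y N \<le> real (card S) * (C * (\<delta> N + D N * (Y N + B)))"
      unfolding Y_def by (rule sum_bounded_above)
    then show ?thesis by (simp add: K_def)
  qed
  have Y0: "Y N \<ge> 0" for N unfolding Y_def by (intro sum_nonneg) simp
  have "(\<lambda>N. K * D N) \<longlonglongrightarrow> 0" using tendsto_mult_left[OF D, of K] by simp
  then have "\<forall>\<^sub>F N in sequentially. K * D N < 1 / 2" by (rule order_tendstoD) simp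
  with eq have "\<forall>\<^sub>F N in sequentially. Y N \<le> 2 * K * (\<delta> N + D N * B)"
  proof eventually_elim
    case (elim N)
    have "(K * D N) * Y N \<le> (1 / 2) * Y N" using elim(2) Y0 by (intro mult_right_mono) auto
    then show ?case using le[OF elim(1)] by (simp add: algebra_simps)
  qed
  moreover have "(\<lambda>N. 2 * K * (\<delta> N + D N * B)) \<longlonglongrightarrow> 2 * K * (0 + 0 * B)"
    by (intro tendsto_intros D \<delta>)
  ultimately have Ylim: "Y \<longlonglongrightarrow> 0"
    using Y0 by (intro tendsto_sandwich[of "\<lambda>_. 0" Y _ "\<lambda>N. 2 * K * (\<delta> N + D N * B)"]) auto
  have "norm (x N p - a p) \<le> Y N" for N
    unfolding Y_def using S p by (auto intro!: member_le_sum)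
  then have "\<forall>\<^sub>F N in sequentially. norm (x N p - a p) \<le> Y N" by simp
  from Lim_null_comparison[OF this Ylim] have "(\<lambda>N. x N p - a p) \<longlonglongrightarrow> 0" .
  then show ?thesis by (simp add: LIM_zero_iff)
qed


section \<open>The geodesic order and the defect\<close>

lemma perm_part_in_Parts:
  assumes "\<sigma> permutes {1..k}" shows "perm_part k \<sigma> \<in> Parts k"
  unfolding Parts_def
proof (clarify, rule partition_onI)
  have "\<Union> (perm_part k \<sigma>) = Inl ` {1..k} \<union> Inr ` \<sigma> ` {1..k}" unfolding perm_part_def by auto
  then show "\<Union> (perm_part k \<sigma>) = points k"
    using permutes_image[OF assms] unfolding points_def Plus_def by simp
  show "disjnt p q" if "p \<in> perm_part k \<sigma>" "q \<in> perm_part k \<sigma>" "p \<noteq> q" for p q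
    using that inj_eq[OF permutes_inj[OF assms]] unfolding perm_part_def disjnt_def by auto
qed (auto simp: perm_part_def)

lemma id_part_in_Parts: "id_part k \<in> Parts k"
  unfolding id_part_def by (intro perm_part_in_Parts permutes_id)

lemma pdist_self: "p \<in> Parts k \<Longrightarrow> pdist k p p = 0"
  using join_absorb[of k p p] unfolding pdist_def by (simp add: Parts_def refines_refl)

lemma pdist_pos:
  assumes p: "p \<in> Parts k" and q: "q \<in> Parts k" and "p \<noteq> q" shows "pdist k p q > 0"
proof -
  note pj = join_refines(1)[OF p q] and qj = join_refines(2)[OF p q]
  have "nc (join k p q) \<noteq> nc p \<or> nc (join k p q) \<noteq> nc q"
  proof (rule ccontr)
    assume "\<not> ?thesis"
    then have eq: "nc (join k p q) = nc p" "nc (join k p q) = nc q" by blast+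
    then have "p = join k p q" using nc_refines(2)[OF pj] by blast
    moreover have "q = join k p q" using nc_refines(2)[OF qj] eq by blast
    ultimately show False using \<open>p \<noteq> q\<close> by metis
  qed
  then show ?thesis using nc_refines(1)[OF pj] nc_refines(1)[OF qj] unfolding pdist_def by auto
qed

lemma geo_le_refl: "p \<in> Parts k \<Longrightarrow> geo_le k p p"
  unfolding geo_le_def by (simp add: pdist_self)

text \<open>
  The distance to \<open>id\<close> is a rank for the geodesic order, which makes the system defining the asymptotic
  cumulants unitriangular.
\<close>

lemma geo_le_rank:
  assumes "p \<in> Parts k" "q \<in> Parts k" "geo_le k q p" "q \<noteq> p"
  shows "pdist k (id_part k) q < pdist k (id_part k) p"
  using assms pdist_pos[of q k p] unfolding geo_le_def by simp

text \<open>
  The triangle inequality from \<open>id\<close> through \<open>q\<close> to \<open>p\<close>, with the halves cleared.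
\<close>

lemma geodesic_excess:
  assumes "p \<in> Parts k" "q \<in> Parts k"
  shows "nc (join k q (id_part k)) + nc (join k q p) \<le> nc q + nc (join k p (id_part k))"
    and "geo_le k q p \<longleftrightarrow>
      nc (join k q (id_part k)) + nc (join k q p) = nc q + nc (join k p (id_part k))"
proof -
  note [simp] = join_commute[OF id_part_in_Parts assms(1)] join_commute[OF id_part_in_Parts assms(2)]
  show "nc (join k q (id_part k)) + nc (join k q p) \<le> nc q + nc (join k p (id_part k))"
    using nc_join_triangle[OF id_part_in_Parts assms(2,1)] by simp
  show "geo_le k q p \<longleftrightarrow>
      nc (join k q (id_part k)) + nc (join k q p) = nc q + nc (join k p (id_part k))"
    unfolding geo_le_def pdist_def by (auto simp: field_simps)
qed

text \<open>
  The triangle inequality at \<open>q\<close>, \<open>p\<close>, \<open>id\<close>, where $q \vee p = q$. It makes \<open>N\<close> to the power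
  \<open>defect k q - defect k p\<close> bounded, so that in the limit only the partitions of equal defect remain.
\<close>

lemma defect_antimono:
  assumes "refines (points k) p q" shows "defect k q \<le> defect k p"
proof -
  have pq: "p \<in> Parts k" "q \<in> Parts k" using assms unfolding refines_def Parts_def by auto
  show ?thesis
    using nc_join_triangle[OF pq(2,1) id_part_in_Parts] join_absorb[OF assms] unfolding defect_def by simp
qed


section \<open>Invariance of the mean tensor\<close>

abbreviation tuples :: "nat \<Rightarrow> nat \<Rightarrow> (point \<Rightarrow> nat) set" where
  "tuples N k \<equiv> points k \<rightarrow>\<^sub>E {1..N}"

text \<open>
  A tuple on \<^term>\<open>points k\<close> is a pair of multi-indices: the primed points carry the row index and the others the
  column index.
\<close>

abbreviation row :: "nat \<Rightarrow> (point \<Rightarrow> nat) \<Rightarrow> nat \<Rightarrow> nat" where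
  "row k n \<equiv> \<lambda>j\<in>{1..k}. n (Inr j)"

abbreviation col :: "nat \<Rightarrow> (point \<Rightarrow> nat) \<Rightarrow> nat \<Rightarrow> nat" where
  "col k n \<equiv> \<lambda>j\<in>{1..k}. n (Inl j)"

lemma Inl_Inr_in_points [simp]: "Inl j \<in> points k \<longleftrightarrow> j \<in> {1..k}" "Inr j \<in> points k \<longleftrightarrow> j \<in> {1..k}"
  by (auto simp: points_def)

lemma points_cases: 
  assumes "u \<in> points k" obtains j where "j \<in> {1..k}" "u = Inl j" | j where "j \<in> {1..k}" "u = Inr j"
  using assms by (cases u) auto

lemma finite_tuples: "finite (tuples N k)"
  by (simp add: finite_PiE finite_points)

lemma row_col_in_multi:
  assumes "n \<in> points k \<rightarrow> {1..N}" shows "row k n \<in> multi N k" "col k n \<in> multi N k"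
proof -
  have "n (Inl j) \<in> {1..N}" "n (Inr j) \<in> {1..N}" if "j \<in> {1..k}" for j
    using that funcset_mem[OF assms] by simp_all
  then show "row k n \<in> multi N k" "col k n \<in> multi N k" unfolding multi_def by auto
qed

lemma sum_multi_multi:
  "(\<Sum>r\<in>multi N k. \<Sum>c\<in>multi N k. h r c) = (\<Sum>n\<in>tuples N k. h (row k n) (col k n))"
proof -
  have "(\<Sum>r\<in>multi N k. \<Sum>c\<in>multi N k. h r c) = (\<Sum>(r, c)\<in>multi N k \<times> multi N k. h r c)"
    by (rule sum.cartesian_product)
  also have "\<dots> = (\<Sum>n\<in>tuples N k. h (row k n) (col k n))"
  proof (rule sum.reindex_bij_witness
      [where i = "\<lambda>n. (row k n, col k n)" and j = "\<lambda>(r, c). \<lambda>u\<in>points k. case_sum c r u"])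
    fix a assume "a \<in> multi N k \<times> multi N k"
    then obtain r c where a: "a = (r, c)" and rc: "r \<in> multi N k" "c \<in> multi N k" by blast
    have rc': "r j \<in> {1..N}" "c j \<in> {1..N}" if "j \<in> {1..k}" for j
      using rc that unfolding multi_def by auto
    let ?n = "\<lambda>u\<in>points k. case_sum c r u"
    have "?n \<in> tuples N k" using rc' by (auto elim!: points_cases)
    then show "(case a of (r, c) \<Rightarrow> \<lambda>u\<in>points k. case_sum c r u) \<in> tuples N k" using a by simp
    have "row k ?n = r" "col k ?n = c"
      using rc unfolding multi_def by (auto simp: fun_eq_iff PiE_iff extensional_def)
    then show "(row k (case a of (r, c) \<Rightarrow> \<lambda>u\<in>points k. case_sum c r u),
          col k (case a of (r, c) \<Rightarrow> \<lambda>u\<in>points k. case_sum c r u)) = a"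
      and "h (row k (case a of (r, c) \<Rightarrow> \<lambda>u\<in>points k. case_sum c r u))
          (col k (case a of (r, c) \<Rightarrow> \<lambda>u\<in>points k. case_sum c r u)) = (case a of (r, c) \<Rightarrow> h r c)"
      using a by simp_all
  next
    fix n assume n: "n \<in> tuples N k"
    show "(row k n, col k n) \<in> multi N k \<times> multi N k"
      using row_col_in_multi[of n k N] n by (auto simp: PiE_iff)
    show "(case (row k n, col k n) of (r, c) \<Rightarrow> \<lambda>u\<in>points k. case_sum c r u) = n"
      using n by (auto simp: fun_eq_iff PiE_iff extensional_def restrict_def split: sum.split)
  qed
  finally show ?thesis .
qed

lemma blockwise_const_cong:
  assumes "p \<in> Parts k" "\<And>u. u \<in> points k \<Longrightarrow> n u = m u"
  shows "blockwise_const p n \<longleftrightarrow> blockwise_const p m"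
proof -
  have "n u = m u" if "b \<in> p" "u \<in> b" for b u
    using assms(2) block_subset[OF assms(1) that(1)] that(2) by blast
  then show ?thesis unfolding blockwise_const_def by simp
qed

text \<open>
  The matrix units select the single tuple that is read off from \<open>r\<close> and \<open>c\<close>.
\<close>

lemma rho_eq:
  assumes p: "p \<in> Parts k" and r: "r \<in> multi N k" and c: "c \<in> multi N k"
  shows "rho N k p r c = (if blockwise_const p (case_sum c r) then 1 else 0)"
proof -
  define n0 where "n0 = (\<lambda>u\<in>points k. case_sum c r u)"
  have n0: "n0 \<in> tuples N k" using r c unfolding n0_def multi_def by (auto elim!: points_cases)
  have ten: "tensor k (\<lambda>j. E_unit (n (Inr j)) (n (Inl j))) r c = (if n = n0 then 1 else 0)"
    if n: "n \<in> tuples N k" for n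
  proof (cases "n = n0")
    case True
    then show ?thesis by (auto simp: tensor_def E_unit_def n0_def)
  next
    case False
    then obtain u where u: "u \<in> points k" "n u \<noteq> n0 u" using PiE_ext[OF n n0] by blast
    then have "\<exists>j\<in>{1..k}. E_unit (n (Inr j)) (n (Inl j)) (r j) (c j) = 0"
      by (cases rule: points_cases[OF u(1)]) (auto simp: n0_def E_unit_def intro!: bexI)
    then show ?thesis using False unfolding tensor_def by simp
  qed
  have "rho N k p r c = (\<Sum>n | n \<in> tuples N k \<and> blockwise_const p n. if n = n0 then 1 else 0)"
    unfolding rho_def using ten by (intro sum.cong) (auto simp: refines_Ker_iff[OF p])
  also have "\<dots> = (if blockwise_const p n0 then 1 else 0)"
    using n0 finite_tuples[of k N] by (subst sum.delta) auto
  also have "blockwise_const p n0 = blockwise_const p (case_sum c r)"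
    by (rule blockwise_const_cong[OF p]) (simp add: n0_def)
  finally show ?thesis .
qed

lemma tensor_mul:
  "mat_mul (multi N k) (tensor k A) (tensor k B) = tensor k (\<lambda>j. mat_mul {1..N} (A j) (B j))"
proof (intro ext)
  fix r c
  show "mat_mul (multi N k) (tensor k A) (tensor k B) r c = tensor k (\<lambda>j. mat_mul {1..N} (A j) (B j)) r c"
    unfolding mat_mul_def tensor_def multi_def
    by (subst prod_sum_PiE) (auto simp: prod.distrib)
qed

definition all_moments :: "'w measure \<Rightarrow> ('w \<Rightarrow> complex) \<Rightarrow> bool" where
  "all_moments P f \<longleftrightarrow> f \<in> borel_measurable P \<and> (\<forall>m::nat. integrable P (\<lambda>\<omega>. cmod (f \<omega>) ^ m))"

text \<open>
  From $2xy \le x^2 + y^2$; the moments of order $2m$ of the factors bound that of order $m$ of the product.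
\<close>

lemma all_moments_mult:
  assumes f: "all_moments P f" and g: "all_moments P g" shows "all_moments P (\<lambda>\<omega>. f \<omega> * g \<omega>)"
proof -
  have [measurable]: "f \<in> borel_measurable P" "g \<in> borel_measurable P" using f g unfolding all_moments_def by auto
  have "integrable P (\<lambda>\<omega>. cmod (f \<omega> * g \<omega>) ^ m)" for m
  proof (rule Bochner_Integration.integrable_bound)
    show "integrable P (\<lambda>\<omega>. cmod (f \<omega>) ^ (2 * m) + cmod (g \<omega>) ^ (2 * m))"
      using f g unfolding all_moments_def by auto
    have "norm (cmod (f \<omega> * g \<omega>) ^ m) \<le> norm (cmod (f \<omega>) ^ (2 * m) + cmod (g \<omega>) ^ (2 * m))" for \<omega>
    proof -
      let ?x = "cmod (f \<omega>) ^ m" and ?y = "cmod (g \<omega>) ^ m"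
      have "2 * (?x * ?y) \<le> ?x\<^sup>2 + ?y\<^sup>2" using sum_squares_bound[of ?x ?y] by (simp add: mult_ac)
      moreover have "0 \<le> ?x * ?y" by simp
      ultimately have "?x * ?y \<le> ?x\<^sup>2 + ?y\<^sup>2" by linarith
      moreover have "?x\<^sup>2 = cmod (f \<omega>) ^ (2 * m)" "?y\<^sup>2 = cmod (g \<omega>) ^ (2 * m)"
        by (simp_all add: power_mult[symmetric] mult.commute)
      ultimately show ?thesis by (simp add: norm_mult power_mult_distrib)
    qed
    then show "AE \<omega> in P. norm (cmod (f \<omega> * g \<omega>) ^ m) \<le> norm (cmod (f \<omega>) ^ (2 * m) + cmod (g \<omega>) ^ (2 * m))"
      by simp
  qed measurable
  then show ?thesis unfolding all_moments_def by simp
qed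

lemma integrable_prod_all_moments:
  assumes "prob_space P" "\<And>j. j \<in> J \<Longrightarrow> all_moments P (f j)"
  shows "integrable P (\<lambda>\<omega>. \<Prod>j\<in>J. f j \<omega>)"
proof -
  interpret prob_space P by fact
  have "all_moments P (\<lambda>\<omega>. \<Prod>j\<in>J. f j \<omega>)"
    using assms(2)
  proof (induction J rule: infinite_finite_induct)
    case (insert j J)
    then show ?case by (simp add: all_moments_mult)
  qed (simp_all add: all_moments_def)
  then have "(\<lambda>\<omega>. \<Prod>j\<in>J. f j \<omega>) \<in> borel_measurable P" "integrable P (\<lambda>\<omega>. cmod (\<Prod>j\<in>J. f j \<omega>) ^ 1)"
    unfolding all_moments_def by blast+
  then show ?thesis by (simp add: integrable_norm_iff)
qed

lemma integrable_tensor: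
  assumes "prob_space P" "\<And>j. random_matrix P N (X j)" "r \<in> multi N k" "c \<in> multi N k"
  shows "integrable P (\<lambda>\<omega>. tensor k (\<lambda>j. X j \<omega>) r c)"
  unfolding tensor_def
proof (rule integrable_prod_all_moments[OF assms(1)])
  fix j assume "j \<in> {1..k}"
  then have "r j \<in> {1..N}" "c j \<in> {1..N}" using assms(3,4) unfolding multi_def by auto
  then show "all_moments P (\<lambda>\<omega>. X j \<omega> (r j) (c j))"
    using assms(2)[of j] unfolding random_matrix_def all_moments_def by blast
qed

text \<open>
  The mean tensor is a function of the joint law, which is how invariance in law enters.
\<close>

lemma mean_tensor_joint_law:
  assumes "\<And>j a b. a \<in> {1..N} \<Longrightarrow> b \<in> {1..N} \<Longrightarrow> (\<lambda>\<omega>. X j \<omega> a b) \<in> borel_measurable P"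
    and r: "r \<in> multi N k" and c: "c \<in> multi N k"
  shows "mean_tensor P k X r c = (\<integral>x. (\<Prod>j=1..k. x (j, r j, c j)) \<partial>joint_law P N k X)"
proof -
  let ?I = "{1..k} \<times> {1..N} \<times> {1..N}"
  have idx: "(j, r j, c j) \<in> ?I" if "j \<in> {1..k}" for j
    using r c that unfolding multi_def by auto
  have 1: "(\<lambda>\<omega>. \<lambda>(j, a, b)\<in>?I. X j \<omega> a b) \<in> measurable P (\<Pi>\<^sub>M x\<in>?I. borel)"
    using assms(1) by (intro measurable_restrict) auto
  have 2: "(\<lambda>x. \<Prod>j=1..k. x (j, r j, c j)) \<in> borel_measurable (\<Pi>\<^sub>M x\<in>?I. (borel :: complex measure))"
    using idx by (intro borel_measurable_prod measurable_component_singleton)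
  have "(\<integral>x. (\<Prod>j=1..k. x (j, r j, c j)) \<partial>joint_law P N k X) =
     (\<integral>\<omega>. (\<Prod>j=1..k. (\<lambda>(j, a, b)\<in>?I. X j \<omega> a b) (j, r j, c j)) \<partial>P)"
    unfolding joint_law_def by (rule integral_distr[OF 1 2])
  also have "\<dots> = mean_tensor P k X r c"
    unfolding mean_tensor_def tensor_def using idx
    by (intro Bochner_Integration.integral_cong prod.cong) simp_all
  finally show ?thesis by simp
qed

lemma integral_double_sum:
  fixes f :: "'a \<Rightarrow> 'b \<Rightarrow> 'w \<Rightarrow> complex"
  assumes "\<And>x y. x \<in> X \<Longrightarrow> y \<in> Y \<Longrightarrow> integrable P (f x y)"
  shows "(\<integral>\<omega>. (\<Sum>x\<in>X. \<Sum>y\<in>Y. f x y \<omega> * w x y) \<partial>P) = (\<Sum>x\<in>X. \<Sum>y\<in>Y. (\<integral>\<omega>. f x y \<omega> \<partial>P) * w x y)"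
proof -
  have "(\<integral>\<omega>. (\<Sum>x\<in>X. \<Sum>y\<in>Y. f x y \<omega> * w x y) \<partial>P) = (\<Sum>x\<in>X. \<integral>\<omega>. (\<Sum>y\<in>Y. f x y \<omega> * w x y) \<partial>P)"
    using assms by (intro Bochner_Integration.integral_sum Bochner_Integration.integrable_sum integrable_mult_left)
  also have "\<dots> = (\<Sum>x\<in>X. \<Sum>y\<in>Y. \<integral>\<omega>. f x y \<omega> * w x y \<partial>P)"
    using assms by (intro sum.cong refl Bochner_Integration.integral_sum integrable_mult_left)
  finally show ?thesis by simp
qed

lemma mean_tensor_conjugate:
  assumes "prob_space P" "\<And>j. random_matrix P N (X j)" "r \<in> multi N k" "c \<in> multi N k"
  shows "mat_mul (multi N k) (mat_mul (multi N k) (tensor k (\<lambda>_. g)) (mean_tensor P k X)) (tensor k (\<lambda>_. h)) r c =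
     mean_tensor P k (\<lambda>j \<omega>. mat_mul {1..N} (mat_mul {1..N} g (X j \<omega>)) h) r c"
proof -
  note int = integrable_tensor[where X = X, OF assms(1,2)]
  let ?w = "\<lambda>m l. tensor k (\<lambda>_. g) r l * tensor k (\<lambda>_. h) m c"
  have "mean_tensor P k (\<lambda>j \<omega>. mat_mul {1..N} (mat_mul {1..N} g (X j \<omega>)) h) r c =
     (\<integral>\<omega>. (\<Sum>m\<in>multi N k. \<Sum>l\<in>multi N k. tensor k (\<lambda>j. X j \<omega>) l m * ?w m l) \<partial>P)"
    unfolding mean_tensor_def tensor_mul[symmetric]
    by (simp add: mat_mul_def sum_distrib_left sum_distrib_right mult_ac)
  also have "\<dots> = (\<Sum>m\<in>multi N k. \<Sum>l\<in>multi N k. mean_tensor P k X l m * ?w m l)"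
    unfolding mean_tensor_def by (rule integral_double_sum[OF int])
  finally show ?thesis by (simp add: mat_mul_def sum_distrib_left sum_distrib_right mult_ac)
qed

lemma measurable_conjugate_entry:
  assumes "random_matrix P N X" "a \<in> {1..N}" "b \<in> {1..N}"
  shows "(\<lambda>\<omega>. mat_mul {1..N} (mat_mul {1..N} g (X \<omega>)) h a b) \<in> borel_measurable P"
  using assms unfolding mat_mul_def random_matrix_def
  by (intro borel_measurable_sum borel_measurable_times borel_measurable_const) auto

lemma mean_tensor_invariant:
  assumes "prob_space P" "\<And>i. random_matrix P N (M i)" "invariant_family A P N M" "g \<in> cat_group A N"
    and rc: "r \<in> multi N k" "c \<in> multi N k"
  shows "mat_mul (multi N k) (mat_mul (multi N k) (tensor k (\<lambda>_. g)) (mean_tensor P k (\<lambda>j. M (i j))))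
     (tensor k (\<lambda>_. inv_mat N g)) r c = mean_tensor P k (\<lambda>j. M (i j)) r c"
proof -
  have law: "joint_law P N k (\<lambda>j \<omega>. mat_mul {1..N} (mat_mul {1..N} g (M (i j) \<omega>)) (inv_mat N g)) =
     joint_law P N k (\<lambda>j. M (i j))"
    using assms(3,4) unfolding invariant_family_def by blast
  have meas: "(\<lambda>\<omega>. M j \<omega> a b) \<in> borel_measurable P" if "a \<in> {1..N}" "b \<in> {1..N}" for j a b
    using assms(2)[of j] that unfolding random_matrix_def by blast
  have "mat_mul (multi N k) (mat_mul (multi N k) (tensor k (\<lambda>_. g)) (mean_tensor P k (\<lambda>j. M (i j))))
     (tensor k (\<lambda>_. inv_mat N g)) r c =
     mean_tensor P k (\<lambda>j \<omega>. mat_mul {1..N} (mat_mul {1..N} g (M (i j) \<omega>)) (inv_mat N g)) r c"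
    by (rule mean_tensor_conjugate[OF assms(1,2) rc])
  also have "\<dots> = (\<integral>x. (\<Prod>j=1..k. x (j, r j, c j)) \<partial>joint_law P N k (\<lambda>j. M (i j)))"
    unfolding law[symmetric]
    by (rule mean_tensor_joint_law[OF _ rc]) (rule measurable_conjugate_entry[OF assms(2)])
  also have "\<dots> = mean_tensor P k (\<lambda>j. M (i j)) r c"
    by (rule mean_tensor_joint_law[OF _ rc, symmetric]) (rule meas)
  finally show ?thesis .
qed

text \<open>
  By invariance in law the integrand does not depend on the group element.
\<close>

lemma haar_average_eq_mean:
  assumes "prob_space P" "\<And>i. random_matrix P N (M i)" "invariant_family A P N M"
    and haar: "haar_measure N (cat_group A N) \<mu>"
    and rc: "r \<in> multi N k" "c \<in> multi N k"
  shows "haar_average \<mu> N k (mean_tensor P k (\<lambda>j. M (i j))) r c = mean_tensor P k (\<lambda>j. M (i j)) r c"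
proof -
  interpret H: prob_space \<mu> using haar unfolding haar_measure_def by blast
  have "haar_average \<mu> N k (mean_tensor P k (\<lambda>j. M (i j))) r c = (\<integral>g. mean_tensor P k (\<lambda>j. M (i j)) r c \<partial>\<mu>)"
    unfolding haar_average_def
    using haar mean_tensor_invariant[OF assms(1-3) _ rc]
    by (intro Bochner_Integration.integral_cong) (auto simp: haar_measure_def)
  then show ?thesis by (simp add: H.prob_space)
qed

lemma mean_tensor_eq_entry_moment:
  "mean_tensor P k X r c = entry_moment P k X (case_sum c r)"
  unfolding mean_tensor_def entry_moment_def tensor_def by simp

lemma entry_moment_eq_mean_tensor:
  "entry_moment P k X n = mean_tensor P k X (row k n) (col k n)"
  unfolding mean_tensor_def entry_moment_def tensor_def by simp

text \<open>
  Two-sided inverses are unique, so the description picks out the adjoint matrix.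
\<close>

lemma inv_mat_unitary:
  assumes "g \<in> unitary_group N" shows "inv_mat N g = adj g"
proof -
  have g: "g \<in> mats N" "mat_mul {1..N} g (adj g) = one_mat N" "mat_mul {1..N} (adj g) g = one_mat N"
    using assms unfolding unitary_group_def by auto
  have adj: "adj g \<in> mats N" using g(1) unfolding mats_def adj_def by auto
  have one: "mat_mul {1..N} (one_mat N) h = h" "mat_mul {1..N} h (one_mat N) = h" if "h \<in> mats N" for h
  proof -
    have "(\<Sum>m=1..N. one_mat N a m * h m b) = h a b" "(\<Sum>m=1..N. h a m * one_mat N m b) = h a b" for a b
    proof -
      have "(\<Sum>m=1..N. one_mat N a m * h m b) = (\<Sum>m=1..N. if m = a then h m b else 0)"
        by (intro sum.cong) (auto simp: one_mat_def)
      also have "\<dots> = h a b" using that unfolding mats_def by auto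
      finally show "(\<Sum>m=1..N. one_mat N a m * h m b) = h a b" .
      have "(\<Sum>m=1..N. h a m * one_mat N m b) = (\<Sum>m=1..N. if m = b then h a m else 0)"
        by (intro sum.cong) (auto simp: one_mat_def)
      also have "\<dots> = h a b" using that unfolding mats_def by auto
      finally show "(\<Sum>m=1..N. h a m * one_mat N m b) = h a b" .
    qed
    then show "mat_mul {1..N} (one_mat N) h = h" "mat_mul {1..N} h (one_mat N) = h"
      unfolding mat_mul_def by auto
  qed
  have assoc: "mat_mul {1..N} (mat_mul {1..N} x y) z = mat_mul {1..N} x (mat_mul {1..N} y z)" for x y z :: cmat
  proof (intro ext)
    fix a b
    have "(\<Sum>m=1..N. (\<Sum>l=1..N. x a l * y l m) * z m b) = (\<Sum>m=1..N. \<Sum>l=1..N. x a l * (y l m * z m b))"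
      by (simp add: sum_distrib_right mult.assoc)
    also have "\<dots> = (\<Sum>l=1..N. \<Sum>m=1..N. x a l * (y l m * z m b))" by (rule sum.swap)
    finally show "mat_mul {1..N} (mat_mul {1..N} x y) z a b = mat_mul {1..N} x (mat_mul {1..N} y z) a b"
      unfolding mat_mul_def by (simp add: sum_distrib_left)
  qed
  show ?thesis
    unfolding inv_mat_def
  proof (rule the_equality)
    fix h assume h: "h \<in> mats N \<and> mat_mul {1..N} g h = one_mat N \<and> mat_mul {1..N} h g = one_mat N"
    have "h = mat_mul {1..N} h (mat_mul {1..N} g (adj g))" using one h g by simp
    also have "\<dots> = adj g" using assoc[of h g "adj g"] h one(1)[OF adj] by simp
    finally show "h = adj g" .
  qed (use g adj in blast)
qed

text \<open>
  Invariance of a tensor under $g^{\otimes k} \cdot (g^*)^{\otimes k}$, with the pair of multi-indices merged into one tuple: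
  \<open>g\<close> acts at the primed points and its complex conjugate at the others.
\<close>

definition tensor_invariant :: "nat \<Rightarrow> nat \<Rightarrow> ((point \<Rightarrow> nat) \<Rightarrow> complex) \<Rightarrow> cmat \<Rightarrow> bool" where
  "tensor_invariant N k F g \<longleftrightarrow> (\<forall>n\<in>tuples N k.
     (\<Sum>m\<in>tuples N k. (\<Prod>j=1..k. g (n (Inr j)) (m (Inr j)) * cnj (g (n (Inl j)) (m (Inl j)))) * F m) = F n)"

lemma entry_moment_invariant:
  assumes "prob_space P" "\<And>i. random_matrix P N (M i)" "invariant_family A P N M" "g \<in> cat_group A N"
    and g: "g \<in> unitary_group N"
  shows "tensor_invariant N k (entry_moment P k (\<lambda>j. M (i j))) g"
  unfolding tensor_invariant_def
proof
  fix n assume n: "n \<in> tuples N k"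
  then have n': "n \<in> points k \<rightarrow> {1..N}" by (auto simp: PiE_iff)
  let ?T = "mean_tensor P k (\<lambda>j. M (i j))" and ?G = "tensor k (\<lambda>_. g)" and ?H = "tensor k (\<lambda>_. inv_mat N g)"
  have "entry_moment P k (\<lambda>j. M (i j)) n = mat_mul (multi N k) (mat_mul (multi N k) ?G ?T) ?H (row k n) (col k n)"
    unfolding entry_moment_eq_mean_tensor
    by (rule mean_tensor_invariant[OF assms(1-4) row_col_in_multi[OF n'], symmetric])
  also have "\<dots> = (\<Sum>m\<in>multi N k. \<Sum>l\<in>multi N k. ?G (row k n) l * ?T l m * ?H m (col k n))"
    unfolding mat_mul_def by (simp add: sum_distrib_right)
  also have "\<dots> = (\<Sum>l\<in>multi N k. \<Sum>m\<in>multi N k. ?G (row k n) l * ?T l m * ?H m (col k n))"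
    by (rule sum.swap)
  also have "\<dots> = (\<Sum>m\<in>tuples N k. ?G (row k n) (row k m) * ?T (row k m) (col k m) * ?H (col k m) (col k n))"
    by (rule sum_multi_multi)
  also have "\<dots> = (\<Sum>m\<in>tuples N k. (\<Prod>j=1..k. g (n (Inr j)) (m (Inr j)) * cnj (g (n (Inl j)) (m (Inl j)))) *
      entry_moment P k (\<lambda>j. M (i j)) m)"
    unfolding entry_moment_eq_mean_tensor inv_mat_unitary[OF g]
    by (intro sum.cong refl) (simp add: tensor_def adj_def prod.distrib)
  finally show "(\<Sum>m\<in>tuples N k. (\<Prod>j=1..k. g (n (Inr j)) (m (Inr j)) * cnj (g (n (Inl j)) (m (Inl j)))) *
      entry_moment P k (\<lambda>j. M (i j)) m) = entry_moment P k (\<lambda>j. M (i j)) n" by simp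
qed

lemma transpose_part_blockwise:
  "blockwise_const (transpose_part p) n \<longleftrightarrow> blockwise_const p (n \<circ> flip)"
  unfolding blockwise_const_def transpose_part_def by simp

lemma transpose_part_in_Parts: assumes "p \<in> Parts k" shows "transpose_part p \<in> Parts k"
proof -
  have inj: "inj flip" unfolding inj_def flip_def by (auto split: sum.splits)
  have "flip ` points k = points k" unfolding points_def Plus_def flip_def by (auto simp: image_Un image_image)
  moreover have "{} \<notin> transpose_part p" using block_nonempty[OF assms] unfolding transpose_part_def by blast
  ultimately show ?thesis
    using partition_on_inj_image[of "points k" p flip] assms inj
    unfolding Parts_def transpose_part_def by (simp add: inj_on_subset)
qed

text \<open>
  The transposition in the definition of the moment compensates the exchange of rows and columns
  in the trace of a product.
\<close>

lemma moment_eq: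
  assumes P: "prob_space P" "\<And>j. random_matrix P N (X j)" and p: "p \<in> Parts k"
  shows "moment P N k X p = inverse (of_nat N ^ nc (join k p (id_part k))) *
     (\<Sum>n | n \<in> tuples N k \<and> blockwise_const p n. entry_moment P k X n)"
proof -
  have rho: "rho N k (transpose_part p) c r = (if blockwise_const p (case_sum c r) then 1 else 0)"
    if "r \<in> multi N k" "c \<in> multi N k" for r c
  proof -
    have "case_sum r c \<circ> flip = case_sum c r" by (auto simp: fun_eq_iff flip_def split: sum.split)
    then show ?thesis using rho_eq[OF transpose_part_in_Parts[OF p] that(2,1)]
      by (simp add: transpose_part_blockwise)
  qed
  note int = integrable_tensor[where X = X, OF P]
  have "(\<integral>\<omega>. mat_trace (multi N k)
        (mat_mul (multi N k) (tensor k (\<lambda>j. X j \<omega>)) (rho N k (transpose_part p))) \<partial>P) =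
     (\<integral>\<omega>. (\<Sum>r\<in>multi N k. \<Sum>c\<in>multi N k. tensor k (\<lambda>j. X j \<omega>) r c * rho N k (transpose_part p) c r) \<partial>P)"
    unfolding mat_trace_def mat_mul_def ..
  also have "\<dots> = (\<Sum>r\<in>multi N k. \<Sum>c\<in>multi N k. mean_tensor P k X r c * rho N k (transpose_part p) c r)"
    unfolding mean_tensor_def by (rule integral_double_sum[OF int])
  also have "\<dots> = (\<Sum>r\<in>multi N k. \<Sum>c\<in>multi N k.
       if blockwise_const p (case_sum c r) then entry_moment P k X (case_sum c r) else 0)"
    by (intro sum.cong refl) (simp add: rho mean_tensor_eq_entry_moment)
  also have "\<dots> = (\<Sum>n\<in>tuples N k. if blockwise_const p n then entry_moment P k X n else 0)"
  proof (subst sum_multi_multi, intro sum.cong refl)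
    fix n
    have "blockwise_const p (case_sum (col k n) (row k n)) = blockwise_const p n"
      by (rule blockwise_const_cong[OF p]) (auto elim: points_cases)
    moreover have "entry_moment P k X (case_sum (col k n) (row k n)) = entry_moment P k X n"
      unfolding entry_moment_def by simp
    ultimately show "(if blockwise_const p (case_sum (col k n) (row k n))
       then entry_moment P k X (case_sum (col k n) (row k n)) else 0) =
       (if blockwise_const p n then entry_moment P k X n else 0)" by simp
  qed
  also have "\<dots> = (\<Sum>n | n \<in> tuples N k \<and> blockwise_const p n. entry_moment P k X n)"
    using finite_tuples by (intro sum.mono_neutral_cong_right) auto
  finally show ?thesis unfolding moment_def by simp
qed


section \<open>Tensors invariant under permutation matrices\<close>

text \<open>
  The permutation matrix of \<open>\<sigma>\<close> with the entry of column \<open>b\<close> multiplied by \<open>e b\<close>. Permutation matrices,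
  signed permutation matrices and diagonal unitary matrices are all of this form.
\<close>

definition monomial_mat :: "nat \<Rightarrow> (nat \<Rightarrow> nat) \<Rightarrow> (nat \<Rightarrow> complex) \<Rightarrow> cmat" where
  "monomial_mat N \<sigma> e = (\<lambda>a b. if b \<in> {1..N} \<and> a = \<sigma> b then e b else 0)"

lemma monomial_mat_mats: "\<sigma> permutes {1..N} \<Longrightarrow> monomial_mat N \<sigma> e \<in> mats N"
  using permutes_in_image[of \<sigma> "{1..N}"] unfolding mats_def monomial_mat_def by auto

lemma monomial_mat_mul_adj:
  assumes \<sigma>: "\<sigma> permutes {1..N}" and e: "\<And>b. cmod (e b) = 1"
  shows "mat_mul {1..N} (monomial_mat N \<sigma> e) (adj (monomial_mat N \<sigma> e)) = one_mat N"
    and "mat_mul {1..N} (adj (monomial_mat N \<sigma> e)) (monomial_mat N \<sigma> e) = one_mat N"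
proof -
  have ee: "e b * cnj (e b) = 1" "cnj (e b) * e b = 1" for b
    using e[of b] by (simp_all add: complex_norm_square[symmetric] mult.commute)
  have inj: "\<sigma> a = \<sigma> b \<longleftrightarrow> a = b" for a b using inj_eq[OF permutes_inj[OF \<sigma>]] .
  show "mat_mul {1..N} (monomial_mat N \<sigma> e) (adj (monomial_mat N \<sigma> e)) = one_mat N"
  proof (intro ext)
    fix a b
    have "(\<Sum>m=1..N. monomial_mat N \<sigma> e a m * adj (monomial_mat N \<sigma> e) m b) =
      (\<Sum>m=1..N. if m = Hilbert_Choice.inv \<sigma> a then (if a = b then 1 else 0) else 0)"
      using permutes_inverses[OF \<sigma>]
      by (intro sum.cong refl) (auto simp: monomial_mat_def adj_def ee)
    also have "\<dots> = one_mat N a b"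
      using permutes_in_image[OF permutes_inv[OF \<sigma>], of a] by (auto simp: one_mat_def)
    finally show "mat_mul {1..N} (monomial_mat N \<sigma> e) (adj (monomial_mat N \<sigma> e)) a b = one_mat N a b"
      unfolding mat_mul_def .
  qed
  show "mat_mul {1..N} (adj (monomial_mat N \<sigma> e)) (monomial_mat N \<sigma> e) = one_mat N"
  proof (intro ext)
    fix a b
    have "(\<Sum>m=1..N. adj (monomial_mat N \<sigma> e) a m * monomial_mat N \<sigma> e m b) =
      (\<Sum>m=1..N. if m = \<sigma> a then one_mat N a b else 0)"
      by (intro sum.cong refl) (auto simp: monomial_mat_def adj_def ee one_mat_def inj)
    also have "\<dots> = one_mat N a b"
      using permutes_in_image[OF \<sigma>, of a] by (auto simp: one_mat_def)
    finally show "mat_mul {1..N} (adj (monomial_mat N \<sigma> e)) (monomial_mat N \<sigma> e) a b = one_mat N a b"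
      unfolding mat_mul_def .
  qed
qed

lemma monomial_mat_unitary:
  "\<sigma> permutes {1..N} \<Longrightarrow> (\<And>b. cmod (e b) = 1) \<Longrightarrow> monomial_mat N \<sigma> e \<in> unitary_group N"
  unfolding unitary_group_def using monomial_mat_mats monomial_mat_mul_adj by blast

lemma orthogonal_iff_real_unitary:
  "g \<in> orthogonal_group N \<longleftrightarrow> g \<in> unitary_group N \<and> (\<forall>a b. g a b \<in> \<real>)"
proof -
  have "adj g = (\<lambda>a b. g b a)" if "\<forall>a b. g a b \<in> \<real>"
    using that by (auto simp: adj_def fun_eq_iff Reals_cnj_iff)
  then show ?thesis unfolding orthogonal_group_def unitary_group_def by auto
qed

lemma signed_permutation_matrix_in_group:
  assumes "\<sigma> permutes {1..N}" "\<And>b. e b = 1 \<or> e b = -1"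
  shows "monomial_mat N \<sigma> e \<in> cat_group Hyper N"
  unfolding monomial_mat_def using assms by auto

lemma permutation_matrix_in_group:
  assumes \<sigma>: "\<sigma> permutes {1..N}" shows "monomial_mat N \<sigma> (\<lambda>_. 1) \<in> cat_group A N"
proof -
  have o: "monomial_mat N \<sigma> (\<lambda>_. 1) \<in> orthogonal_group N"
    unfolding orthogonal_iff_real_unitary using monomial_mat_unitary[OF \<sigma>]
    by (simp add: monomial_mat_def)
  have rows: "(\<Sum>b=1..N. monomial_mat N \<sigma> (\<lambda>_. 1) a b) = 1" if "a \<in> {1..N}" for a
  proof -
    have "(\<Sum>b=1..N. monomial_mat N \<sigma> (\<lambda>_. 1) a b) = (\<Sum>b=1..N. if b = Hilbert_Choice.inv \<sigma> a then 1 else 0)"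
      using permutes_inverses[OF \<sigma>] by (intro sum.cong refl) (auto simp: monomial_mat_def)
    then show ?thesis using permutes_in_image[OF permutes_inv[OF \<sigma>], of a] that by simp
  qed
  have cols: "(\<Sum>a=1..N. monomial_mat N \<sigma> (\<lambda>_. 1) a b) = 1" if "b \<in> {1..N}" for b
  proof -
    have "(\<Sum>a=1..N. monomial_mat N \<sigma> (\<lambda>_. 1) a b) = (\<Sum>a=1..N. if a = \<sigma> b then 1 else 0)"
      using that by (intro sum.cong refl) (auto simp: monomial_mat_def)
    then show ?thesis using permutes_in_image[OF \<sigma>, of b] that by simp
  qed
  show ?thesis
  proof (cases A)
    case Sym then show ?thesis using o orthogonal_iff_real_unitary by simp
  next
    case Hyper
    then show ?thesis using signed_permutation_matrix_in_group[OF \<sigma>, of "\<lambda>_. 1"] by simp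
  next
    case AllParts
    then show ?thesis using \<sigma> by (auto simp: monomial_mat_def)
  qed (use o rows cols in auto)
qed

lemma prod_points:
  fixes f :: "point \<Rightarrow> complex"
  shows "(\<Prod>j=1..k. f (Inr j) * f (Inl j)) = (\<Prod>u\<in>points k. f u)"
proof -
  have "(\<Prod>u\<in>points k. f u) = (\<Prod>u\<in>Inl ` {1..k}. f u) * (\<Prod>u\<in>Inr ` {1..k}. f u)"
    unfolding points_def Plus_def by (intro prod.union_disjoint) auto
  then show ?thesis by (simp add: prod.reindex prod.distrib mult.commute)
qed

text \<open>
  A monomial matrix maps each basis tensor to a multiple of a basis tensor, so invariance relates two
  single values of \<open>F\<close>.
\<close>

lemma tensor_invariant_monomial:
  assumes inv: "tensor_invariant N k F (monomial_mat N \<sigma> e)" and \<sigma>: "\<sigma> permutes {1..N}"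
    and m: "m \<in> tuples N k"
  shows "F (\<lambda>u\<in>points k. \<sigma> (m u)) = (\<Prod>j=1..k. e (m (Inr j)) * cnj (e (m (Inl j)))) * F m"
proof -
  let ?n = "\<lambda>u\<in>points k. \<sigma> (m u)" and ?g = "monomial_mat N \<sigma> e"
  have mN: "m u \<in> {1..N}" if "u \<in> points k" for u using m that by (rule PiE_mem)
  have n: "?n \<in> tuples N k" using mN permutes_in_image[OF \<sigma>] by auto
  have inj: "\<sigma> a = \<sigma> b \<longleftrightarrow> a = b" for a b using inj_eq[OF permutes_inj[OF \<sigma>]] .
  have w: "(\<Prod>j=1..k. ?g (?n (Inr j)) (m' (Inr j)) * cnj (?g (?n (Inl j)) (m' (Inl j)))) =
     (if m' = m then \<Prod>j=1..k. e (m (Inr j)) * cnj (e (m (Inl j))) else 0)" if m': "m' \<in> tuples N k" for m'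
  proof (cases "m' = m")
    case True
    then show ?thesis using mN by (auto simp: monomial_mat_def intro!: prod.cong)
  next
    case False
    then obtain u where u: "u \<in> points k" "m u \<noteq> m' u" using PiE_ext[OF m' m] by metis
    then have "\<exists>j\<in>{1..k}. ?g (?n (Inr j)) (m' (Inr j)) * cnj (?g (?n (Inl j)) (m' (Inl j))) = 0"
      by (cases rule: points_cases[OF u(1)]) (auto simp: monomial_mat_def inj intro!: bexI)
    then show ?thesis using False by simp
  qed
  have "F ?n = (\<Sum>m'\<in>tuples N k.
      (\<Prod>j=1..k. ?g (?n (Inr j)) (m' (Inr j)) * cnj (?g (?n (Inl j)) (m' (Inl j)))) * F m')"
    by (rule sym) (rule bspec[OF inv[unfolded tensor_invariant_def] n])
  also have "\<dots> = (\<Sum>m'\<in>tuples N k. if m' = m then (\<Prod>j=1..k. e (m (Inr j)) * cnj (e (m (Inl j)))) * F m else 0)"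
    by (intro sum.cong refl) (simp only: w, simp)
  also have "\<dots> = (\<Prod>j=1..k. e (m (Inr j)) * cnj (e (m (Inl j)))) * F m"
    using m finite_tuples[of k N] by simp
  finally show ?thesis .
qed

text \<open>
  Two tuples with the same kernel differ by a bijection between their sets of values. The complements of these
  sets in $\{1, \dots, N\}$ have the same size, so it extends to a permutation.
\<close>

lemma exists_permutation_between_tuples:
  assumes n: "n \<in> tuples N k" and m: "m \<in> tuples N k" and ker: "Ker k n = Ker k m"
  obtains \<sigma> where "\<sigma> permutes {1..N}" "n = (\<lambda>u\<in>points k. \<sigma> (m u))"
proof -
  have eq: "n u = n v \<longleftrightarrow> m u = m v" if uv: "u \<in> points k" "v \<in> points k" for u v
  proof -
    have "n' u = n' v \<longleftrightarrow> block_of (Ker k n') u = block_of (Ker k n') v" for n' :: "point \<Rightarrow> nat"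
    proof -
      have b: "block_of (Ker k n') w = {v \<in> points k. n' v = n' w}" if "w \<in> points k" for w
        using that by (intro block_of_eq[OF Ker_in_Parts]) (auto simp: Ker_def)
      show ?thesis unfolding b[OF uv(1)] b[OF uv(2)] using uv by auto
    qed
    then show ?thesis using ker by simp
  qed
  define f where "f = (\<lambda>x. n (SOME u. u \<in> points k \<and> m u = x))"
  have f: "f (m u) = n u" if u: "u \<in> points k" for u
  proof -
    have "(SOME v. v \<in> points k \<and> m v = m u) \<in> points k \<and> m (SOME v. v \<in> points k \<and> m v = m u) = m u"
      by (rule someI[of _ u]) (use u in simp)
    then show ?thesis unfolding f_def using eq u by simp
  qed
  let ?I = "m ` points k" and ?J = "n ` points k"
  have bf: "bij_betw f ?I ?J"
    unfolding bij_betw_def using f eq by (auto simp: inj_on_def image_image)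
  have sub: "?I \<subseteq> {1..N}" "?J \<subseteq> {1..N}" using n m by (auto dest: PiE_mem)
  have "card ({1..N} - ?I) = card ({1..N} - ?J)"
    using bij_betw_same_card[OF bf] sub finite_points by (simp add: card_Diff_subset)
  then obtain g where bg: "bij_betw g ({1..N} - ?I) ({1..N} - ?J)"
    using finite_same_card_bij by (metis finite_Diff finite_atLeastAtMost)
  define \<sigma> where "\<sigma> = (\<lambda>x. if x \<in> ?I then f x else if x \<in> {1..N} then g x else x)"
  have "bij_betw \<sigma> ?I ?J" using bf by (rule bij_betw_cong[THEN iffD1, rotated]) (simp add: \<sigma>_def)
  moreover have "bij_betw \<sigma> ({1..N} - ?I) ({1..N} - ?J)"
    using bg by (rule bij_betw_cong[THEN iffD1, rotated]) (simp add: \<sigma>_def)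
  ultimately have "bij_betw \<sigma> (?I \<union> ({1..N} - ?I)) (?J \<union> ({1..N} - ?J))"
    by (rule bij_betw_combine) auto
  then have "bij_betw \<sigma> {1..N} {1..N}" using sub by (simp add: Un_absorb1)
  then have "\<sigma> permutes {1..N}"
    by (rule bij_imp_permutes) (use sub in \<open>auto simp: \<sigma>_def\<close>)
  moreover have "n = (\<lambda>u\<in>points k. \<sigma> (m u))"
    using PiE_arb[OF n] f by (auto simp: fun_eq_iff \<sigma>_def)
  ultimately show ?thesis by (rule that)
qed

text \<open>
  \<open>a\<close> are the coordinates of the tensor \<open>F\<close> on the \<open>rho N k q\<close>, with \<open>q\<close> ranging over all partitions.
\<close>

definition partition_expansion :: "nat \<Rightarrow> nat \<Rightarrow> ((point \<Rightarrow> nat) \<Rightarrow> complex) \<Rightarrow> (part \<Rightarrow> complex) \<Rightarrow> bool" where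
  "partition_expansion N k F a \<longleftrightarrow>
     (\<forall>n\<in>tuples N k. F n = (\<Sum>q | q \<in> Parts k \<and> blockwise_const q n. a q))"

lemma neg_nc_strict_mono: "p \<in> Parts k \<Longrightarrow> q \<in> Parts k \<Longrightarrow> refines (points k) q p \<Longrightarrow> q \<noteq> p \<Longrightarrow> - real (nc q) < - real (nc p)"
  using nc_refines[of k q p] by force

lemma refines_refl_Parts: "p \<in> Parts k \<Longrightarrow> refines (points k) p p"
  by (simp add: Parts_def refines_refl)

lemma exists_tuple_of_kernel:
  assumes "2 * k \<le> N" "p \<in> Parts k"
  obtains n where "n \<in> tuples N k" "Ker k n = p" "card (n ` points k) \<le> nc p"
  using exists_tuple_with_Ker[of p k "{1..N}"] nc_le[of p k] assms by (metis card_atLeastAtMost diff_Suc_1 finite_atLeastAtMost order_trans)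

text \<open>
  The value of \<open>F\<close> depends on the kernel only, and every partition is a kernel since it has at most
  $2k \le N$ blocks; it remains to invert the sum over finer partitions.
\<close>

lemma partition_expansion_exists:
  assumes N: "2 * k \<le> N"
    and inv: "\<And>\<sigma>. \<sigma> permutes {1..N} \<Longrightarrow> tensor_invariant N k F (monomial_mat N \<sigma> (\<lambda>_. 1))"
  shows "\<exists>a. partition_expansion N k F a"
proof -
  \<comment> \<open>\<open>F\<close> as a function of the kernel.\<close>
  define f where "f = (\<lambda>p. F (SOME n. n \<in> tuples N k \<and> Ker k n = p))"
  have f: "F n = f (Ker k n)" if n: "n \<in> tuples N k" for n
  proof -
    define m where "m = (SOME m. m \<in> tuples N k \<and> Ker k m = Ker k n)"
    have m: "m \<in> tuples N k" "Ker k m = Ker k n"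
      using someI[of "\<lambda>m. m \<in> tuples N k \<and> Ker k m = Ker k n" n] n unfolding m_def by auto
    obtain \<sigma> where \<sigma>: "\<sigma> permutes {1..N}" "m = (\<lambda>u\<in>points k. \<sigma> (n u))"
      using exists_permutation_between_tuples[OF m(1) n m(2)] by blast
    have "F m = F n" using tensor_invariant_monomial[OF inv[OF \<sigma>(1)] \<sigma>(1) n] \<sigma>(2) by simp
    then show ?thesis unfolding f_def m_def by simp
  qed
  have "\<exists>a. \<forall>p\<in>Parts k. f p = (\<Sum>q | q \<in> Parts k \<and> refines (points k) q p. a q)"
    by (rule triangular_solution_exists[OF finite_Parts refines_refl_Parts neg_nc_strict_mono])
  then obtain a where a: "\<forall>p\<in>Parts k. f p = (\<Sum>q | q \<in> Parts k \<and> refines (points k) q p. a q)" ..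
  have "F n = (\<Sum>q | q \<in> Parts k \<and> blockwise_const q n. a q)" if "n \<in> tuples N k" for n
    unfolding f[OF that] a[rule_format, OF Ker_in_Parts]
    by (intro sum.cong) (auto simp: refines_Ker_iff)
  then show ?thesis unfolding partition_expansion_def by blast
qed

text \<open>
  This is the linear independence of the \<open>rho N k q\<close> for $N \ge 2k$.
\<close>

lemma partition_expansion_unique:
  assumes N: "2 * k \<le> N" and a: "partition_expansion N k F a" and b: "partition_expansion N k F b"
    and p: "p \<in> Parts k"
  shows "a p = b p"
proof (rule triangular_solution_unique[OF finite_Parts refines_refl_Parts neg_nc_strict_mono _ p])
  fix p assume p: "p \<in> Parts k"
  obtain n where n: "n \<in> tuples N k" "Ker k n = p" by (rule exists_tuple_of_kernel[OF N p])
  have eq: "{q. q \<in> Parts k \<and> refines (points k) q p} = {q. q \<in> Parts k \<and> blockwise_const q n}"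
    using refines_Ker_iff n by auto
  show "(\<Sum>q | q \<in> Parts k \<and> refines (points k) q p. a q) = (\<Sum>q | q \<in> Parts k \<and> refines (points k) q p. b q)"
    unfolding eq
    using a[unfolded partition_expansion_def, rule_format, OF n(1)]
      b[unfolded partition_expansion_def, rule_format, OF n(1)] by simp
qed

text \<open>
  The shape of all vanishing arguments below: if the coefficients of the strictly finer partitions are
  zero, a coefficient is itself a value of \<open>F\<close>.
\<close>

lemma partition_expansion_leading_term:
  assumes N: "2 * k \<le> N" and a: "partition_expansion N k F a" and p: "p \<in> Parts k"
    and n: "n \<in> tuples N k" "Ker k n = p"
    and finer: "\<And>q. refines (points k) q p \<Longrightarrow> q \<noteq> p \<Longrightarrow> a q = 0"
  shows "F n = a p"
proof -
  have "F n = (\<Sum>q | q \<in> Parts k \<and> refines (points k) q p. a q)"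
    using a n refines_Ker_iff unfolding partition_expansion_def
    by (auto intro!: sum.cong)
  also have "\<dots> = (\<Sum>q\<in>{p}. a q)"
    using finite_Parts[of k] refines_refl_Parts[OF p] p finer
    by (intro sum.mono_neutral_right) auto
  finally show ?thesis by simp
qed

text \<open>
  Induction from the finest partitions upwards.
\<close>

lemma finer_induct [consumes 1, case_names step]:
  assumes "p \<in> Parts k"
    and step: "\<And>p. p \<in> Parts k \<Longrightarrow> (\<And>q. refines (points k) q p \<Longrightarrow> q \<noteq> p \<Longrightarrow> Q q) \<Longrightarrow> Q p"
  shows "Q p"
  using assms(1)
proof (induction "2 * k - nc p" arbitrary: p rule: less_induct)
  case less
  show ?case
  proof (rule step[OF less.prems])
    fix q assume q: "refines (points k) q p" "q \<noteq> p"
    then have qP: "q \<in> Parts k" unfolding refines_def Parts_def by blast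
    show "Q q" using neg_nc_strict_mono[OF less.prems qP q] nc_le[OF qP] by (intro less.hyps qP) simp
  qed
qed


section \<open>Sign changes\<close>

lemma even_blocks_coarsen:
  assumes "refines (points k) q p" "\<forall>b\<in>q. even (card b)" "b \<in> p"
  shows "even (card b)"
proof -
  have pt: "partition_on b {d \<in> q. d \<subseteq> b}" by (rule refines_obtains_subset[OF assms(1,3)])
  have q: "q \<in> Parts k" using assms(1) unfolding refines_def Parts_def by blast
  have "card b = (\<Sum>d | d \<in> q \<and> d \<subseteq> b. card d)"
    using product_partition[OF pt] finite_block[OF q] by simp
  also have "even \<dots>" using assms(2) by (intro dvd_sum) auto
  finally show ?thesis .
qed

text \<open>
  Change the sign of the single basis vector whose index labels the odd block.
\<close>

lemma odd_level_vanishes: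
  assumes inv: "\<And>e. (\<And>b. e b = 1 \<or> e b = -1) \<Longrightarrow> tensor_invariant N k F (monomial_mat N id e)"
    and n: "n \<in> tuples N k" and b: "b \<in> Ker k n" "odd (card b)"
  shows "F n = 0"
proof -
  obtain u0 where u0: "b = {v \<in> points k. n v = n u0}" using b(1) unfolding Ker_def by blast
  \<comment> \<open>The sign change of the basis vector that labels the odd level.\<close>
  define e where "e = (\<lambda>x. if x = n u0 then - 1 else 1 :: complex)"
  have [simp]: "cnj (e x) = e x" for x by (simp add: e_def)
  have "(\<lambda>u\<in>points k. id (n u)) = n" using n by (auto simp: fun_eq_iff PiE_iff extensional_def)
  then have "F n = (\<Prod>j=1..k. e (n (Inr j)) * cnj (e (n (Inl j)))) * F n"
    using tensor_invariant_monomial[OF inv permutes_id n, of e] by (simp add: e_def)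
  also have "(\<Prod>j=1..k. e (n (Inr j)) * cnj (e (n (Inl j)))) = (\<Prod>u\<in>points k. e (n u))"
    using prod_points[of "\<lambda>u. e (n u)" k] by simp
  also have "\<dots> = (\<Prod>u\<in>b. - 1)"
    unfolding u0 using finite_points[of k] by (intro prod.mono_neutral_cong_right) (auto simp: e_def)
  also have "\<dots> = - 1" using b(2) by simp
  finally show ?thesis by simp
qed

text \<open>
  A partition with only even blocks refines nothing but partitions with only even blocks. Below a partition
  with an odd block, all coefficients thus vanish by induction, and the leading one is a value of \<open>F\<close>
  on a kernel with an odd block.
\<close>

lemma hyperoctahedral_coefficients:
  assumes N: "2 * k \<le> N" and a: "partition_expansion N k F a"
    and inv: "\<And>e. (\<And>b. e b = 1 \<or> e b = -1) \<Longrightarrow> tensor_invariant N k F (monomial_mat N id e)"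
    and p: "p \<in> Parts k" and "\<exists>b\<in>p. odd (card b)"
  shows "a p = 0"
  using p assms(5)
proof (induction rule: finer_induct)
  case (step p)
  obtain b where b: "b \<in> p" "odd (card b)" using step.prems by blast
  obtain n where n: "n \<in> tuples N k" "Ker k n = p" by (rule exists_tuple_of_kernel[OF N step.hyps])
  have "a q = 0" if "refines (points k) q p" "q \<noteq> p" for q
    using step.IH[OF that] even_blocks_coarsen[OF that(1)] b by blast
  from partition_expansion_leading_term[OF N a step.hyps n this] show ?case
    using odd_level_vanishes[OF inv n(1)] b n(2) by simp
qed


section \<open>Orthogonal matrices fixing the constant vector\<close>

text \<open>
  The circulant matrix with first row $(\alpha, \beta, \gamma)$ on the coordinates \<open>x\<close>, \<open>y\<close>, \<open>z\<close> (in this cyclic order),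
  and \<open>\<delta>\<close> times the identity elsewhere. The parameter \<open>\<delta>\<close> is 1 for a group element and 0 for a derivative.
\<close>

definition circulant_mat :: "nat \<Rightarrow> nat \<Rightarrow> nat \<Rightarrow> nat \<Rightarrow> complex \<Rightarrow> complex \<Rightarrow> complex \<Rightarrow> complex \<Rightarrow> cmat" where
  "circulant_mat N x y z \<alpha> \<beta> \<gamma> \<delta> = (\<lambda>a b.
     if a \<in> {x, y, z} \<and> b \<in> {x, y, z}
     then (if a = b then \<alpha> else if (a, b) \<in> {(x, y), (y, z), (z, x)} then \<beta> else \<gamma>)
     else if a = b \<and> a \<in> {1..N} then \<delta> else 0)"

lemma circulant_mat_outside:
  "\<not> (a \<in> {x, y, z} \<and> b \<in> {x, y, z}) \<Longrightarrow>
     circulant_mat N x y z \<alpha> \<beta> \<gamma> \<delta> a b = (if a = b \<and> a \<in> {1..N} then \<delta> else 0)"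
  unfolding circulant_mat_def by (rule if_not_P)

lemma circulant_mat_entries:
  assumes "x \<noteq> y" "y \<noteq> z" "x \<noteq> z"
  shows "circulant_mat N x y z \<alpha> \<beta> \<gamma> \<delta> x x = \<alpha>" "circulant_mat N x y z \<alpha> \<beta> \<gamma> \<delta> x y = \<beta>"
    "circulant_mat N x y z \<alpha> \<beta> \<gamma> \<delta> x z = \<gamma>" "circulant_mat N x y z \<alpha> \<beta> \<gamma> \<delta> y x = \<gamma>"
    "circulant_mat N x y z \<alpha> \<beta> \<gamma> \<delta> y y = \<alpha>" "circulant_mat N x y z \<alpha> \<beta> \<gamma> \<delta> y z = \<beta>"
    "circulant_mat N x y z \<alpha> \<beta> \<gamma> \<delta> z x = \<beta>" "circulant_mat N x y z \<alpha> \<beta> \<gamma> \<delta> z y = \<gamma>"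
    "circulant_mat N x y z \<alpha> \<beta> \<gamma> \<delta> z z = \<alpha>"
  using assms assms[symmetric] by (simp_all add: circulant_mat_def)

lemma circulant_mat_sum:
  assumes xyz: "x \<in> {1..N}" "y \<in> {1..N}" "z \<in> {1..N}" and d: "x \<noteq> y" "y \<noteq> z" "x \<noteq> z" and a: "a \<in> {1..N}"
  shows "(\<Sum>b=1..N. circulant_mat N x y z \<alpha> \<beta> \<gamma> \<delta> a b * h b) =
    (if a = x then \<alpha> * h x + \<beta> * h y + \<gamma> * h z
     else if a = y then \<gamma> * h x + \<alpha> * h y + \<beta> * h z
     else if a = z then \<beta> * h x + \<gamma> * h y + \<alpha> * h z else \<delta> * h a)"
proof (cases "a \<in> {x, y, z}")
  case True
  have "(\<Sum>b=1..N. circulant_mat N x y z \<alpha> \<beta> \<gamma> \<delta> a b * h b) =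
    (\<Sum>b\<in>{x, y, z}. circulant_mat N x y z \<alpha> \<beta> \<gamma> \<delta> a b * h b)"
  proof (rule sum.mono_neutral_right)
    show "\<forall>b\<in>{1..N} - {x, y, z}. circulant_mat N x y z \<alpha> \<beta> \<gamma> \<delta> a b * h b = 0"
      using True by (auto simp: circulant_mat_def)
  qed (use xyz in auto)
  also have "\<dots> = circulant_mat N x y z \<alpha> \<beta> \<gamma> \<delta> a x * h x +
      circulant_mat N x y z \<alpha> \<beta> \<gamma> \<delta> a y * h y + circulant_mat N x y z \<alpha> \<beta> \<gamma> \<delta> a z * h z"
    using d by simp
  finally have *: "(\<Sum>b=1..N. circulant_mat N x y z \<alpha> \<beta> \<gamma> \<delta> a b * h b) = \<dots>" .
  consider "a = x" | "a = y" | "a = z" using True by blast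
  then show ?thesis unfolding * by cases (use d d[symmetric] in \<open>simp_all add: circulant_mat_entries\<close>)
next
  case False
  have "(\<Sum>b=1..N. circulant_mat N x y z \<alpha> \<beta> \<gamma> \<delta> a b * h b) = (\<Sum>b=1..N. if b = a then \<delta> * h a else 0)"
    using False by (intro sum.cong refl) (simp add: circulant_mat_def)
  then show ?thesis using a False by simp
qed

lemma circulant_mat_transpose:
  assumes d: "x \<noteq> y" "y \<noteq> z" "x \<noteq> z"
  shows "circulant_mat N x y z \<alpha> \<beta> \<gamma> \<delta> b a = circulant_mat N x y z \<alpha> \<gamma> \<beta> \<delta> a b"
proof (cases "a \<in> {x, y, z} \<and> b \<in> {x, y, z}")
  case True
  then consider "a = x" | "a = y" | "a = z" by blast
  then show ?thesis
  proof cases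
    case 1
    from True consider "b = x" | "b = y" | "b = z" by blast
    then show ?thesis by cases (use 1 d d[symmetric] in \<open>simp_all add: circulant_mat_entries\<close>)
  next
    case 2
    from True consider "b = x" | "b = y" | "b = z" by blast
    then show ?thesis by cases (use 2 d d[symmetric] in \<open>simp_all add: circulant_mat_entries\<close>)
  next
    case 3
    from True consider "b = x" | "b = y" | "b = z" by blast
    then show ?thesis by cases (use 3 d d[symmetric] in \<open>simp_all add: circulant_mat_entries\<close>)
  qed
next
  case False
  then have False': "\<not> (b \<in> {x, y, z} \<and> a \<in> {x, y, z})" by blast
  show ?thesis unfolding circulant_mat_outside[OF False] circulant_mat_outside[OF False'] by auto
qed

text \<open>
  The rows are unit vectors because
  $\alpha^2 + \beta^2 + \gamma^2 = (\alpha + \beta + \gamma)^2 - 2 (\alpha \beta + \beta \gamma + \gamma \alpha)$; distinct rows have scalar product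
  $\alpha \beta + \beta \gamma + \gamma \alpha = 0$.
\<close>

lemma circulant_mat_orthogonal:
  assumes xyz: "x \<in> {1..N}" "y \<in> {1..N}" "z \<in> {1..N}" and d: "x \<noteq> y" "y \<noteq> z" "x \<noteq> z"
    and s: "\<alpha> + \<beta> + \<gamma> = 1" "\<alpha> * \<beta> + \<beta> * \<gamma> + \<gamma> * \<alpha> = 0"
  shows "mat_mul {1..N} (circulant_mat N x y z \<alpha> \<beta> \<gamma> 1) (circulant_mat N x y z \<alpha> \<gamma> \<beta> 1) = one_mat N"
proof (intro ext)
  fix a b
  have sq: "\<alpha> * \<alpha> + \<beta> * \<beta> + \<gamma> * \<gamma> = 1"
  proof -
    have "\<alpha> * \<alpha> + \<beta> * \<beta> + \<gamma> * \<gamma> = (\<alpha> + \<beta> + \<gamma>)\<^sup>2 - 2 * (\<alpha> * \<beta> + \<beta> * \<gamma> + \<gamma> * \<alpha>)"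
      by (simp add: power2_eq_square algebra_simps)
    then show ?thesis using s by simp
  qed
  have s2: "\<alpha> * \<gamma> + \<beta> * \<alpha> + \<gamma> * \<beta> = 0" "\<alpha> * \<beta> + \<beta> * \<gamma> + \<gamma> * \<alpha> = 0"
    "\<gamma> * \<alpha> + \<alpha> * \<beta> + \<beta> * \<gamma> = 0" "\<gamma> * \<beta> + \<alpha> * \<gamma> + \<beta> * \<alpha> = 0"
    "\<beta> * \<alpha> + \<gamma> * \<beta> + \<alpha> * \<gamma> = 0" "\<beta> * \<gamma> + \<gamma> * \<alpha> + \<alpha> * \<beta> = 0"
    and sq2: "\<gamma> * \<gamma> + \<alpha> * \<alpha> + \<beta> * \<beta> = 1" "\<beta> * \<beta> + \<gamma> * \<gamma> + \<alpha> * \<alpha> = 1"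
    using s(2) sq by (simp_all only: ac_simps)
  let ?C = "circulant_mat N x y z \<alpha> \<gamma> \<beta> 1"
  have out: "?C a' b' = (if a' = b' \<and> a' \<in> {1..N} then 1 else 0)" if "a' \<notin> {x, y, z} \<or> b' \<notin> {x, y, z}" for a' b'
    using that by (intro circulant_mat_outside) blast
  show "mat_mul {1..N} (circulant_mat N x y z \<alpha> \<beta> \<gamma> 1) ?C a b = one_mat N a b"
  proof (cases "a \<in> {1..N}")
    case True
    note sum = circulant_mat_sum[OF xyz d True, of \<alpha> \<beta> \<gamma> 1 "\<lambda>m. ?C m b"]
    have "(\<Sum>m=1..N. circulant_mat N x y z \<alpha> \<beta> \<gamma> 1 a m * ?C m b) = one_mat N a b"
    proof (cases "a \<in> {x, y, z} \<and> b \<in> {x, y, z}")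
      case ab: True
      then consider "a = x" | "a = y" | "a = z" by blast
      then show ?thesis
      proof cases
        case 1
        from ab consider "b = x" | "b = y" | "b = z" by blast
        then show ?thesis unfolding sum
          by cases (use 1 d d[symmetric] xyz in \<open>simp_all add: circulant_mat_entries one_mat_def sq sq2 s2\<close>)
      next
        case 2
        from ab consider "b = x" | "b = y" | "b = z" by blast
        then show ?thesis unfolding sum
          by cases (use 2 d d[symmetric] xyz in \<open>simp_all add: circulant_mat_entries one_mat_def sq sq2 s2\<close>)
      next
        case 3
        from ab consider "b = x" | "b = y" | "b = z" by blast
        then show ?thesis unfolding sum
          by cases (use 3 d d[symmetric] xyz in \<open>simp_all add: circulant_mat_entries one_mat_def sq sq2 s2\<close>)
      qed
    next
      case False
      show ?thesis
      proof (cases "a \<in> {x, y, z}")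
        case True
        then have "?C x b = 0" "?C y b = 0" "?C z b = 0" "a \<noteq> b" using False out by auto
        then show ?thesis unfolding sum using True by (auto simp: one_mat_def)
      next
        case na: False
        then show ?thesis unfolding sum using out[of a b] True by (auto simp: one_mat_def)
      qed
    qed
    then show ?thesis unfolding mat_mul_def .
  next
    case False
    then have "circulant_mat N x y z \<alpha> \<beta> \<gamma> 1 a m = 0" for m
      using False xyz by (subst circulant_mat_outside) auto
    then show ?thesis using False by (simp add: mat_mul_def one_mat_def)
  qed
qed

text \<open>
  These are the rotations of the span of three basis vectors around the axis $(1, 1, 1)$.
\<close>

lemma circulant_mat_in_group:
  assumes xyz: "x \<in> {1..N}" "y \<in> {1..N}" "z \<in> {1..N}" and d: "x \<noteq> y" "y \<noteq> z" "x \<noteq> z"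
    and s: "\<alpha> + \<beta> + \<gamma> = 1" "\<alpha> * \<beta> + \<beta> * \<gamma> + \<gamma> * \<alpha> = 0" and r: "\<alpha> \<in> \<real>" "\<beta> \<in> \<real>" "\<gamma> \<in> \<real>"
  shows "circulant_mat N x y z \<alpha> \<beta> \<gamma> 1 \<in> cat_group BrauerS N"
proof -
  let ?g = "circulant_mat N x y z \<alpha> \<beta> \<gamma> 1"
  note tr = circulant_mat_transpose[OF d]
  have t: "(\<lambda>a b. ?g b a) = circulant_mat N x y z \<alpha> \<gamma> \<beta> 1" using tr by (intro ext)
  have s': "\<alpha> + \<gamma> + \<beta> = 1" "\<alpha> * \<gamma> + \<gamma> * \<beta> + \<beta> * \<alpha> = 0" using s by (simp_all add: algebra_simps)
  have "?g a b = 0" if "a \<notin> {1..N} \<or> b \<notin> {1..N}" for a b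
  proof -
    have "a \<noteq> x \<and> a \<noteq> y \<and> a \<noteq> z \<or> b \<noteq> x \<and> b \<noteq> y \<and> b \<noteq> z" using that xyz by blast
    then have "\<not> (a \<in> {x, y, z} \<and> b \<in> {x, y, z})" by simp
    then show ?thesis using that by (subst circulant_mat_outside) auto
  qed
  then have "?g \<in> mats N" unfolding mats_def by blast
  moreover have "?g a b \<in> \<real>" for a b
    unfolding circulant_mat_def using r by (simp only: Reals_1 Reals_0 split: if_split) simp
  ultimately have "?g \<in> orthogonal_group N"
    unfolding orthogonal_group_def mem_Collect_eq t
    using circulant_mat_orthogonal[OF xyz d s] circulant_mat_orthogonal[OF xyz d s'] by blast
  moreover have "(\<Sum>b=1..N. ?g a b) = 1" if "a \<in> {1..N}" for a
  proof -
    have "\<gamma> + \<alpha> + \<beta> = 1" "\<beta> + \<gamma> + \<alpha> = 1" using s(1) by (simp_all only: ac_simps)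
    then show ?thesis
      using circulant_mat_sum[OF xyz d that, of \<alpha> \<beta> \<gamma> 1 "\<lambda>_. 1"] s(1) by (simp split: if_splits)
  qed
  moreover have "(\<Sum>a=1..N. ?g a b) = 1" if "b \<in> {1..N}" for b
  proof -
    have "\<beta> + \<alpha> + \<gamma> = 1" "\<gamma> + \<beta> + \<alpha> = 1" using s(1) by (simp_all only: ac_simps)
    then show ?thesis
      using circulant_mat_sum[OF xyz d that, of \<alpha> \<gamma> \<beta> 1 "\<lambda>_. 1"] s'(1) unfolding tr[of N \<alpha> \<beta> \<gamma> 1 _ b]
      by (simp split: if_splits)
  qed
  ultimately show ?thesis by simp
qed


lemma circulant_mat_has_field_derivative:
  assumes "(\<alpha> has_field_derivative \<alpha>') (at w)" "(\<beta> has_field_derivative \<beta>') (at w)"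
    "(\<gamma> has_field_derivative \<gamma>') (at w)"
  shows "((\<lambda>w. circulant_mat N x y z (\<alpha> w) (\<beta> w) (\<gamma> w) 1 a b) has_field_derivative
     circulant_mat N x y z \<alpha>' \<beta>' \<gamma>' 0 a b) (at w)"
proof -
  have "((\<lambda>w. if P then (if Q then \<alpha> w else if R then \<beta> w else \<gamma> w) else if S then 1 else 0)
    has_field_derivative (if P then (if Q then \<alpha>' else if R then \<beta>' else \<gamma>') else if S then 0 else 0)) (at w)"
    for P Q R S using assms by (cases P; cases Q; cases R; cases S) simp_all
  then show ?thesis unfolding circulant_mat_def .
qed

lemma circulant_mat_identity:
  assumes "x \<in> {1..N}" "y \<in> {1..N}" "z \<in> {1..N}" "x \<noteq> y" "y \<noteq> z" "x \<noteq> z"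
  shows "circulant_mat N x y z 1 0 0 1 = one_mat N"
proof (intro ext)
  fix a b
  show "circulant_mat N x y z 1 0 0 1 a b = one_mat N a b"
  proof (cases "a \<in> {x, y, z} \<and> b \<in> {x, y, z}")
    case True
    then have "a \<in> {1..N}" using assms by blast
    moreover have "circulant_mat N x y z 1 0 0 1 a b = (if a = b then 1 else 0)"
      unfolding circulant_mat_def if_P[OF True] by simp
    ultimately show ?thesis by (simp add: one_mat_def)
  next
    case False
    then show ?thesis unfolding circulant_mat_outside[OF False] one_mat_def by simp
  qed
qed

lemma fun_upd_in_tuples: "n \<in> tuples N k \<Longrightarrow> u \<in> points k \<Longrightarrow> b \<in> {1..N} \<Longrightarrow> n(u := b) \<in> tuples N k"
  by (auto simp: PiE_iff extensional_def)

text \<open>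
  The tuples that agree with \<open>n\<close> off \<open>u\<close> are the \<open>n(u := b)\<close>.
\<close>

lemma sum_single_change:
  assumes n: "n \<in> tuples N k" and u: "u \<in> points k"
  shows "(\<Sum>m\<in>tuples N k. X (m u) * (\<Prod>v\<in>points k - {u}. one_mat N (n v) (m v)) * F m) =
     (\<Sum>b=1..N. X b * F (n(u := b)))"
proof -
  let ?S = "(\<lambda>b. n(u := b)) ` {1..N}"
  have inS: "m \<in> ?S" if m: "m \<in> tuples N k" and eq: "\<And>v. v \<in> points k - {u} \<Longrightarrow> n v = m v" for m
  proof -
    have "m = n(u := m u)"
      by (rule PiE_ext[OF m fun_upd_in_tuples[OF n u PiE_mem[OF m u]]]) (use eq in auto)
    then show ?thesis using PiE_mem[OF m u] by blast
  qed
  have "(\<Sum>m\<in>tuples N k. X (m u) * (\<Prod>v\<in>points k - {u}. one_mat N (n v) (m v)) * F m) =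
    (\<Sum>m\<in>?S. X (m u) * (\<Prod>v\<in>points k - {u}. one_mat N (n v) (m v)) * F m)"
  proof (rule sum.mono_neutral_right[OF finite_tuples])
    show "?S \<subseteq> tuples N k" using fun_upd_in_tuples[OF n u] by blast
    show "\<forall>m\<in>tuples N k - ?S. X (m u) * (\<Prod>v\<in>points k - {u}. one_mat N (n v) (m v)) * F m = 0"
    proof
      fix m assume m: "m \<in> tuples N k - ?S"
      then obtain v where "v \<in> points k - {u}" "n v \<noteq> m v" using inS by blast
      then have "\<exists>v\<in>points k - {u}. one_mat N (n v) (m v) = 0" by (auto simp: one_mat_def)
      then show "X (m u) * (\<Prod>v\<in>points k - {u}. one_mat N (n v) (m v)) * F m = 0"
        using finite_points by simp
    qed
  qed
  also have "\<dots> = (\<Sum>b=1..N. X b * (\<Prod>v\<in>points k - {u}. one_mat N (n v) ((n(u := b)) v)) * F (n(u := b)))"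
    by (subst sum.reindex) (auto simp: inj_on_def fun_eq_iff dest: fun_upd_eqD)
  also have "\<dots> = (\<Sum>b=1..N. X b * F (n(u := b)))"
  proof (intro sum.cong refl)
    fix b
    have "(\<Prod>v\<in>points k - {u}. one_mat N (n v) ((n(u := b)) v)) = 1"
      using PiE_mem[OF n] by (intro prod.neutral) (auto simp: one_mat_def)
    then show "X b * (\<Prod>v\<in>points k - {u}. one_mat N (n v) ((n(u := b)) v)) * F (n(u := b)) = X b * F (n(u := b))"
      by simp
  qed
  finally show ?thesis .
qed

text \<open>
  The derivative at the identity of the invariance under a curve of rotations around $(1, 1, 1)$. The curve is
  the rational one
  $(\alpha, \beta, \gamma) = (1 + w, w + w^2, -w) / (1 + w + w^2)$, for which $\alpha + \beta + \gamma = 1$ and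
  $\alpha \beta + \beta \gamma + \gamma \alpha = 0$ are polynomial identities; its velocity at $w = 0$ is $(0, 1, -1)$. The
  expression is differentiated as a function of a complex variable, and it is constant on the real
  axis, where the matrices belong to the group.
\<close>

lemma infinitesimal_invariance:
  assumes xyz: "x \<in> {1..N}" "y \<in> {1..N}" "z \<in> {1..N}" and d: "x \<noteq> y" "y \<noteq> z" "x \<noteq> z"
    and inv: "\<And>g. g \<in> cat_group BrauerS N \<Longrightarrow> tensor_invariant N k F g"
    and n: "n \<in> tuples N k"
  shows "(\<Sum>u\<in>points k. \<Sum>b=1..N. circulant_mat N x y z 0 1 (- 1) 0 (n u) b * F (n(u := b))) = 0"
proof -
  define \<alpha> \<beta> \<gamma> :: "complex \<Rightarrow> complex" where "\<alpha> = (\<lambda>w. (1 + w) / (1 + w + w\<^sup>2))"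
    and "\<beta> = (\<lambda>w. (w + w\<^sup>2) / (1 + w + w\<^sup>2))" and "\<gamma> = (\<lambda>w. - w / (1 + w + w\<^sup>2))"
  define g where "g = (\<lambda>w. circulant_mat N x y z (\<alpha> w) (\<beta> w) (\<gamma> w) 1)"
  let ?X = "circulant_mat N x y z 0 1 (- 1) 0"
  have g0: "g 0 = one_mat N"
    unfolding g_def \<alpha>_def \<beta>_def \<gamma>_def using circulant_mat_identity[OF xyz d] by simp
  have dg: "((\<lambda>w. g w a b) has_field_derivative ?X a b) (at 0)" for a b
    unfolding g_def
  proof (rule circulant_mat_has_field_derivative)
    show "(\<alpha> has_field_derivative 0) (at 0)" unfolding \<alpha>_def by (auto intro!: derivative_eq_intros)
    show "(\<beta> has_field_derivative 1) (at 0)" unfolding \<beta>_def by (auto intro!: derivative_eq_intros)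
    show "(\<gamma> has_field_derivative - 1) (at 0)" unfolding \<gamma>_def by (auto intro!: derivative_eq_intros)
  qed
  define h where "h = (\<lambda>w. \<Sum>m\<in>tuples N k. (\<Prod>u\<in>points k. g w (n u) (m u)) * F m)"
  have "(h has_field_derivative (\<Sum>m\<in>tuples N k. (\<Sum>u\<in>points k. ?X (n u) (m u) *
      (\<Prod>v\<in>points k - {u}. g 0 (n v) (m v))) * F m)) (at 0)"
    unfolding h_def by (intro DERIV_sum DERIV_cmult_right has_field_derivative_prod dg)
  also have "(\<Sum>m\<in>tuples N k. (\<Sum>u\<in>points k. ?X (n u) (m u) *
      (\<Prod>v\<in>points k - {u}. g 0 (n v) (m v))) * F m) =
    (\<Sum>u\<in>points k. \<Sum>m\<in>tuples N k. ?X (n u) (m u) * (\<Prod>v\<in>points k - {u}. one_mat N (n v) (m v)) * F m)"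
    unfolding sum_distrib_right g0 by (rule sum.swap)
  also have "\<dots> = (\<Sum>u\<in>points k. \<Sum>b=1..N. ?X (n u) b * F (n(u := b)))"
    by (intro sum.cong refl sum_single_change[OF n])
  finally have dh: "(h has_field_derivative (\<Sum>u\<in>points k. \<Sum>b=1..N. ?X (n u) b * F (n(u := b)))) (at (complex_of_real 0))"
    by simp
  \<comment> \<open>For real parameters the matrices are real and belong to the group.\<close>
  have const: "h (complex_of_real t) = F n" for t :: real
  proof -
    let ?D = "1 + t + t\<^sup>2"
    have "?D = (t + 1 / 2)\<^sup>2 + 3 / 4" by (simp add: power2_eq_square algebra_simps)
    moreover have "(t + 1 / 2)\<^sup>2 \<ge> 0" by simp
    ultimately have D: "?D \<noteq> 0" by linarith
    have r: "\<alpha> (of_real t) = of_real ((1 + t) / ?D)" "\<beta> (of_real t) = of_real ((t + t\<^sup>2) / ?D)"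
      "\<gamma> (of_real t) = of_real (- t / ?D)"
      unfolding \<alpha>_def \<beta>_def \<gamma>_def by simp_all
    have s: "(1 + t) / ?D + (t + t\<^sup>2) / ?D + - t / ?D = 1"
      using D by (simp add: add_divide_distrib[symmetric] diff_divide_distrib[symmetric])
    have q: "(1 + t) / ?D * ((t + t\<^sup>2) / ?D) + (t + t\<^sup>2) / ?D * (- t / ?D) + - t / ?D * ((1 + t) / ?D) = 0"
    proof -
      have "(1 + t) * (t + t\<^sup>2) + (t + t\<^sup>2) * (- t) + - t * (1 + t) = 0" by (simp add: algebra_simps power2_eq_square)
      then show ?thesis by (simp add: add_divide_distrib[symmetric] diff_divide_distrib[symmetric])
    qed
    have rr: "\<alpha> (of_real t) \<in> \<real>" "\<beta> (of_real t) \<in> \<real>" "\<gamma> (of_real t) \<in> \<real>" unfolding r by auto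
    have gt: "g (of_real t) \<in> cat_group BrauerS N"
      unfolding g_def
    proof (rule circulant_mat_in_group[OF xyz d _ _ rr])
      show "\<alpha> (of_real t) + \<beta> (of_real t) + \<gamma> (of_real t) = 1"
        unfolding r using arg_cong[OF s, of complex_of_real] by simp
      show "\<alpha> (of_real t) * \<beta> (of_real t) + \<beta> (of_real t) * \<gamma> (of_real t) + \<gamma> (of_real t) * \<alpha> (of_real t) = 0"
        unfolding r using arg_cong[OF q, of complex_of_real] by simp
    qed
    then have real: "cnj (g (of_real t) a b) = g (of_real t) a b" for a b
      by (simp add: orthogonal_group_def Reals_cnj_iff)
    have "F n = (\<Sum>m\<in>tuples N k. (\<Prod>j=1..k. g (of_real t) (n (Inr j)) (m (Inr j)) * g (of_real t) (n (Inl j)) (m (Inl j))) * F m)"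
      using bspec[OF inv[OF gt, unfolded tensor_invariant_def] n] unfolding real by simp
    also have "\<dots> = h (of_real t)"
      unfolding h_def using prod_points[of "\<lambda>u. g (of_real t) (n u) (_ u)" k]
      by (intro sum.cong refl) (simp add: prod_points[symmetric])
    finally show ?thesis by simp
  qed
  have "((\<lambda>t. h (complex_of_real t)) has_vector_derivative (\<Sum>u\<in>points k. \<Sum>b=1..N. ?X (n u) b * F (n(u := b)))) (at 0)"
    using has_vector_derivative_real_field[OF dh] .
  moreover have "((\<lambda>t. h (complex_of_real t)) has_vector_derivative 0) (at 0)"
    unfolding const by simp
  ultimately show ?thesis by (rule vector_derivative_unique_at)
qed


text \<open>
  Giving a set \<open>S\<close> inside one level of \<open>n\<close> a fresh value splits it off, which is compatible with \<open>q\<close> exactly when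
  \<open>S\<close> is a union of blocks of \<open>q\<close>.
\<close>

lemma blockwise_const_fresh:
  assumes q: "q \<in> Parts k" and S: "S \<subseteq> points k" and w: "w \<notin> n ` points k"
    and S_const: "\<And>u v. u \<in> S \<Longrightarrow> v \<in> S \<Longrightarrow> n u = n v"
  shows "blockwise_const q (\<lambda>u. if u \<in> S then w else n u) \<longleftrightarrow>
     blockwise_const q n \<and> (\<forall>d\<in>q. d \<subseteq> S \<or> d \<inter> S = {})"
proof
  let ?m = "\<lambda>u. if u \<in> S then w else n u"
  assume m: "blockwise_const q ?m"
  have "d \<subseteq> S \<or> d \<inter> S = {}" if d: "d \<in> q" for d
  proof (rule ccontr)
    assume "\<not> (d \<subseteq> S \<or> d \<inter> S = {})"
    then obtain u v where uv: "u \<in> d" "v \<in> d" "u \<in> S" "v \<notin> S" by blast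
    then have "w = n v" using blockwise_constD[OF m d uv(1,2)] by simp
    then show False using w block_subset[OF q d] uv(2) by blast
  qed
  moreover have "blockwise_const q n"
    unfolding blockwise_const_def
  proof (intro ballI)
    fix d u v assume d: "d \<in> q" "u \<in> d" "v \<in> d"
    show "n u = n v"
    proof (cases "u \<in> S")
      case True
      then have "v \<in> S" using calculation[OF d(1)] d by blast
      then show ?thesis using S_const True by blast
    next
      case False
      then have "v \<notin> S" using calculation[OF d(1)] d by blast
      then show ?thesis using blockwise_constD[OF m d] False by simp
    qed
  qed
  ultimately show "blockwise_const q n \<and> (\<forall>d\<in>q. d \<subseteq> S \<or> d \<inter> S = {})" by blast
next
  assume n: "blockwise_const q n \<and> (\<forall>d\<in>q. d \<subseteq> S \<or> d \<inter> S = {})"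
  show "blockwise_const q (\<lambda>u. if u \<in> S then w else n u)"
    unfolding blockwise_const_def
  proof (intro ballI)
    fix d u v assume d: "d \<in> q" "u \<in> d" "v \<in> d"
    then have "n u = n v" "u \<in> S \<longleftrightarrow> v \<in> S" using n blockwise_constD[of q n d u v] by blast+
    then show "(if u \<in> S then w else n u) = (if v \<in> S then w else n v)" by simp
  qed
qed

lemma two_le_cardE:
  assumes "card S \<ge> 2" obtains y z where "y \<in> S" "z \<in> S" "y \<noteq> z"
proof -
  have "S \<noteq> {}" "\<not> is_singleton S" using assms by (auto simp: is_singleton_altdef)
  then show ?thesis using that unfolding is_singleton_def by (metis all_not_in_conv is_singletonI' is_singleton_def)
qed

text \<open>
  The infinitesimal invariance at the tuple where \<open>b0\<close> has been moved from the value \<open>x\<close> of its level \<open>B\<close> to a fresh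
  value \<open>y\<close>, while \<open>z\<close> remains fresh. Moving \<open>b0\<close> back to \<open>x\<close> gives \<open>F n\<close>, moving it to \<open>z\<close> isolates it, and moving
  another point \<open>c\<close> of \<open>B\<close> to \<open>y\<close> or to \<open>z\<close> pairs it with \<open>b0\<close> or isolates both.
\<close>

lemma rotation_relation:
  assumes inv: "\<And>g. g \<in> cat_group BrauerS N \<Longrightarrow> tensor_invariant N k F g"
    and n: "n \<in> tuples N k" and b0: "b0 \<in> points k"
    and yz: "y \<in> {1..N}" "z \<in> {1..N}" "y \<notin> n ` points k" "z \<notin> n ` points k" "y \<noteq> z"
  defines "B \<equiv> {v \<in> points k. n v = n b0}"
  shows "F n = F (n(b0 := z)) + (\<Sum>c\<in>B - {b0}. F (n(b0 := y, c := y)) - F (n(b0 := y, c := z)))"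
proof -
  define x where "x = n b0"
  define n1 where "n1 = n(b0 := y)"
  have x: "x \<in> {1..N}" unfolding x_def using PiE_mem[OF n b0] .
  have d: "x \<noteq> y" "y \<noteq> z" "x \<noteq> z" using yz b0 unfolding x_def by auto
  have n1: "n1 \<in> tuples N k" unfolding n1_def by (rule fun_upd_in_tuples[OF n b0 yz(1)])
  define G where "G = (\<lambda>u. \<Sum>b=1..N. circulant_mat N x y z 0 1 (- 1) 0 (n1 u) b * F (n1(u := b)))"
  have b0B: "b0 \<in> B" "B \<subseteq> points k" unfolding B_def using b0 by auto
  have fin: "finite B" using b0B finite_points finite_subset by blast
  have G: "G u = (if n1 u = x then F (n1(u := y)) - F (n1(u := z))
     else if n1 u = y then - F (n1(u := x)) + F (n1(u := z))
     else if n1 u = z then F (n1(u := x)) - F (n1(u := y)) else 0)" if "u \<in> points k" for u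
    unfolding G_def circulant_mat_sum[OF x yz(1,2) d PiE_mem[OF n1 that]] by (simp split: if_split)
  have "0 = (\<Sum>u\<in>points k. G u)"
    unfolding G_def by (rule infinitesimal_invariance[OF x yz(1,2) d inv n1, symmetric])
  also have "\<dots> = (\<Sum>u\<in>B. G u)"
  proof (rule sum.mono_neutral_right[OF finite_points b0B(2)], rule ballI)
    fix u assume u: "u \<in> points k - B"
    then have "n1 u \<noteq> x" "n1 u \<noteq> y" "n1 u \<noteq> z" using yz b0B unfolding n1_def x_def B_def by auto
    then show "G u = 0" using G u by simp
  qed
  also have "\<dots> = G b0 + (\<Sum>c\<in>B - {b0}. G c)" by (rule sum.remove[OF fin b0B(1)])
  also have "G b0 = - F n + F (n(b0 := z))"
  proof -
    have "n1 b0 = y" "n1(b0 := x) = n" "n1(b0 := z) = n(b0 := z)" unfolding n1_def x_def by simp_all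
    then show ?thesis using G[OF b0] d(1) by simp
  qed
  also have "(\<Sum>c\<in>B - {b0}. G c) = (\<Sum>c\<in>B - {b0}. F (n(b0 := y, c := y)) - F (n(b0 := y, c := z)))"
  proof (intro sum.cong refl)
    fix c assume c: "c \<in> B - {b0}"
    then have "c \<in> points k" "n1 c = x" unfolding B_def n1_def x_def by auto
    then show "G c = F (n(b0 := y, c := y)) - F (n(b0 := y, c := z))" using G unfolding n1_def by simp
  qed
  finally have zero: "0 = - F n + F (n(b0 := z)) + (\<Sum>c\<in>B - {b0}. F (n(b0 := y, c := y)) - F (n(b0 := y, c := z)))" .
  have "s = t + w" if "0 = - s + t + w" for s t w :: complex using that by algebra
  from this[OF zero] show ?thesis .
qed

text \<open>
  Every tuple on the right of the preceding relation has a kernel strictly finer than \<open>p\<close> when the block \<open>B\<close> has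
  more than two elements. Expand the difference of the two sides: \<open>J q\<close> is the total factor of \<open>a q\<close>. It is 1 for
  \<open>q = p\<close>, and 0 if \<open>q\<close> does not refine \<open>p\<close>. It is also 0 if the blocks of \<open>q\<close> have at most two elements, since then \<open>b0\<close> is either isolated in \<open>q\<close> or paired with
  exactly one point \<open>c\<close>, and this accounts for \<open>F n\<close> exactly once. The remaining coefficients vanish by
  induction.
\<close>

lemma bistochastic_coefficients:
  assumes N: "2 * k \<le> N" and a: "partition_expansion N k F a"
    and inv: "\<And>g. g \<in> cat_group BrauerS N \<Longrightarrow> tensor_invariant N k F g"
    and p: "p \<in> Parts k" and "\<exists>b\<in>p. card b > 2"
  shows "a p = 0"
  using p assms(5)
proof (induction rule: finer_induct)
  case (step p)
  obtain B where B: "B \<in> p" "card B > 2" using step.prems by blast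
  have finB: "finite B" by (rule finite_block[OF step.hyps B(1)])
  have BP: "B \<subseteq> points k" by (rule block_subset[OF step.hyps B(1)])
  obtain n where n: "n \<in> tuples N k" "Ker k n = p" "card (n ` points k) \<le> nc p" by (rule exists_tuple_of_kernel[OF N step.hyps])
  obtain b0 where b0: "b0 \<in> B" using block_nonempty[OF step.hyps B(1)] by blast
  have b0P: "b0 \<in> points k" using b0 BP by blast
  have B_eq: "B = {v \<in> points k. n v = n b0}"
  proof -
    have "{v \<in> points k. n v = n b0} \<in> p" using n(2) b0P unfolding Ker_def by blast
    then show ?thesis using block_disjoint[OF step.hyps B(1) _ b0] b0P by blast
  qed
  \<comment> \<open>A block with three elements leaves two indices of $\{1, \dots, N\}$ that no block uses.\<close>
  have "nc p + 2 \<le> 2 * k"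
  proof -
    have pt: "partition_on (points k) p" using step.hyps unfolding Parts_def by simp
    have "2 * k = (\<Sum>b\<in>p. card b)"
      using product_partition[OF pt] finite_block[OF step.hyps] card_points by simp
    also have "\<dots> = card B + (\<Sum>b\<in>p - {B}. card b)"
      by (rule sum.remove[OF finite_part[OF step.hyps] B(1)])
    also have "\<dots> \<ge> 3 + (\<Sum>b\<in>p - {B}. 1)"
      using B(2) finite_block[OF step.hyps] block_nonempty[OF step.hyps]
      by (intro add_mono sum_mono) (auto simp: Suc_le_eq card_gt_0_iff)
    finally show ?thesis using card.remove[OF finite_part[OF step.hyps] B(1)] unfolding nc_def by simp
  qed
  moreover have "card ({1..N} - n ` points k) = N - card (n ` points k)"
    using n(1) finite_points by (subst card_Diff_subset) (auto dest: PiE_mem)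
  ultimately have "card ({1..N} - n ` points k) \<ge> 2" using n(3) N by simp
  then obtain y z where "y \<in> {1..N} - n ` points k" "z \<in> {1..N} - n ` points k" "y \<noteq> z"
    by (rule two_le_cardE)
  then have yz: "y \<in> {1..N}" "z \<in> {1..N}" "y \<notin> n ` points k" "z \<notin> n ` points k" "y \<noteq> z"
    by blast+
  define I where "I = (\<lambda>q (m :: point \<Rightarrow> nat). if blockwise_const q m then 1 else 0 :: complex)"
  define J where "J = (\<lambda>q. I q n - I q (n(b0 := z)) -
     (\<Sum>c\<in>B - {b0}. I q (n(b0 := y, c := y)) - I q (n(b0 := y, c := z))))"
  \<comment> \<open>A set is saturated if it is a union of blocks. For each tuple below,
    compatibility with \<open>q\<close> reduces to saturation of the sets that received fresh values.\<close>
  define sat where "sat = (\<lambda>q S. \<forall>d\<in>q. d \<subseteq> S \<or> d \<inter> S = ({} :: point set))"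
  have F: "F m = (\<Sum>q\<in>Parts k. a q * I q m)" if "m \<in> tuples N k" for m
    using a that finite_Parts[of k] unfolding partition_expansion_def I_def
    by (auto intro!: sum.mono_neutral_cong_left split: if_splits)
  have t: "n(b0 := z) \<in> tuples N k" "n(b0 := y, c := y) \<in> tuples N k" "n(b0 := y, c := z) \<in> tuples N k"
    if "c \<in> B - {b0}" for c
    using that BP b0P yz n(1) by (auto intro!: fun_upd_in_tuples)
  have t0: "n(b0 := z) \<in> tuples N k" by (rule fun_upd_in_tuples[OF n(1) b0P yz(2)])
  have "(\<Sum>q\<in>Parts k. a q * J q) = F n - F (n(b0 := z)) -
     (\<Sum>c\<in>B - {b0}. F (n(b0 := y, c := y)) - F (n(b0 := y, c := z)))"
  proof -
    have "(\<Sum>q\<in>Parts k. a q * J q) = (\<Sum>q\<in>Parts k. a q * I q n) - (\<Sum>q\<in>Parts k. a q * I q (n(b0 := z))) -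
      (\<Sum>q\<in>Parts k. \<Sum>c\<in>B - {b0}. a q * I q (n(b0 := y, c := y)) - a q * I q (n(b0 := y, c := z)))"
      unfolding J_def by (simp add: right_diff_distrib sum_subtractf sum_distrib_left)
    also have "(\<Sum>q\<in>Parts k. \<Sum>c\<in>B - {b0}. a q * I q (n(b0 := y, c := y)) - a q * I q (n(b0 := y, c := z))) =
      (\<Sum>c\<in>B - {b0}. \<Sum>q\<in>Parts k. a q * I q (n(b0 := y, c := y)) - a q * I q (n(b0 := y, c := z)))"
      by (rule sum.swap)
    also have "\<dots> = (\<Sum>c\<in>B - {b0}. F (n(b0 := y, c := y)) - F (n(b0 := y, c := z)))"
      by (intro sum.cong refl) (simp only: F[OF t(2)] F[OF t(3)] sum_subtractf)
    finally show ?thesis unfolding F[OF n(1)] F[OF t0] .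
  qed
  also have "\<dots> = 0"
    using rotation_relation[OF inv n(1) b0P yz] unfolding B_eq[symmetric] by simp
  finally have zero: "(\<Sum>q\<in>Parts k. a q * J q) = 0" .
  have I1: "I q (n(b0 := z)) = (if blockwise_const q n \<and> sat q {b0} then 1 else 0)"
    and I2: "c \<in> B - {b0} \<Longrightarrow> I q (n(b0 := y, c := y)) = (if blockwise_const q n \<and> sat q {b0, c} then 1 else 0)"
    and I3: "c \<in> B - {b0} \<Longrightarrow> I q (n(b0 := y, c := z)) =
       (if blockwise_const q n \<and> sat q {b0} \<and> sat q {c} then 1 else 0)"
    if q: "q \<in> Parts k" for q c
  proof -
    have single: "(\<lambda>u. if u \<in> {v} then w else m u) = m(v := w)" for m :: "point \<Rightarrow> nat" and v w by auto
    have b: "blockwise_const q (m(v := w)) \<longleftrightarrow> blockwise_const q m \<and> sat q {v}"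
      if "v \<in> points k" "w \<notin> m ` points k" for m :: "point \<Rightarrow> nat" and v w
      using blockwise_const_fresh[OF q _ that(2), of "{v}"] that(1) unfolding single sat_def by simp
    show "I q (n(b0 := z)) = (if blockwise_const q n \<and> sat q {b0} then 1 else 0)"
      unfolding I_def b[OF b0P yz(4)] ..
    assume c: "c \<in> B - {b0}"
    then have cP: "c \<in> points k" "n c = n b0" using B_eq by auto
    have pair: "(\<lambda>u. if u \<in> {b0, c} then y else n u) = n(b0 := y, c := y)" by auto
    show "I q (n(b0 := y, c := y)) = (if blockwise_const q n \<and> sat q {b0, c} then 1 else 0)"
    proof -
      have "{b0, c} \<subseteq> points k" using cP b0P by blast
      moreover have "n u = n v" if "u \<in> {b0, c}" "v \<in> {b0, c}" for u v using that cP(2) by auto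
      ultimately have "blockwise_const q (n(b0 := y, c := y)) \<longleftrightarrow> blockwise_const q n \<and> sat q {b0, c}"
        unfolding pair[symmetric] sat_def by (intro blockwise_const_fresh[OF q _ yz(3)]) blast+
      then show ?thesis unfolding I_def by simp
    qed
    have "z \<notin> (n(b0 := y)) ` points k" using yz by auto
    from b[OF cP(1) this] b[OF b0P yz(3)]
    show "I q (n(b0 := y, c := z)) = (if blockwise_const q n \<and> sat q {b0} \<and> sat q {c} then 1 else 0)"
      unfolding I_def by simp
  qed
  have J_eq: "J q = (if blockwise_const q n then 1 - (if sat q {b0} then 1 else 0) -
     (\<Sum>c\<in>B - {b0}. (if sat q {b0, c} then 1 else 0) - (if sat q {b0} \<and> sat q {c} then 1 else 0)) else 0)"
    if q: "q \<in> Parts k" for q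
    unfolding J_def I1[OF q] using I2[OF q] I3[OF q] by (simp add: I_def)
  have J0: "J q = 0" if q: "q \<in> Parts k" and small: "\<forall>d\<in>q. card d \<le> 2" for q
  proof (cases "blockwise_const q n")
    case True
    let ?d = "block_of q b0"
    note d = block_of_in[OF q b0P]
    have others: "b0 \<notin> e" if "e \<in> q" "e \<noteq> ?d" for e using block_disjoint[OF q that(1) d(1) _ d(2)] that(2) by blast
    have dB: "?d \<subseteq> B"
      unfolding B_eq using block_subset[OF q d(1)] blockwise_constD[OF True d(1) _ d(2)] by blast
    show ?thesis
    proof (cases "?d = {b0}")
      case single: True
      then have "sat q {b0}" unfolding sat_def using others by blast
      moreover have "sat q {b0, c} \<longleftrightarrow> sat q {c}" if "c \<noteq> b0" for c
      proof -
        have "e \<subseteq> {b0, c} \<or> e \<inter> {b0, c} = {} \<longleftrightarrow> e \<subseteq> {c} \<or> e \<inter> {c} = {}" if "e \<in> q" for e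
        proof (cases "e = ?d")
          case True then show ?thesis using single \<open>c \<noteq> b0\<close> by auto
        next
          case False then show ?thesis using others[OF that False] by blast
        qed
        then show ?thesis unfolding sat_def by blast
      qed
      ultimately show ?thesis unfolding J_eq[OF q] by simp
    next
      case False
      then obtain e where e: "e \<in> ?d" "e \<noteq> b0" using d(2) by blast
      have de: "?d = {b0, e}"
      proof -
        have "{b0, e} \<subseteq> ?d" using d(2) e by blast
        moreover have "card ?d \<le> card {b0, e}" using small d(1) e(2) by (simp add: numeral_2_eq_2)
        ultimately show ?thesis using card_seteq[OF finite_block[OF q d(1)]] by blast
      qed
      have "\<not> sat q {b0}" unfolding sat_def using d(1) de e(2) by blast
      moreover have "sat q {b0, c} \<longleftrightarrow> c = e" if "c \<noteq> b0" for c
      proof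
        assume "sat q {b0, c}"
        then show "c = e" unfolding sat_def using d(1) de e(2) by blast
      next
        assume "c = e"
        then have "f \<subseteq> {b0, c} \<or> f \<inter> {b0, c} = {}" if "f \<in> q" for f
          using de block_disjoint[OF q that d(1)] by (cases "f = ?d") blast+
        then show "sat q {b0, c}" unfolding sat_def by blast
      qed
      then have "(\<Sum>c\<in>B - {b0}. if sat q {b0, c} then 1 else 0 :: complex) = (\<Sum>c\<in>B - {b0}. if c = e then 1 else 0)"
        by (intro sum.cong) auto
      then have "(\<Sum>c\<in>B - {b0}. if sat q {b0, c} then 1 else 0 :: complex) = 1"
        using finB dB e by auto
      ultimately show ?thesis unfolding J_eq[OF q] using True by simp
    qed
  qed (simp add: J_eq[OF q])
  have J1: "J p = 1"
  proof -
    have not_sat: "\<not> sat p S" if S: "finite S" "card S \<le> 2" "b0 \<in> S" for S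
    proof
      assume "sat p S"
      then have "B \<subseteq> S" unfolding sat_def using B(1) b0 S(3) by blast
      from card_mono[OF S(1) this] show False using S(2) B(2) by simp
    qed
    have "\<not> sat p {b0}" "\<not> sat p {b0, c}" for c
      by (rule not_sat; simp add: card_insert_if)+
    moreover have "blockwise_const p n"
      using refines_Ker_iff[OF step.hyps, of n] refines_refl_Parts[OF step.hyps] n(2) by simp
    ultimately show ?thesis unfolding J_eq[OF step.hyps] by simp
  qed
  have "a q * J q = 0" if q: "q \<in> Parts k" "q \<noteq> p" for q
  proof (cases "blockwise_const q n")
    case True
    then have ref: "refines (points k) q p" using refines_Ker_iff[OF q(1)] n(2) by metis
    show ?thesis
    proof (cases "\<exists>d\<in>q. card d > 2")
      case True then show ?thesis using step.IH[OF ref q(2)] by simp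
    next
      case False then show ?thesis using J0[OF q(1)] by (simp add: not_less)
    qed
  qed (simp add: J_eq[OF q(1)])
  then have "(\<Sum>q\<in>Parts k. a q * J q) = (\<Sum>q\<in>{p}. a q * J q)"
    using finite_Parts step.hyps by (intro sum.mono_neutral_right) auto
  then show ?case using zero J1 by simp
qed


section \<open>Invariant tensors of the five groups\<close>

lemma cat_group_unitary:
  assumes "g \<in> cat_group A N" shows "g \<in> unitary_group N"
proof (cases A)
  case Hyper
  then obtain \<sigma> \<epsilon> where \<sigma>: "\<sigma> permutes {1..N}" and \<epsilon>: "\<forall>b. \<epsilon> b = 1 \<or> \<epsilon> b = - 1"
    and g: "g = monomial_mat N \<sigma> \<epsilon>"
    using assms unfolding monomial_mat_def by auto
  have "cmod (\<epsilon> b) = 1" for b using \<epsilon>[rule_format, of b] by (elim disjE) simp_all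
  then show ?thesis unfolding g by (rule monomial_mat_unitary[OF \<sigma>])
next
  case AllParts
  then obtain \<sigma> where \<sigma>: "\<sigma> permutes {1..N}" and g: "g = monomial_mat N \<sigma> (\<lambda>_. 1)"
    using assms unfolding monomial_mat_def by auto
  show ?thesis unfolding g by (rule monomial_mat_unitary[OF \<sigma>]) simp
qed (use assms orthogonal_iff_real_unitary in auto)

lemma bistochastic_in_orthogonal_in_unitary:
  "cat_group BrauerS N \<subseteq> cat_group Brauer N" "cat_group Brauer N \<subseteq> cat_group Sym N"
  using orthogonal_iff_real_unitary by auto

lemma sign_matrix_orthogonal:
  assumes "\<And>b. e b = 1 \<or> e b = -1" shows "monomial_mat N id e \<in> cat_group Brauer N"
proof -
  have "monomial_mat N id e a b \<in> \<real>" for a b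
    using assms[of b] unfolding monomial_mat_def by auto
  moreover have "monomial_mat N id e \<in> unitary_group N"
    using cat_group_unitary[OF signed_permutation_matrix_in_group[OF permutes_id, of e]] assms by blast
  ultimately show ?thesis by (simp add: orthogonal_iff_real_unitary)
qed

lemma nc_pairing:
  assumes "p \<in> cat_parts Brauer k" shows "nc p = k"
proof -
  have p: "p \<in> Parts k" "\<forall>b\<in>p. card b = 2" using assms by auto
  have pt: "partition_on (points k) p" using p(1) unfolding Parts_def by simp
  have "2 * k = (\<Sum>b\<in>p. card b)"
    using product_partition[OF pt] finite_block[OF p(1)] card_points by simp
  then show ?thesis using p(2) unfolding nc_def by simp
qed

text \<open>
  The pairs are the graph of a permutation of $\{1, \dots, k\}$.
\<close>

lemma mixed_pairing_is_permutation:
  assumes p: "p \<in> Parts k" and mixed: "\<And>b. b \<in> p \<Longrightarrow> \<exists>i j. b = {Inl i, Inr j}"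
  shows "p \<in> cat_parts Sym k"
proof -
  define \<sigma> where "\<sigma> = (\<lambda>i. if i \<in> {1..k} then (THE j. {Inl i, Inr j} \<in> p) else i)"
  have \<sigma>: "{Inl i, Inr (\<sigma> i)} \<in> p" if i: "i \<in> {1..k}" for i
  proof -
    have i': "Inl i \<in> points k" using i by simp
    obtain i2 j where j: "block_of p (Inl i) = {Inl i2, Inr j}" using mixed[OF block_of_in(1)[OF p i']] by blast
    then have ij: "{Inl i, Inr j} \<in> p" using block_of_in[OF p i'] by auto
    have "j' = j" if "{Inl i, Inr j'} \<in> p" for j'
      using block_disjoint[OF p that ij, of "Inl i"] by (auto simp: doubleton_eq_iff)
    then have "(THE j. {Inl i, Inr j} \<in> p) = j" using ij by blast
    then show ?thesis using ij i unfolding \<sigma>_def by simp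
  qed
  have "\<sigma> i \<in> {1..k}" if "i \<in> {1..k}" for i
    using block_subset[OF p \<sigma>[OF that]] by simp
  moreover have "inj_on \<sigma> {1..k}"
  proof (rule inj_onI)
    fix i i' assume ii: "i \<in> {1..k}" "i' \<in> {1..k}" "\<sigma> i = \<sigma> i'"
    have "{Inl i, Inr (\<sigma> i)} = {Inl i', Inr (\<sigma> i')}"
      using block_disjoint[OF p \<sigma>[OF ii(1)] \<sigma>[OF ii(2)], of "Inr (\<sigma> i)"] ii(3) by simp
    then show "i = i'" by (auto simp: doubleton_eq_iff)
  qed
  ultimately have "bij_betw \<sigma> {1..k} {1..k}"
    by (intro bij_betw_imageI endo_inj_surj) auto
  then have perm: "\<sigma> permutes {1..k}" by (rule bij_imp_permutes) (auto simp: \<sigma>_def)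
  have "p = perm_part k \<sigma>"
  proof
    show "perm_part k \<sigma> \<subseteq> p" using \<sigma> unfolding perm_part_def by auto
    show "p \<subseteq> perm_part k \<sigma>"
    proof
      fix b assume b: "b \<in> p"
      then obtain i j where ij: "b = {Inl i, Inr j}" using mixed by blast
      have i: "i \<in> {1..k}" using block_subset[OF p b] ij by simp
      have "b = {Inl i, Inr (\<sigma> i)}" by (rule block_disjoint[OF p b \<sigma>[OF i], of "Inl i"]) (simp_all add: ij)
      then show "b \<in> perm_part k \<sigma>" using i unfolding perm_part_def by blast
    qed
  qed
  then show ?thesis using perm by auto
qed

text \<open>
  Multiply the basis vector at the value of the pair by the imaginary unit \<open>\<i>\<close>. The two points contribute
  $\mathrm{i}^2$ or $(-\mathrm{i})^2$, since they are both primed or both not primed.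
\<close>

lemma unmixed_pair_vanishes:
  assumes inv: "\<And>g. g \<in> unitary_group N \<Longrightarrow> tensor_invariant N k F g"
    and n: "n \<in> tuples N k" and b: "{u, v} \<in> Ker k n" "u \<noteq> v" "isl u \<longleftrightarrow> isl v"
  shows "F n = 0"
proof -
  have b_eq: "{u, v} = {w \<in> points k. n w = n u}"
    using block_disjoint[OF Ker_in_Parts b(1), of "{w \<in> points k. n w = n u}" u] b(1)
      block_subset[OF Ker_in_Parts b(1)] unfolding Ker_def by blast
  define e where "e = (\<lambda>x. if x = n u then \<i> else 1)"
  define f where "f = (\<lambda>w. if isl w then cnj (e (n w)) else e (n w))"
  have "monomial_mat N id e \<in> unitary_group N"
    by (rule monomial_mat_unitary[OF permutes_id]) (simp add: e_def)
  then have invg: "tensor_invariant N k F (monomial_mat N id e)" by (rule inv)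
  have "(\<lambda>u\<in>points k. id (n u)) = n" using n by (auto simp: fun_eq_iff PiE_iff extensional_def)
  then have "F n = (\<Prod>j=1..k. e (n (Inr j)) * cnj (e (n (Inl j)))) * F n"
    using tensor_invariant_monomial[OF invg permutes_id n] by simp
  also have "(\<Prod>j=1..k. e (n (Inr j)) * cnj (e (n (Inl j)))) = (\<Prod>w\<in>points k. f w)"
    unfolding prod_points[symmetric] f_def by simp
  also have "\<dots> = (\<Prod>w\<in>{u, v}. f w)"
    unfolding b_eq using finite_points[of k] by (intro prod.mono_neutral_right) (auto simp: f_def e_def)
  also have "\<dots> = f u * f v" using b(2) by simp
  also have "n v = n u" using b_eq by blast
  then have "f u * f v = - 1" using b(3) unfolding f_def e_def by auto
  finally show ?thesis by simp
qed

lemma cat_parts_subset: "cat_parts A k \<subseteq> Parts k"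
  by (cases A) (auto simp: perm_part_in_Parts)

text \<open>
  The first fundamental theorem of invariant theory for the five groups, in the stable range. For the
  unitary group, the coefficients off the pairings vanish because it contains the orthogonal group;
  pairings all have \<open>k\<close> blocks, so none is strictly finer than another, and the coefficient of a pairing is a
  value of \<open>F\<close>.
\<close>

theorem invariant_tensor_expansion:
  assumes N: "2 * k \<le> N" and inv: "\<And>g. g \<in> cat_group A N \<Longrightarrow> tensor_invariant N k F g"
  obtains a where "partition_expansion N k F a" "\<And>p. p \<in> Parts k \<Longrightarrow> p \<notin> cat_parts A k \<Longrightarrow> a p = 0"
proof -
  obtain a where a: "partition_expansion N k F a"
    using partition_expansion_exists[OF N inv[OF permutation_matrix_in_group]] by blast
  have small: "card b \<le> 2"
    if "A = BrauerS \<or> A = Brauer \<or> A = Sym" "a p \<noteq> 0" "p \<in> Parts k" "b \<in> p" for p b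
  proof -
    have "cat_group BrauerS N \<subseteq> cat_group A N"
      using that(1) bistochastic_in_orthogonal_in_unitary[of N] by blast
    then have "tensor_invariant N k F g" if "g \<in> cat_group BrauerS N" for g using inv that by blast
    from bistochastic_coefficients[OF N a this that(3)] show ?thesis using that by (meson not_le)
  qed
  have even: "even (card b)"
    if "A = Hyper \<or> A = Brauer \<or> A = Sym" "a p \<noteq> 0" "p \<in> Parts k" "b \<in> p" for p b
  proof -
    have "monomial_mat N id e \<in> cat_group A N" if "\<And>b. e b = 1 \<or> e b = -1" for e
    proof -
      have "monomial_mat N id e \<in> cat_group Hyper N"
        by (rule signed_permutation_matrix_in_group[OF permutes_id]) (rule that)
      moreover have "monomial_mat N id e \<in> cat_group Brauer N"
        by (rule sign_matrix_orthogonal) (rule that)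
      ultimately show ?thesis
        using \<open>A = Hyper \<or> A = Brauer \<or> A = Sym\<close> bistochastic_in_orthogonal_in_unitary(2)[of N] by blast
    qed
    from hyperoctahedral_coefficients[OF N a inv[OF this] that(3)] show ?thesis using that by blast
  qed
  have pairing: "p \<in> cat_parts Brauer k" if A: "A = Brauer \<or> A = Sym" and p: "a p \<noteq> 0" "p \<in> Parts k" for p
  proof -
    have "card b = 2" if b: "b \<in> p" for b
    proof -
      have "card b \<le> 2" "even (card b)" "card b > 0"
        using small[of p b] even[of p b] A p b finite_block[OF p(2) b] block_nonempty[OF p(2) b]
        by (auto simp: card_gt_0_iff)
      then show ?thesis by (cases "card b = 1") auto
    qed
    then show ?thesis using p by simp
  qed
  have "a p = 0" if p: "p \<in> Parts k" "p \<notin> cat_parts A k" for p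
  proof (rule ccontr)
    assume ap: "a p \<noteq> 0"
    have A: "A = Sym"
      using p small[OF _ ap p(1)] even[OF _ ap p(1)] pairing[OF _ ap p(1)] by (cases A) auto
    have pB: "p \<in> cat_parts Brauer k" by (rule pairing[OF _ ap p(1)]) (simp add: A)
    obtain n where n: "n \<in> tuples N k" "Ker k n = p" by (rule exists_tuple_of_kernel[OF N p(1)])
    have "a q = 0" if q: "refines (points k) q p" "q \<noteq> p" for q
    proof (rule ccontr)
      assume "a q \<noteq> 0"
      moreover have "q \<in> Parts k" using q(1) unfolding refines_def Parts_def by blast
      ultimately have "q \<in> cat_parts Brauer k" using pairing A by blast
      then show False using nc_refines(2)[OF q(1)] nc_pairing pB q(2) by metis
    qed
    from partition_expansion_leading_term[OF N a p(1) n this] have Fn: "F n \<noteq> 0" using ap by simp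
    obtain b where b: "b \<in> p" "\<nexists>i j. b = {Inl i, Inr j}"
      using mixed_pairing_is_permutation[OF p(1)] p(2) A by blast
    then obtain u v where uv: "b = {u, v}" "u \<noteq> v" using pB by (auto simp: card_2_iff)
    have "isl u \<longleftrightarrow> isl v" using b(2) unfolding uv(1) by (cases u; cases v) (auto simp: insert_commute)
    then have "F n = 0"
      using unmixed_pair_vanishes[of N k F n u v] inv n b(1) uv A by simp
    with Fn show False by simp
  qed
  with a show ?thesis by (rule that)
qed


section \<open>Finite-dimensional cumulants\<close>

text \<open>
  $d(\mathrm{id}_k, q) + d(q, p) - d(\mathrm{id}_k, p)$, which is a natural number.
\<close>

definition excess :: "nat \<Rightarrow> part \<Rightarrow> part \<Rightarrow> nat" where
  "excess k q p = nc q + nc (join k p (id_part k)) - (nc (join k q (id_part k)) + nc (join k q p))"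

lemma excess_zero_iff:
  assumes "p \<in> Parts k" "q \<in> Parts k" shows "excess k q p = 0 \<longleftrightarrow> geo_le k q p"
  using geodesic_excess[OF assms] unfolding excess_def by auto

text \<open>
  The scalar product of \<open>rho N k q\<close> and \<open>rho N k p\<close> counts the tuples that are constant on the blocks of $q \vee p$.
\<close>

lemma partition_expansion_sum:
  assumes exp: "partition_expansion N k F a" and p: "p \<in> Parts k"
  shows "(\<Sum>n | n \<in> tuples N k \<and> blockwise_const p n. F n) = (\<Sum>q\<in>Parts k. a q * of_nat N ^ nc (join k q p))"
proof -
  have "(\<Sum>n | n \<in> tuples N k \<and> blockwise_const p n. F n) =
    (\<Sum>n | n \<in> tuples N k \<and> blockwise_const p n. \<Sum>q\<in>Parts k. if blockwise_const q n then a q else 0)"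
    using exp finite_Parts[of k] unfolding partition_expansion_def
    by (intro sum.cong refl) (simp add: sum.inter_filter[symmetric] Collect_conj_eq)
  also have "\<dots> = (\<Sum>q\<in>Parts k. \<Sum>n | n \<in> tuples N k \<and> blockwise_const p n. if blockwise_const q n then a q else 0)"
    by (rule sum.swap)
  also have "\<dots> = (\<Sum>q\<in>Parts k. a q * of_nat N ^ nc (join k q p))"
  proof (intro sum.cong refl)
    fix q assume q: "q \<in> Parts k"
    have fin: "finite {n. n \<in> tuples N k \<and> blockwise_const p n}" using finite_tuples[of k N] by simp
    have "(\<Sum>n | n \<in> tuples N k \<and> blockwise_const p n. if blockwise_const q n then a q else 0) =
      (\<Sum>n | n \<in> tuples N k \<and> blockwise_const (join k q p) n. a q)"
      using fin by (intro sum.mono_neutral_cong_right) (auto simp: blockwise_const_join[OF q p])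
    also have "\<dots> = a q * of_nat N ^ nc (join k q p)"
      using card_blockwise_const[OF join_in_Parts[OF q p], of "{1..N}"] by simp
    finally show "(\<Sum>n | n \<in> tuples N k \<and> blockwise_const p n. if blockwise_const q n then a q else 0) =
      a q * of_nat N ^ nc (join k q p)" .
  qed
  finally show ?thesis .
qed

lemma entry_moment_restrict: "entry_moment P k X (restrict n (points k)) = entry_moment P k X n"
  unfolding entry_moment_def by simp

context
  fixes A :: category and P :: "'w measure" and M :: "'i \<Rightarrow> 'w \<Rightarrow> cmat" and \<mu> :: "cmat measure" and N :: nat
  assumes N: "N \<ge> 1"
    and prob: "prob_space P" and rm: "\<And>i. random_matrix P N (M i)"
    and inv: "invariant_family A P N M" and haar: "haar_measure N (cat_group A N) \<mu>"
begin

text \<open>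
  The equation that defines the finite-dimensional cumulants says that, up to the normalising powers of \<open>N\<close>, they are
  the coefficients of a partition expansion of the entry moments.
\<close>

lemma fin_cumulant_equation_iff:
  assumes zero: "\<forall>p. p \<notin> cat_parts A k \<longrightarrow> \<kappa> p = 0"
  shows "(\<forall>r\<in>multi N k. \<forall>c\<in>multi N k. haar_average \<mu> N k (mean_tensor P k (\<lambda>j. M (i j))) r c =
        (\<Sum>p\<in>cat_parts A k. \<kappa> p * of_nat N powi (- defect k p) * rho N k p r c)) \<longleftrightarrow>
     partition_expansion N k (entry_moment P k (\<lambda>j. M (i j))) (\<lambda>p. \<kappa> p * of_nat N powi (- defect k p))"
    (is "(\<forall>r\<in>_. \<forall>c\<in>_. ?H r c = ?S r c) \<longleftrightarrow> _")
proof -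
  have H: "?H r c = entry_moment P k (\<lambda>j. M (i j)) (case_sum c r)"
    if "r \<in> multi N k" "c \<in> multi N k" for r c
    using haar_average_eq_mean[OF prob rm inv haar that, of i] by (simp add: mean_tensor_eq_entry_moment)
  have S: "?S r c = (\<Sum>q | q \<in> Parts k \<and> blockwise_const q (case_sum c r). \<kappa> q * of_nat N powi (- defect k q))"
    if "r \<in> multi N k" "c \<in> multi N k" for r c
  proof -
    have "?S r c = (\<Sum>q\<in>Parts k. \<kappa> q * of_nat N powi (- defect k q) * rho N k q r c)"
      using zero cat_parts_subset[of A k] finite_Parts[of k] by (intro sum.mono_neutral_left) auto
    also have "\<dots> = (\<Sum>q | q \<in> Parts k \<and> blockwise_const q (case_sum c r). \<kappa> q * of_nat N powi (- defect k q))"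
      using finite_Parts[of k] by (intro sum.mono_neutral_cong_right) (auto simp: rho_eq that)
    finally show ?thesis .
  qed
  have bc: "{q. q \<in> Parts k \<and> blockwise_const q (case_sum (col k n) (row k n))} =
    {q. q \<in> Parts k \<and> blockwise_const q n}" for n :: "point \<Rightarrow> nat"
  proof -
    have glue: "case_sum (col k n) (row k n) u = n u" if "u \<in> points k" for u
      using that by (auto elim: points_cases)
    have "blockwise_const q (case_sum (col k n) (row k n)) = blockwise_const q n" if "q \<in> Parts k" for q
      by (rule blockwise_const_cong[OF that glue])
    then show ?thesis by blast
  qed
  have F: "entry_moment P k (\<lambda>j. M (i j)) (case_sum (col k n) (row k n)) = entry_moment P k (\<lambda>j. M (i j)) n" for n
    unfolding entry_moment_def by simp
  show ?thesis
  proof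
    assume *: "\<forall>r\<in>multi N k. \<forall>c\<in>multi N k. ?H r c = ?S r c"
    show "partition_expansion N k (entry_moment P k (\<lambda>j. M (i j))) (\<lambda>p. \<kappa> p * of_nat N powi (- defect k p))"
      unfolding partition_expansion_def
    proof
      fix n assume "n \<in> tuples N k"
      then have rc: "row k n \<in> multi N k" "col k n \<in> multi N k"
        by (intro row_col_in_multi; auto simp: PiE_iff)+
      show "entry_moment P k (\<lambda>j. M (i j)) n =
        (\<Sum>q | q \<in> Parts k \<and> blockwise_const q n. \<kappa> q * of_nat N powi (- defect k q))"
        using *[rule_format, OF rc] H[OF rc] S[OF rc] unfolding bc F by simp
    qed
  next
    assume *: "partition_expansion N k (entry_moment P k (\<lambda>j. M (i j))) (\<lambda>p. \<kappa> p * of_nat N powi (- defect k p))"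
    show "\<forall>r\<in>multi N k. \<forall>c\<in>multi N k. ?H r c = ?S r c"
    proof (intro ballI)
      fix r c assume rc: "r \<in> multi N k" "c \<in> multi N k"
      let ?n = "restrict (case_sum c r) (points k)"
      have "?n \<in> tuples N k" using rc unfolding multi_def by (auto elim!: points_cases)
      then have "entry_moment P k (\<lambda>j. M (i j)) ?n =
          (\<Sum>q | q \<in> Parts k \<and> blockwise_const q ?n. \<kappa> q * of_nat N powi (- defect k q))"
        using * unfolding partition_expansion_def by blast
      moreover have "{q. q \<in> Parts k \<and> blockwise_const q ?n} = {q. q \<in> Parts k \<and> blockwise_const q (case_sum c r)}"
      proof -
        have "blockwise_const q ?n = blockwise_const q (case_sum c r)" if "q \<in> Parts k" for q
          by (rule blockwise_const_cong[OF that]) simp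
        then show ?thesis by blast
      qed
      ultimately show "?H r c = ?S r c" unfolding H[OF rc] S[OF rc] by (simp add: entry_moment_restrict)
    qed
  qed
qed

text \<open>
  The expansion exists with support in \<^term>\<open>cat_parts A k\<close> by invariance and is unique, so the description of
  the cumulants defines them.
\<close>

lemma fin_cumulant_expansion:
  fixes i :: "nat \<Rightarrow> 'i"
  assumes k: "2 * k \<le> N"
  defines "\<kappa> \<equiv> fin_cumulant A \<mu> P N k (\<lambda>j. M (i j))"
  shows "p \<notin> cat_parts A k \<Longrightarrow> \<kappa> p = 0"
    and "partition_expansion N k (entry_moment P k (\<lambda>j. M (i j))) (\<lambda>p. \<kappa> p * of_nat N powi (- defect k p))"
proof -
  let ?F = "entry_moment P k (\<lambda>j. M (i j))"
  define Q where "Q = (\<lambda>\<kappa>. (\<forall>p. p \<notin> cat_parts A k \<longrightarrow> \<kappa> p = 0) \<and>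
     partition_expansion N k ?F (\<lambda>p. \<kappa> p * of_nat N powi (- defect k p)))"
  have "tensor_invariant N k ?F g" if "g \<in> cat_group A N" for g
    by (rule entry_moment_invariant[OF prob rm inv that cat_group_unitary[OF that]])
  then obtain a where a: "partition_expansion N k ?F a" "\<And>p. p \<in> Parts k \<Longrightarrow> p \<notin> cat_parts A k \<Longrightarrow> a p = 0"
    using invariant_tensor_expansion[OF k, of A ?F] by blast
  define \<kappa>0 where "\<kappa>0 = (\<lambda>p. if p \<in> cat_parts A k then a p * of_nat N powi defect k p else 0)"
  have "\<kappa>0 p * of_nat N powi (- defect k p) = a p" if "p \<in> Parts k" for p
    using N a(2)[OF that] by (simp add: \<kappa>0_def power_int_minus)
  then have "partition_expansion N k ?F (\<lambda>p. \<kappa>0 p * of_nat N powi (- defect k p))"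
    using a(1) unfolding partition_expansion_def by simp
  then have Q0: "Q \<kappa>0" by (simp add: Q_def \<kappa>0_def)
  have "\<kappa>' = \<kappa>0" if Q: "Q \<kappa>'" for \<kappa>'
  proof
    fix p
    show "\<kappa>' p = \<kappa>0 p"
    proof (cases "p \<in> cat_parts A k")
      case True
      then have "\<kappa>' p * of_nat N powi (- defect k p) = \<kappa>0 p * of_nat N powi (- defect k p)"
        using partition_expansion_unique[OF k conjunct2[OF Q[unfolded Q_def]] conjunct2[OF Q0[unfolded Q_def]]] cat_parts_subset by blast
      then show ?thesis using N by simp
    next
      case False then show ?thesis using Q Q0 unfolding Q_def by simp
    qed
  qed
  with Q0 have "Q (THE \<kappa>. Q \<kappa>)" by (rule theI)
  moreover have "\<kappa> = (THE \<kappa>. Q \<kappa>)"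
    unfolding \<kappa>_def fin_cumulant_def Q_def
    by (rule arg_cong[where f = The], rule ext, rule conj_cong[OF refl], rule fin_cumulant_equation_iff)
  ultimately have "Q \<kappa>" by simp
  then show "p \<notin> cat_parts A k \<Longrightarrow> \<kappa> p = 0"
    and "partition_expansion N k ?F (\<lambda>p. \<kappa> p * of_nat N powi (- defect k p))" unfolding Q_def by blast+
qed

lemma entry_moment_eq_fin_cumulants:
  assumes k: "2 * k \<le> N" and n: "n \<in> points k \<rightarrow> {1..N}"
  shows "entry_moment P k (\<lambda>j. M (i j)) n =
    (\<Sum>p | p \<in> cat_parts A k \<and> refines (points k) p (Ker k n).
       1 / of_nat N powi defect k p * fin_cumulant A \<mu> P N k (\<lambda>j. M (i j)) p)"
proof -
  let ?n = "restrict n (points k)" and ?\<kappa> = "fin_cumulant A \<mu> P N k (\<lambda>j. M (i j))"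
  note fc = fin_cumulant_expansion[where i = i, OF k]
  have bc: "blockwise_const q ?n \<longleftrightarrow> refines (points k) q (Ker k n)" if "q \<in> Parts k" for q
    using blockwise_const_cong[OF that, of ?n n] refines_Ker_iff[OF that, of n] by simp
  have "?n \<in> tuples N k" using n by auto
  from bspec[OF fc(2)[unfolded partition_expansion_def] this]
  have "entry_moment P k (\<lambda>j. M (i j)) n =
     (\<Sum>q | q \<in> Parts k \<and> blockwise_const q ?n. ?\<kappa> q * of_nat N powi (- defect k q))"
    unfolding entry_moment_restrict .
  also have "\<dots> = (\<Sum>p | p \<in> cat_parts A k \<and> refines (points k) p (Ker k n).
       1 / of_nat N powi defect k p * ?\<kappa> p)"
    using finite_Parts[of k] cat_parts_subset[of A k] fc(1) bc
    by (intro sum.mono_neutral_cong_right) (auto simp: power_int_minus field_simps)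
  finally show ?thesis .
qed

text \<open>
  Besides the scalar product $N^{\mathrm{nc}(q \vee p)}$ of the two tensors, the exponent collects the normalisations of
  the moment and of the cumulant.
\<close>

lemma moment_eq_fin_cumulants:
  assumes k: "2 * k \<le> N" and p: "p \<in> Parts k"
  shows "moment P N k (\<lambda>j. M (i j)) p =
    (\<Sum>q\<in>cat_parts A k. inverse (of_nat N) ^ excess k q p * fin_cumulant A \<mu> P N k (\<lambda>j. M (i j)) q)"
proof -
  let ?\<kappa> = "fin_cumulant A \<mu> P N k (\<lambda>j. M (i j))" and ?J = "nc (join k p (id_part k))"
  note fc = fin_cumulant_expansion[where i = i, OF k]
  have N0: "of_nat N \<noteq> (0 :: complex)" using N by simp
  have coeff: "inverse (of_nat N ^ ?J) * (of_nat N powi (- defect k q) * of_nat N ^ nc (join k q p)) =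
     inverse (of_nat N :: complex) ^ excess k q p" if q: "q \<in> Parts k" for q
  proof -
    have "int (excess k q p) = int ?J + defect k q - int (nc (join k q p))"
      using geodesic_excess(1)[OF p q] unfolding excess_def defect_def by simp
    then have "- int (excess k q p) = - int ?J + (- defect k q + int (nc (join k q p)))" by simp
    then have "of_nat N powi (- int (excess k q p)) =
       of_nat N powi (- int ?J) * (of_nat N powi (- defect k q) * (of_nat N :: complex) powi int (nc (join k q p)))"
      using N0 by (simp only: power_int_add simp_thms)
    then show ?thesis by (simp add: power_int_minus power_inverse)
  qed
  have "moment P N k (\<lambda>j. M (i j)) p = inverse (of_nat N ^ ?J) *
     (\<Sum>q\<in>Parts k. ?\<kappa> q * of_nat N powi (- defect k q) * of_nat N ^ nc (join k q p))"
    unfolding moment_eq[OF prob rm p] partition_expansion_sum[OF fc(2) p] ..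
  also have "\<dots> = (\<Sum>q\<in>Parts k. inverse (of_nat N) ^ excess k q p * ?\<kappa> q)"
    unfolding sum_distrib_left by (intro sum.cong refl) (simp add: coeff[symmetric] mult_ac)
  also have "\<dots> = (\<Sum>q\<in>cat_parts A k. inverse (of_nat N) ^ excess k q p * ?\<kappa> q)"
    using finite_Parts[of k] cat_parts_subset[of A k] fc(1) by (intro sum.mono_neutral_right) auto
  finally show ?thesis .
qed

end


section \<open>Convergence of the cumulants\<close>

lemma asym_cumulant_equation:
  assumes p: "p \<in> cat_parts A k"
  shows "limit_moment P M k i p = (\<Sum>q | q \<in> cat_parts A k \<and> geo_le k q p. asym_cumulant A P M k i q)"
proof -
  let ?C = "cat_parts A k"
  define Q where "Q = (\<lambda>\<kappa>. (\<forall>p. p \<notin> ?C \<longrightarrow> \<kappa> p = 0) \<and>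
     (\<forall>p\<in>?C. limit_moment P M k i p = (\<Sum>p' | p' \<in> ?C \<and> geo_le k p' p. \<kappa> p')))"
  have fin: "finite ?C" using finite_subset[OF cat_parts_subset finite_Parts] .
  have refl: "geo_le k p p" if "p \<in> ?C" for p using that cat_parts_subset geo_le_refl by blast
  have rank: "pdist k (id_part k) q < pdist k (id_part k) p"
    if "p \<in> ?C" "q \<in> ?C" "geo_le k q p" "q \<noteq> p" for p q
    using geo_le_rank that cat_parts_subset by blast
  obtain a where a: "\<forall>p\<in>?C. limit_moment P M k i p = (\<Sum>q | q \<in> ?C \<and> geo_le k q p. a q)"
    using triangular_solution_exists[where le = "geo_le k" and rank = "pdist k (id_part k)"
        and f = "limit_moment P M k i", OF fin refl rank] by blast
  define \<kappa>0 where "\<kappa>0 = (\<lambda>p. if p \<in> ?C then a p else 0)"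
  have "(\<Sum>q | q \<in> ?C \<and> geo_le k q p. \<kappa>0 q) = (\<Sum>q | q \<in> ?C \<and> geo_le k q p. a q)" for p
    by (intro sum.cong) (auto simp: \<kappa>0_def)
  then have Q0: "Q \<kappa>0" using a by (simp add: Q_def \<kappa>0_def)
  have "\<kappa> = \<kappa>0" if Q: "Q \<kappa>" for \<kappa>
  proof
    fix p
    show "\<kappa> p = \<kappa>0 p"
    proof (cases "p \<in> ?C")
      case True
      show ?thesis
      proof (rule triangular_solution_unique[where le = "geo_le k" and rank = "pdist k (id_part k)",
            OF fin refl rank _ True])
        fix p assume "p \<in> ?C"
        then show "(\<Sum>q | q \<in> ?C \<and> geo_le k q p. \<kappa> q) = (\<Sum>q | q \<in> ?C \<and> geo_le k q p. \<kappa>0 q)"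
          using conjunct2[OF Q[unfolded Q_def]] conjunct2[OF Q0[unfolded Q_def]] by simp
      qed
    qed (use Q Q0 in \<open>simp add: Q_def\<close>)
  qed
  with Q0 have "Q (THE \<kappa>. Q \<kappa>)" by (rule theI)
  then show ?thesis using p unfolding asym_cumulant_def Q_def by blast
qed

text \<open>
  The matrix $N^{-\mathrm{excess}(q, p)}$ that maps cumulants to moments converges to the zeta matrix of the geodesic
  order, because the excess is zero exactly when \<open>q\<close> is below \<open>p\<close>.
\<close>

lemma fin_cumulant_tendsto:
  fixes P :: "nat \<Rightarrow> 'w measure" and M :: "nat \<Rightarrow> 'i \<Rightarrow> 'w \<Rightarrow> cmat"
  assumes prob: "\<And>N. N \<ge> 1 \<Longrightarrow> prob_space (P N)"
    and rm: "\<And>N i. N \<ge> 1 \<Longrightarrow> random_matrix (P N) N (M N i)"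
    and inv: "\<And>N. N \<ge> 1 \<Longrightarrow> invariant_family A (P N) N (M N)"
    and haar: "\<And>N. N \<ge> 1 \<Longrightarrow> haar_measure N (cat_group A N) (\<mu> N)"
    and conv: "converges_in_distribution A P M" and p: "p \<in> cat_parts A k"
  shows "(\<lambda>N. fin_cumulant A (\<mu> N) (P N) N k (\<lambda>j. M N (i j)) p) \<longlonglongrightarrow> asym_cumulant A P M k i p"
proof -
  let ?C = "cat_parts A k"
  have CP: "q \<in> Parts k" if "q \<in> ?C" for q using that cat_parts_subset by blast
  show ?thesis
  proof (rule perturbed_triangular_systems_converge
      [where S = ?C and le = "geo_le k" and rank = "pdist k (id_part k)"
        and m = "\<lambda>N. moment (P N) N k (\<lambda>j. M N (i j))"
        and g = "\<lambda>N p q. inverse (of_nat N) ^ excess k q p" and x = "\<lambda>N. fin_cumulant A (\<mu> N) (P N) N k (\<lambda>j. M N (i j))"])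
    show "finite ?C" using finite_subset[OF cat_parts_subset finite_Parts] .
    show "geo_le k q q" if "q \<in> ?C" for q using geo_le_refl CP that by blast
    show "pdist k (id_part k) q < pdist k (id_part k) p"
      if "p \<in> ?C" "q \<in> ?C" "geo_le k q p" "q \<noteq> p" for p q using geo_le_rank CP that by blast
    show "(\<lambda>N. inverse (of_nat N :: complex) ^ excess k q p) \<longlonglongrightarrow> (if geo_le k q p then 1 else 0)"
      if "p \<in> ?C" "q \<in> ?C" for p q
    proof (cases "excess k q p = 0")
      case True
      then show ?thesis using excess_zero_iff[OF CP CP, OF that] by simp
    next
      case False
      have "(\<lambda>N. inverse (of_nat N :: complex) ^ excess k q p) \<longlonglongrightarrow> 0 ^ excess k q p"
        by (intro tendsto_power lim_inverse_n)
      then show ?thesis using False excess_zero_iff[OF CP CP, OF that] by (simp add: power_0_left)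
    qed
    show "(\<lambda>N. moment (P N) N k (\<lambda>j. M N (i j)) p) \<longlonglongrightarrow>
       (\<Sum>q | q \<in> ?C \<and> geo_le k q p. asym_cumulant A P M k i q)" if "p \<in> ?C" for p
    proof -
      have "convergent (\<lambda>N. moment (P N) N k (\<lambda>j. M N (i j)) p)"
        using conv that unfolding converges_in_distribution_def by blast
      then show ?thesis
        unfolding asym_cumulant_equation[OF that, symmetric] limit_moment_def by (simp add: convergent_LIMSEQ_iff)
    qed
    show "\<forall>\<^sub>F N in sequentially. \<forall>p\<in>?C. moment (P N) N k (\<lambda>j. M N (i j)) p =
       (\<Sum>q\<in>?C. inverse (of_nat N) ^ excess k q p * fin_cumulant A (\<mu> N) (P N) N k (\<lambda>j. M N (i j)) q)"
      using eventually_ge_at_top[of 1] eventually_ge_at_top[of "2 * k"]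
    proof eventually_elim
      case (elim N)
      show ?case
        using moment_eq_fin_cumulants[OF elim(1) prob[OF elim(1)] rm[OF elim(1)] inv[OF elim(1)] haar[OF elim(1)] elim(2)] CP
        by blast
    qed
  qed (fact p)
qed

theorem theorem4p5:
  fixes A :: category
    and P :: "nat \<Rightarrow> 'w measure"
    and M :: "nat \<Rightarrow> 'i \<Rightarrow> 'w \<Rightarrow> cmat"
    and \<mu> :: "nat \<Rightarrow> cmat measure"
  assumes prob: "\<And>N. N \<ge> 1 \<Longrightarrow> prob_space (P N)"
    and rm: "\<And>N i. N \<ge> 1 \<Longrightarrow> random_matrix (P N) N (M N i)"
    and inv: "\<And>N. N \<ge> 1 \<Longrightarrow> invariant_family A (P N) N (M N)"
    and haar: "\<And>N. N \<ge> 1 \<Longrightarrow> haar_measure N (cat_group A N) (\<mu> N)"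
  shows
    "(\<forall>k N (i :: nat \<Rightarrow> 'i) n. N \<ge> 1 \<and> N \<ge> 2 * k \<and> n \<in> points k \<rightarrow> {1..N} \<longrightarrow>
        entry_moment (P N) k (\<lambda>j. M N (i j)) n =
        (\<Sum>p | p \<in> cat_parts A k \<and> refines (points k) p (Ker k n).
           1 / of_nat N powi defect k p * fin_cumulant A (\<mu> N) (P N) N k (\<lambda>j. M N (i j)) p)) \<and>
     (converges_in_distribution A P M \<longrightarrow>
      (\<forall>k (i :: nat \<Rightarrow> 'i) (n :: nat \<Rightarrow> point \<Rightarrow> nat).
        (\<forall>\<^sub>F N in sequentially. n N \<in> points k \<rightarrow> {1..N}) \<longrightarrow>
        (\<exists>\<epsilon> :: nat \<Rightarrow> complex. \<epsilon> \<longlonglongrightarrow> 0 \<and>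
          (\<forall>\<^sub>F N in sequentially.
             entry_moment (P N) k (\<lambda>j. M N (i j)) (n N) =
             of_nat N powi (- defect k (Ker k (n N))) *
             ((\<Sum>p | p \<in> cat_parts A k \<and> finer_compatible k p (Ker k (n N)).
                 asym_cumulant A P M k i p) + \<epsilon> N)))))"
proof -
  have exact: "entry_moment (P N) k (\<lambda>j. M N (i j)) n =
        (\<Sum>p | p \<in> cat_parts A k \<and> refines (points k) p (Ker k n).
           1 / of_nat N powi defect k p * fin_cumulant A (\<mu> N) (P N) N k (\<lambda>j. M N (i j)) p)"
    if "N \<ge> 1" "N \<ge> 2 * k" "n \<in> points k \<rightarrow> {1..N}" for k N and i :: "nat \<Rightarrow> 'i" and n
    by (rule entry_moment_eq_fin_cumulants[OF that(1) prob rm inv haar that(2,3)]) (rule that(1))+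
  have asym: "\<exists>\<epsilon> :: nat \<Rightarrow> complex. \<epsilon> \<longlonglongrightarrow> 0 \<and>
          (\<forall>\<^sub>F N in sequentially.
             entry_moment (P N) k (\<lambda>j. M N (i j)) (n N) =
             of_nat N powi (- defect k (Ker k (n N))) *
             ((\<Sum>p | p \<in> cat_parts A k \<and> finer_compatible k p (Ker k (n N)).
                 asym_cumulant A P M k i p) + \<epsilon> N))"
    if conv: "converges_in_distribution A P M"
      and n: "\<forall>\<^sub>F N in sequentially. n N \<in> points k \<rightarrow> {1..N}"
    for k and i :: "nat \<Rightarrow> 'i" and n :: "nat \<Rightarrow> point \<Rightarrow> nat"
  proof -
    let ?C = "cat_parts A k" and ?K = "\<lambda>N. Ker k (n N)"
    let ?\<kappa> = "\<lambda>N. fin_cumulant A (\<mu> N) (P N) N k (\<lambda>j. M N (i j))" and ?a = "asym_cumulant A P M k i"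
    have finC: "finite ?C" using finite_subset[OF cat_parts_subset finite_Parts] .
    have lim: "(\<lambda>N. ?\<kappa> N p) \<longlonglongrightarrow> ?a p" if "p \<in> ?C" for p
      using fin_cumulant_tendsto[OF prob rm inv haar conv that] by blast
    \<comment> \<open>The contribution of \<open>p\<close> to the error: if the defects agree, it tends to 0 as the
      cumulants converge, and otherwise it carries a factor of order $1/N$.\<close>
    define w where "w = (\<lambda>N p. of_nat N powi (defect k (?K N) - defect k p) * ?\<kappa> N p -
       (if defect k p = defect k (?K N) then ?a p else 0))"
    define \<epsilon> where "\<epsilon> = (\<lambda>N. \<Sum>p | p \<in> ?C \<and> refines (points k) p (?K N). w N p)"
    define B where "B = (\<lambda>N. \<Sum>p\<in>?C. norm (?\<kappa> N p - ?a p) + norm (inverse (of_nat N) * ?\<kappa> N p))"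
    have "B \<longlonglongrightarrow> 0"
      unfolding B_def
    proof (rule tendsto_null_sum)
      fix p assume p: "p \<in> ?C"
      have "(\<lambda>N. ?\<kappa> N p - ?a p) \<longlonglongrightarrow> 0" using lim[OF p] by (simp add: LIM_zero_iff)
      moreover have "(\<lambda>N. inverse (of_nat N) * ?\<kappa> N p) \<longlonglongrightarrow> 0 * ?a p"
        by (intro tendsto_mult lim_inverse_n lim[OF p])
      ultimately show "(\<lambda>N. norm (?\<kappa> N p - ?a p) + norm (inverse (of_nat N) * ?\<kappa> N p)) \<longlonglongrightarrow> 0"
        by (intro tendsto_add_zero tendsto_norm_zero) simp_all
    qed
    moreover have "norm (\<epsilon> N) \<le> B N" if N: "N \<ge> 1" for N
    proof -
      have "norm (w N p) \<le> norm (?\<kappa> N p - ?a p) + norm (inverse (of_nat N) * ?\<kappa> N p)"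
        if p: "refines (points k) p (?K N)" for p
      proof (cases "defect k p = defect k (?K N)")
        case True
        then show ?thesis by (simp add: w_def)
      next
        case False
        then have "defect k (?K N) - defect k p \<le> - 1" using defect_antimono[OF p] by simp
        then have "real N powi (defect k (?K N) - defect k p) \<le> real N powi (- 1)"
          using N by (intro power_int_increasing) simp_all
        then have "norm ((of_nat N :: complex) powi (defect k (?K N) - defect k p)) \<le> norm (inverse (of_nat N) :: complex)"
          by (simp add: norm_power_int norm_inverse power_int_minus)
        then have "norm (of_nat N powi (defect k (?K N) - defect k p) * ?\<kappa> N p) \<le> norm (inverse (of_nat N) * ?\<kappa> N p)"
          unfolding norm_mult by (intro mult_right_mono) simp_all
        then show ?thesis using False by (simp add: w_def add_increasing)
      qed
      then have "norm (\<epsilon> N) \<le> (\<Sum>p | p \<in> ?C \<and> refines (points k) p (?K N).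
          norm (?\<kappa> N p - ?a p) + norm (inverse (of_nat N) * ?\<kappa> N p))"
        unfolding \<epsilon>_def by (intro sum_norm_le) simp
      also have "\<dots> \<le> B N"
        unfolding B_def using finC by (intro sum_mono2) auto
      finally show ?thesis .
    qed
    then have "\<forall>\<^sub>F N in sequentially. norm (\<epsilon> N) \<le> B N"
      using eventually_ge_at_top[of "1::nat"] by (rule eventually_mono[rotated])
    ultimately have "\<epsilon> \<longlonglongrightarrow> 0" by (rule Lim_null_comparison[rotated])
    moreover have "\<forall>\<^sub>F N in sequentially.
             entry_moment (P N) k (\<lambda>j. M N (i j)) (n N) =
             of_nat N powi (- defect k (?K N)) *
             ((\<Sum>p | p \<in> ?C \<and> finer_compatible k p (?K N). ?a p) + \<epsilon> N)"
      using n eventually_ge_at_top[of 1] eventually_ge_at_top[of "2 * k"]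
    proof eventually_elim
      case (elim N)
      have N0: "of_nat N \<noteq> (0 :: complex)" using elim(2) by simp
      have "(\<Sum>p | p \<in> ?C \<and> finer_compatible k p (?K N). ?a p) =
        (\<Sum>p | p \<in> ?C \<and> refines (points k) p (?K N). if defect k p = defect k (?K N) then ?a p else 0)"
        using finC by (intro sum.mono_neutral_cong_left) (auto simp: finer_compatible_def)
      then have "(\<Sum>p | p \<in> ?C \<and> finer_compatible k p (?K N). ?a p) + \<epsilon> N =
        (\<Sum>p | p \<in> ?C \<and> refines (points k) p (?K N). of_nat N powi (defect k (?K N) - defect k p) * ?\<kappa> N p)"
        unfolding \<epsilon>_def w_def by (simp add: sum.distrib[symmetric])
      then have "of_nat N powi (- defect k (?K N)) *
             ((\<Sum>p | p \<in> ?C \<and> finer_compatible k p (?K N). ?a p) + \<epsilon> N) =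
        (\<Sum>p | p \<in> ?C \<and> refines (points k) p (?K N). 1 / of_nat N powi defect k p * ?\<kappa> N p)"
        using N0 by (simp add: sum_distrib_left power_int_diff power_int_minus field_simps)
      then show ?case using exact[OF elim(2,3,1), of i] by simp
    qed
    ultimately show ?thesis by blast
  qed
  show ?thesis using exact asym by blast
qed

end
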